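(* Let $r,\mu,\rho\in\mathbb{R}$, $\sigma>0$, $\lambda=\frac{\mu-r}{\sigma}$, $\gamma>1$, and assume $\rho>(1-\gamma)\left(r+\frac{\lambda^2}{2\gamma}\right)$. Then the constant $a>0$ for which the value function satisfies $V(x)=a\,\frac{x^{1-\gamma}}{1-\gamma}$ for all $x>0$ is $$a=\left(\frac{\rho-(1-\gamma)\left(r+\frac{\lambda^2}{2\gamma}\right)}{\gamma}\right)^{-\gamma};$$ that is, $V(x)=a\,\frac{x^{1-\gamma}}{1-\gamma}$ for all $x>0$ with this value of $a$.
   Context: $W$ is a standard one-dimensional Brownian motion on a filtered probability space $(\Omega,\mathcal{F},\mathbb{F}=(\mathcal{F}_t)_{t\ge0},\mathbb{P})$ satisfying the usual conditions. $\mathbb{R}^+$ denotes the set of nonnegative reals. $L^{2,\mathbb{F}}_{\mathrm{loc}}(\Omega\times[0,\infty);\mathbb{R})$ is the space of $\mathbb{F}$-adapted real-valued (measurable in $(\omega,t)$) processes $Z$ with $\mathbb{E}\left[\int_0^R|Z_t|^2\mathrm{d}t\right]<\infty$ for every $R>0$; $L^{1,\mathbb{F}}_{\mathrm{loc}}(\Omega\times[0,\infty);\mathbb{R}^+)$ is the space of $\mathbb{F}$-adapted $\mathbb{R}^+$-valued (measurable) processes $Z$ with $\mathbb{E}\left[\int_0^R|Z_t|\mathrm{d}t\right]<\infty$ for every $R>0$. For $x>0$, $c\in L^{1,\mathbb{F}}_{\mathrm{loc}}(\Omega\times[0,\infty);\mathbb{R}^+)$ and $\pi\in L^{2,\mathbb{F}}_{\mathrm{loc}}(\Omega\times[0,\infty);\mathbb{R})$,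 the wealth process $X=X^{x;c,\pi}$ is the unique strong solution of $$\mathrm{d}X_t=(rX_t+\sigma\lambda\pi_t)\,\mathrm{d}t+\sigma\pi_t\,\mathrm{d}W_t-c_t\,\mathrm{d}t,\qquad X_0=x.$$ The set of admissible strategies is $$\mathcal{A}(x)=\{(c,\pi)\in L^{1,\mathbb{F}}_{\mathrm{loc}}(\Omega\times[0,\infty);\mathbb{R}^+)\times L^{2,\mathbb{F}}_{\mathrm{loc}}(\Omega\times[0,\infty);\mathbb{R}):\ X^{x;c,\pi}\ge0\}.$$ The objective functional is $J(c)=\mathbb{E}\left[\int_0^\infty e^{-\rho s}\frac{c_s^{1-\gamma}}{1-\gamma}\,\mathrm{d}s\right]\in[-\infty,0]$ (with the convention that $\frac{0^{1-\gamma}}{1-\gamma}=-\infty$), and the value function is $V(x)=\sup_{(c,\pi)\in\mathcal{A}(x)}J(c)\in[-\infty,0]$. *)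

theory Defs
  imports "HOL-Probability.Probability"
begin

text \<open>Stochastic processes are functions \<open>real \<Rightarrow> 'a \<Rightarrow> real\<close> (time first); only times
  \<open>t \<ge> 0\<close> are meaningful, and values at negative times are unconstrained. Of each \<open>F t\<close> only
  the underlying sigma-algebra matters, not the measure it carries.\<close>

locale usual_filtered_prob_space = prob_space M
  for M :: "'a measure" +
  fixes F :: "real \<Rightarrow> 'a measure"
  assumes subalgebra_F: "0 \<le> t \<Longrightarrow> subalgebra M (F t)"
    and mono_F: "0 \<le> s \<Longrightarrow> s \<le> t \<Longrightarrow> sets (F s) \<subseteq> sets (F t)"
    and complete_F: "N \<in> null_sets M \<Longrightarrow> A \<subseteq> N \<Longrightarrow> A \<in> sets (F 0)"
    and right_continuous_F: "0 \<le> t \<Longrightarrow> sets (F t) = (\<Inter>s\<in>{t<..}. sets (F s))"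

definition adapted :: "(real \<Rightarrow> 'a measure) \<Rightarrow> (real \<Rightarrow> 'a \<Rightarrow> real) \<Rightarrow> bool" where
  "adapted F Z \<longleftrightarrow> (\<forall>t\<ge>0. Z t \<in> borel_measurable (F t))"

definition jointly_measurable :: "'a measure \<Rightarrow> (real \<Rightarrow> 'a \<Rightarrow> real) \<Rightarrow> bool" where
  "jointly_measurable M Z \<longleftrightarrow>
     (\<lambda>(\<omega>, t). Z t \<omega>) \<in> borel_measurable (M \<Otimes>\<^sub>M restrict_space borel {0..})"

definition continuous_paths :: "'a measure \<Rightarrow> (real \<Rightarrow> 'a \<Rightarrow> real) \<Rightarrow> bool" where
  "continuous_paths M Z \<longleftrightarrow> (AE \<omega> in M. continuous_on {0..} (\<lambda>t. Z t \<omega>))"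

definition brownian_motion ::
  "'a measure \<Rightarrow> (real \<Rightarrow> 'a measure) \<Rightarrow> (real \<Rightarrow> 'a \<Rightarrow> real) \<Rightarrow> bool" where
  "brownian_motion M F W \<longleftrightarrow>
     adapted F W \<and> continuous_paths M W \<and> (AE \<omega> in M. W 0 \<omega> = 0) \<and>
     (\<forall>s t. 0 \<le> s \<and> s < t \<longrightarrow>
        distributed M lborel (\<lambda>\<omega>. W t \<omega> - W s \<omega>) (normal_density 0 (sqrt (t - s))) \<and>
        prob_space.indep_set M (sets (F s))
          {(\<lambda>\<omega>. W t \<omega> - W s \<omega>) -` B \<inter> space M | B. B \<in> sets borel})"

definition L1_loc :: "'a measure \<Rightarrow> (real \<Rightarrow> 'a measure) \<Rightarrow> (real \<Rightarrow> 'a \<Rightarrow> real) set" where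
  "L1_loc M F = {Z. adapted F Z \<and> jointly_measurable M Z \<and>
     (\<forall>R>0. (\<integral>\<^sup>+\<omega>. (\<integral>\<^sup>+t\<in>{0..R}. ennreal \<bar>Z t \<omega>\<bar> \<partial>lborel) \<partial>M) < \<infinity>)}"

definition L1_loc_nonneg :: "'a measure \<Rightarrow> (real \<Rightarrow> 'a measure) \<Rightarrow> (real \<Rightarrow> 'a \<Rightarrow> real) set" where
  "L1_loc_nonneg M F = {Z \<in> L1_loc M F. \<forall>t\<ge>0. \<forall>\<omega>\<in>space M. 0 \<le> Z t \<omega>}"

definition L2_loc :: "'a measure \<Rightarrow> (real \<Rightarrow> 'a measure) \<Rightarrow> (real \<Rightarrow> 'a \<Rightarrow> real) set" where
  "L2_loc M F = {Z. adapted F Z \<and> jointly_measurable M Z \<and>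
     (\<forall>R>0. (\<integral>\<^sup>+\<omega>. (\<integral>\<^sup>+t\<in>{0..R}. ennreal (\<bar>Z t \<omega>\<bar>\<^sup>2) \<partial>lborel) \<partial>M) < \<infinity>)}"

text \<open>The Ito integral is the usual one: step processes
  \<open>\<Sum>i<n. \<xi> i 1_(\<tau> i, \<tau> (i+1)]\<close> with square-integrable, \<open>F (\<tau> i)\<close>-measurable coefficients are
  integrated elementarily, and the integral of a general integrand is the continuous adapted process
  obtained as the mean-square limit (unique up to indistinguishability).\<close>

definition step_data ::
  "'a measure \<Rightarrow> (real \<Rightarrow> 'a measure) \<Rightarrow> nat \<Rightarrow> (nat \<Rightarrow> real) \<Rightarrow> (nat \<Rightarrow> 'a \<Rightarrow> real) \<Rightarrow> bool" where
  "step_data M F n \<tau> \<xi> \<longleftrightarrow> 0 \<le> \<tau> 0 \<and>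
     (\<forall>i<n. \<tau> i < \<tau> (Suc i) \<and> \<xi> i \<in> borel_measurable (F (\<tau> i)) \<and>
            integrable M (\<lambda>\<omega>. (\<xi> i \<omega>)\<^sup>2))"

definition step_process ::
  "nat \<Rightarrow> (nat \<Rightarrow> real) \<Rightarrow> (nat \<Rightarrow> 'a \<Rightarrow> real) \<Rightarrow> real \<Rightarrow> 'a \<Rightarrow> real" where
  "step_process n \<tau> \<xi> t \<omega> = (\<Sum>i<n. \<xi> i \<omega> * indicator {\<tau> i<..\<tau> (Suc i)} t)"

definition step_integral ::
  "(real \<Rightarrow> 'a \<Rightarrow> real) \<Rightarrow> nat \<Rightarrow> (nat \<Rightarrow> real) \<Rightarrow> (nat \<Rightarrow> 'a \<Rightarrow> real) \<Rightarrow> real \<Rightarrow> 'a \<Rightarrow> real" where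
  "step_integral W n \<tau> \<xi> t \<omega> =
     (\<Sum>i<n. \<xi> i \<omega> * (W (min t (\<tau> (Suc i))) \<omega> - W (min t (\<tau> i)) \<omega>))"

definition ito_integral ::
  "'a measure \<Rightarrow> (real \<Rightarrow> 'a measure) \<Rightarrow> (real \<Rightarrow> 'a \<Rightarrow> real) \<Rightarrow>
   (real \<Rightarrow> 'a \<Rightarrow> real) \<Rightarrow> (real \<Rightarrow> 'a \<Rightarrow> real) \<Rightarrow> bool" where
  "ito_integral M F W H I \<longleftrightarrow>
     H \<in> L2_loc M F \<and> adapted F I \<and> continuous_paths M I \<and>
     (\<forall>T\<ge>0. \<exists>n \<tau> \<xi>. (\<forall>k::nat. step_data M F (n k) (\<tau> k) (\<xi> k)) \<and>
        (\<lambda>k. \<integral>\<^sup>+\<omega>. (\<integral>\<^sup>+t\<in>{0..T}.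
               ennreal ((step_process (n k) (\<tau> k) (\<xi> k) t \<omega> - H t \<omega>)\<^sup>2) \<partial>lborel) \<partial>M)
          \<longlonglongrightarrow> 0 \<and>
        (\<lambda>k. \<integral>\<^sup>+\<omega>. ennreal ((step_integral W (n k) (\<tau> k) (\<xi> k) T \<omega> - I T \<omega>)\<^sup>2) \<partial>M)
          \<longlonglongrightarrow> 0)"

text \<open>\<open>X\<close> is a strong solution of
  \<open>dX = (r X + \<sigma> lam \<pi>) dt + \<sigma> \<pi> dW - c dt\<close>, \<open>X 0 = x\<close>, read in integrated form.\<close>

definition wealth_process ::
  "'a measure \<Rightarrow> (real \<Rightarrow> 'a measure) \<Rightarrow> (real \<Rightarrow> 'a \<Rightarrow> real) \<Rightarrow> real \<Rightarrow> real \<Rightarrow> real \<Rightarrow>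
   real \<Rightarrow> (real \<Rightarrow> 'a \<Rightarrow> real) \<Rightarrow> (real \<Rightarrow> 'a \<Rightarrow> real) \<Rightarrow> (real \<Rightarrow> 'a \<Rightarrow> real) \<Rightarrow> bool" where
  "wealth_process M F W r \<sigma> lam x c \<pi> X \<longleftrightarrow>
     adapted F X \<and> continuous_paths M X \<and>
     (\<exists>I. ito_integral M F W (\<lambda>t \<omega>. \<sigma> * \<pi> t \<omega>) I \<and>
        (AE \<omega> in M. \<forall>t\<ge>0.
           set_integrable lborel {0..t} (\<lambda>s. r * X s \<omega> + \<sigma> * lam * \<pi> s \<omega> - c s \<omega>) \<and>
           X t \<omega> = x + (LINT s:{0..t}|lborel. r * X s \<omega> + \<sigma> * lam * \<pi> s \<omega> - c s \<omega>) + I t \<omega>))"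

text \<open>Since the wealth process of a strategy exists and is unique up to indistinguishability,
  nonnegativity is expressed for some version of it.\<close>

definition admissible ::
  "'a measure \<Rightarrow> (real \<Rightarrow> 'a measure) \<Rightarrow> (real \<Rightarrow> 'a \<Rightarrow> real) \<Rightarrow> real \<Rightarrow> real \<Rightarrow> real \<Rightarrow>
   real \<Rightarrow> ((real \<Rightarrow> 'a \<Rightarrow> real) \<times> (real \<Rightarrow> 'a \<Rightarrow> real)) set" where
  "admissible M F W r \<sigma> lam x =
     {(c, \<pi>). c \<in> L1_loc_nonneg M F \<and> \<pi> \<in> L2_loc M F \<and>
        (\<exists>X. wealth_process M F W r \<sigma> lam x c \<pi> X \<and> (AE \<omega> in M. \<forall>t\<ge>0. 0 \<le> X t \<omega>))}"

text \<open>The case distinction is needed because \<open>0 powr (1 - \<gamma>) = 0\<close> in the library.\<close>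

definition utility :: "real \<Rightarrow> real \<Rightarrow> ereal" where
  "utility \<gamma> y = (if y = 0 then - \<infinity> else ereal (y powr (1 - \<gamma>) / (1 - \<gamma>)))"

text \<open>For \<open>\<gamma> > 1\<close> the integrand is nonpositive with values in \<open>[-\<infinity>, 0]\<close>, so its expected
  integral is minus the Lebesgue integral of its negation.\<close>

definition objective :: "'a measure \<Rightarrow> real \<Rightarrow> real \<Rightarrow> (real \<Rightarrow> 'a \<Rightarrow> real) \<Rightarrow> ereal" where
  "objective M \<rho> \<gamma> c =
     - enn2ereal (\<integral>\<^sup>+\<omega>. (\<integral>\<^sup>+s\<in>{0..}.
         e2ennreal (- (ereal (exp (- \<rho> * s)) * utility \<gamma> (c s \<omega>))) \<partial>lborel) \<partial>M)"

definition value_function ::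
  "'a measure \<Rightarrow> (real \<Rightarrow> 'a measure) \<Rightarrow> (real \<Rightarrow> 'a \<Rightarrow> real) \<Rightarrow> real \<Rightarrow> real \<Rightarrow> real \<Rightarrow>
   real \<Rightarrow> real \<Rightarrow> real \<Rightarrow> ereal" where
  "value_function M F W r \<sigma> lam \<rho> \<gamma> x =
     (SUP (c, \<pi>) \<in> admissible M F W r \<sigma> lam x. objective M \<rho> \<gamma> c)"

end

theory Submission
  imports Defs
begin

text \<open>
  Let \<open>Z t = exp (- lam W t - lam\<^sup>2 t / 2)\<close>, so that \<open>exp (- r t) Z t\<close> is the state price density.
  Testing the wealth equation against \<open>Z\<close> gives the budget constraint
  \<open>E (\<integral> exp (- r s) Z s c s ds) \<le> x\<close> for every admissible consumption \<open>c\<close>. No Ito formula is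
  needed: pairing a step integral with \<open>Z\<close> turns \<open>dW\<close> into \<open>- lam dt\<close> by independence of
  increments, this passes to mean-square limits, and the linear drift is removed pathwise.

  The candidate optimum is \<open>c\<^sup>* = k X\<^sup>*\<close> for a geometric Brownian motion \<open>X\<^sup>*\<close>, where
  \<open>k = a powr (- 1 / \<gamma>)\<close>; it satisfies \<open>exp (- \<rho> s) (c\<^sup>* s) powr (- \<gamma>) = y exp (- r s) Z s\<close> with
  \<open>y = (k x) powr (- \<gamma>)\<close>. Hence the tangent inequality of the utility at \<open>c\<^sup>*\<close>, integrated
  against the budget constraint, bounds \<open>J(c)\<close> by \<open>J(c\<^sup>*)\<close>, which is a Gaussian integral. That \<open>X\<^sup>*\<close>
  solves the wealth equation is checked on uniform grids: the error of the left-endpoint sums is a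
  sum of orthogonal terms of variance \<open>O(h\<^sup>2)\<close> plus a Riemann sum error.
\<close>

section \<open>Brownian increments and the exponential martingale\<close>

text \<open>Two integrability gaps shape the budget argument. Consumption is only locally
  integrable, so \<open>Z t * c u\<close> and \<open>Z t * X t\<close> cannot be integrated term by
  term. The wealth equation is therefore solved pathwise for the discounted wealth plus discounted
  consumption, which leaves an expression in square-integrable data whose expectation can be
  computed. Moreover the state price is first frozen at the terminal time, so that one random weight
  meets every term; Tonelli and the martingale property turn \<open>Z t\<close> back into
  \<open>Z u\<close> afterwards. The coefficients of the candidate come from matching exponents. Its
  marginal utility contains \<open>W\<close> with factor \<open>- \<gamma> * \<theta>\<close>, which
  must be \<open>- lam\<close>; hence \<theta> = lam / \<gamma>, that is, the fraction \<theta> /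
  \<sigma> of wealth is invested. The drift \<delta> = r + lam * \<theta> - k is what the wealth
  equation leaves after consuming at rate k, and \<gamma> * k = \<rho> - (1 - \<gamma>) * (r + lam^2
  / (2 * \<gamma>)) makes the remaining exponents agree. Finally y * x is exactly \<gamma> - 1 times
  the disutility of the candidate, so the tangent inequality closes without slack.\<close>

lemma (in prob_space) indep_var_nn_integral:
  fixes X Y :: "'a \<Rightarrow> ennreal"
  assumes "indep_var borel X borel Y"
  shows "(\<integral>\<^sup>+w. X w * Y w \<partial>M) = (\<integral>\<^sup>+w. X w \<partial>M) * (\<integral>\<^sup>+w. Y w \<partial>M)"
proof -
  have eq: "case_bool borel borel = (\<lambda>_. borel)"
    by (rule ext) (simp split: bool.split)
  have "indep_vars (\<lambda>_. borel) (case_bool X Y) UNIV"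
    using assms by (simp add: indep_var_def eq)
  from indep_vars_nn_integral[OF _ this]
  show ?thesis
    by (simp add: UNIV_bool mult.commute)
qed

text \<open>Completing the square: an exponential tilt of a centred Gaussian only shifts its mean.
  This one-dimensional Girsanov fact is the source of all exponential moments below.\<close>

lemma normal_density_exp_tilt:
  assumes "\<sigma> > 0"
  shows "normal_density 0 \<sigma> x * exp (\<theta> * x - \<theta>\<^sup>2 * \<sigma>\<^sup>2 / 2) = normal_density (\<theta> * \<sigma>\<^sup>2) \<sigma> x"
proof -
  have "- (x\<^sup>2) / (2 * \<sigma>\<^sup>2) + (\<theta> * x - \<theta>\<^sup>2 * \<sigma>\<^sup>2 / 2) = - ((x - \<theta> * \<sigma>\<^sup>2)\<^sup>2) / (2 * \<sigma>\<^sup>2)"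
    using assms by (simp add: field_simps power2_eq_square)
  then show ?thesis
    unfolding normal_density_def by (simp add: mult.assoc flip: exp_add)
qed

text \<open>Continuity and the start at 0 are required for every sample point instead of almost
  every one, so that joint measurability and pathwise integrals involve no exceptional set.
  \<open>brownian_version\<close> reduces the general case to this one.\<close>

locale brownian = usual_filtered_prob_space M F
  for M :: "'a measure" and F :: "real \<Rightarrow> 'a measure" +
  fixes W :: "real \<Rightarrow> 'a \<Rightarrow> real"
  assumes W_adapted: "0 \<le> t \<Longrightarrow> W t \<in> borel_measurable (F t)"
    and W_continuous: "w \<in> space M \<Longrightarrow> continuous_on {0..} (\<lambda>t. W t w)"
    and W_0: "w \<in> space M \<Longrightarrow> W 0 w = 0"
    and W_distributed: "0 \<le> s \<Longrightarrow> s < t \<Longrightarrow>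
        distributed M lborel (\<lambda>w. W t w - W s w) (normal_density 0 (sqrt (t - s)))"
    and W_indep: "0 \<le> s \<Longrightarrow> s < t \<Longrightarrow>
        indep_set (sets (F s)) {(\<lambda>w. W t w - W s w) -` B \<inter> space M | B. B \<in> sets borel}"

lemma (in usual_filtered_prob_space) measurable_F_le:
  assumes "0 \<le> s" "s \<le> t" "f \<in> measurable (F s) N"
  shows "f \<in> measurable (F t) N"
  using assms subalgebra_F[of s] subalgebra_F[of t] mono_F[of s t]
  unfolding subalgebra_def measurable_def by auto

lemma (in usual_filtered_prob_space) measurable_F_M:
  assumes "0 \<le> s" "f \<in> measurable (F s) N"
  shows "f \<in> measurable M N"
  using assms subalgebra_F measurable_from_subalg by blast

context brownian
begin

lemma W_measurable_F: "0 \<le> s \<Longrightarrow> s \<le> t \<Longrightarrow> W s \<in> borel_measurable (F t)"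
  using W_adapted measurable_F_le by blast

lemma W_measurable_M: "0 \<le> s \<Longrightarrow> W s \<in> borel_measurable M"
  using W_adapted measurable_F_M by blast

text \<open>Independence is postulated for set families, whereas \<open>indep_var\<close> speaks of
  generated sigma-algebras. The preimages under the increment are intersection-stable, which
  licenses the passage.\<close>

lemma indep_var_increment:
  fixes A :: "'a \<Rightarrow> real"
  assumes "0 \<le> s" "s < t" "A \<in> measurable (F s) N"
  shows "indep_var N A borel (\<lambda>w. W t w - W s w)"
proof -
  let ?D = "\<lambda>w. W t w - W s w"
  let ?B = "{?D -` B \<inter> space M | B. B \<in> sets borel}"
  have D: "?D \<in> borel_measurable M"
    using assms by (intro borel_measurable_diff W_measurable_M) auto
  have sp: "space (F s) = space M"
    using subalgebra_F[of s] assms by (auto simp: subalgebra_def)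
  have sub: "sigma_sets (space M) {A -` B \<inter> space M | B. B \<in> sets N} \<subseteq> sets (F s)"
    unfolding sp[symmetric]
    using measurable_sets[OF assms(3)] by (intro sets.sigma_sets_subset) auto
  have st: "Int_stable ?B"
  proof (rule Int_stableI)
    fix a b assume "a \<in> ?B" "b \<in> ?B"
    then obtain B C where "a = ?D -` B \<inter> space M" "b = ?D -` C \<inter> space M" "B \<in> sets borel" "C \<in> sets borel"
      by blast
    then show "a \<inter> b \<in> ?B"
      by (auto intro!: exI[of _ "B \<inter> C"])
  qed
  have "indep_set (sigma_sets (space M) (sets (F s))) (sigma_sets (space M) ?B)"
    using W_indep[OF assms(1,2)] st
    by (intro indep_set_sigma_sets) (auto simp: Int_stable_def)
  moreover have "sigma_sets (space M) (sets (F s)) = sets (F s)"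
    using sets.sigma_sets_eq[of "F s"] sp by simp
  ultimately have ind: "indep_set (sets (F s)) (sigma_sets (space M) ?B)"
    by simp
  have "indep_set (sigma_sets (space M) {A -` B \<inter> space M | B. B \<in> sets N}) (sigma_sets (space M) ?B)"
    using ind sub unfolding indep_sets2_eq by blast
  then show ?thesis
    unfolding indep_var_eq using D measurable_F_M[OF assms(1,3)] by blast
qed

lemma nn_integral_mult_increment:
  fixes A g :: "_ \<Rightarrow> real"
  assumes "0 \<le> s" "s \<le> t" "A \<in> borel_measurable (F s)" "g \<in> borel_measurable borel"
  shows "(\<integral>\<^sup>+w. ennreal (A w) * ennreal (g (W t w - W s w)) \<partial>M)
    = (\<integral>\<^sup>+w. ennreal (A w) \<partial>M) * (\<integral>\<^sup>+w. ennreal (g (W t w - W s w)) \<partial>M)"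
\<comment> \<open>Independence is only available for s < t; for s = t the second factor is a
  constant.\<close>
proof (cases "s = t")
  case True
  have "A \<in> borel_measurable M" using measurable_F_M assms by blast
  then show ?thesis using True by (simp add: nn_integral_multc emeasure_space_1)
next
  case False
  have "indep_var borel (ennreal \<circ> A) borel ((\<lambda>x. ennreal (g x)) \<circ> (\<lambda>w. W t w - W s w))"
    using assms False
    by (intro indep_var_compose[OF indep_var_increment[OF assms(1) _ assms(3)]]) auto
  from indep_var_nn_integral[OF this] show ?thesis by (simp add: comp_def)
qed

lemma integral_mult_increment:
  fixes A :: "'a \<Rightarrow> real" and g :: "real \<Rightarrow> real"
  assumes "0 \<le> s" "s \<le> t" "A \<in> borel_measurable (F s)" "g \<in> borel_measurable borel"
    and "integrable M A" "integrable M (\<lambda>w. g (W t w - W s w))"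
  shows "integrable M (\<lambda>w. A w * g (W t w - W s w))"
    and "expectation (\<lambda>w. A w * g (W t w - W s w))
      = expectation A * expectation (\<lambda>w. g (W t w - W s w))"
proof -
  have "integrable M (\<lambda>w. A w * g (W t w - W s w)) \<and>
     expectation (\<lambda>w. A w * g (W t w - W s w))
      = expectation A * expectation (\<lambda>w. g (W t w - W s w))"
  proof (cases "s = t")
    case True
    then show ?thesis using assms by (simp add: prob_space)
  next
    case False
    have "indep_var borel ((\<lambda>x. x) \<circ> A) borel (g \<circ> (\<lambda>w. W t w - W s w))"
      using assms False by (intro indep_var_compose[OF indep_var_increment[OF assms(1) _ assms(3)]]) auto
    then have *: "indep_var borel A borel (\<lambda>w. g (W t w - W s w))" by (simp add: comp_def)
    from indep_var_lebesgue_integral[OF *] indep_var_integrable[OF *] show ?thesis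
      using assms by simp
  qed
  then show "integrable M (\<lambda>w. A w * g (W t w - W s w))"
    "expectation (\<lambda>w. A w * g (W t w - W s w))
      = expectation A * expectation (\<lambda>w. g (W t w - W s w))" by auto
qed

text \<open>After the tilt, any moment of the increment is a moment of a Gaussian with mean \<theta>
  * (t - s). The choice \<theta> = 0 returns the ordinary moments.\<close>

lemma increment_tilted_integral:
  assumes st: "0 \<le> s" "s < t" and g: "g \<in> borel_measurable borel"
    and i: "has_bochner_integral lborel (\<lambda>x. normal_density (\<theta> * (t - s)) (sqrt (t - s)) x * g x) v"
  shows "has_bochner_integral M
    (\<lambda>w. exp (\<theta> * (W t w - W s w) - \<theta>\<^sup>2 * (t - s) / 2) * g (W t w - W s w)) v"
proof -
  let ?g = "\<lambda>x. exp (\<theta> * x - \<theta>\<^sup>2 * (t - s) / 2) * g x"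
  note D = W_distributed[OF st]
  have m: "?g \<in> borel_measurable lborel" using g by measurable
  have eq: "normal_density 0 (sqrt (t - s)) x * ?g x = normal_density (\<theta> * (t - s)) (sqrt (t - s)) x * g x" for x
    using normal_density_exp_tilt[of "sqrt (t - s)" x \<theta>] st by (simp flip: mult.assoc)
  show ?thesis
    using distributed_integral[OF D m] distributed_integrable[OF D m] i
    unfolding has_bochner_integral_iff eq by simp
qed

text \<open>These are the total mass and the mean of the shifted Gaussian. The nonzero mean \<theta>
  * (t - s) is where the later replacement of dW by \<theta> dt originates.\<close>

lemma exp_increment:
  assumes "0 \<le> s" "s \<le> t"
  shows "has_bochner_integral M (\<lambda>w. exp (\<theta> * (W t w - W s w) - \<theta>\<^sup>2 * (t - s) / 2)) 1"
    and "has_bochner_integral M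
      (\<lambda>w. exp (\<theta> * (W t w - W s w) - \<theta>\<^sup>2 * (t - s) / 2) * (W t w - W s w)) (\<theta> * (t - s))"
proof -
  have "has_bochner_integral M (\<lambda>w. exp (\<theta> * (W t w - W s w) - \<theta>\<^sup>2 * (t - s) / 2)) 1 \<and>
    has_bochner_integral M
      (\<lambda>w. exp (\<theta> * (W t w - W s w) - \<theta>\<^sup>2 * (t - s) / 2) * (W t w - W s w)) (\<theta> * (t - s))"
  proof (cases "s = t")
    case True
    then show ?thesis by (simp add: has_bochner_integral_iff prob_space)
  next
    case False
    then have st: "s < t" using assms by simp
    have "has_bochner_integral lborel (\<lambda>x. normal_density (\<theta> * (t - s)) (sqrt (t - s)) x * 1) 1"
      using st by (simp add: has_bochner_integral_iff)
    from increment_tilted_integral[OF assms(1) st _ this]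
      increment_tilted_integral[OF assms(1) st _ normal_moment_nz_1]
    show ?thesis using st by simp
  qed
  then show "has_bochner_integral M (\<lambda>w. exp (\<theta> * (W t w - W s w) - \<theta>\<^sup>2 * (t - s) / 2)) 1"
    "has_bochner_integral M
      (\<lambda>w. exp (\<theta> * (W t w - W s w) - \<theta>\<^sup>2 * (t - s) / 2) * (W t w - W s w)) (\<theta> * (t - s))" by auto
qed

lemma increment_mean:
  assumes "0 \<le> s" "s \<le> t"
  shows "has_bochner_integral M (\<lambda>w. W t w - W s w) 0"
  using exp_increment(2)[OF assms, of 0] by simp

lemma increment_second_moment:
  assumes "0 \<le> s" "s \<le> t"
  shows "has_bochner_integral M (\<lambda>w. (W t w - W s w)\<^sup>2) (t - s)"
proof (cases "s = t")
  case False
  then have st: "s < t" using assms by simp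
  have "has_bochner_integral lborel (\<lambda>x. normal_density 0 (sqrt (t - s)) x * x\<^sup>2) (t - s)"
    using normal_moment_even[of "sqrt (t - s)" 0 1] st by (simp add: eval_nat_numeral diff_divide_distrib)
  from increment_tilted_integral[OF assms(1) st _, of "\<lambda>x. x\<^sup>2" 0] this show ?thesis by simp
qed (simp add: has_bochner_integral_iff)

text \<open>The stochastic exponential of \<theta> * W. With \<theta> = - lam it is the density
  \<open>Z\<close> of the overview; with \<theta> = lam / \<gamma> it drives the candidate
  wealth.\<close>

definition G :: "real \<Rightarrow> real \<Rightarrow> 'a \<Rightarrow> real" where
  "G \<theta> t w = exp (\<theta> * W t w - \<theta>\<^sup>2 * t / 2)"

lemma G_pos [simp]: "G \<theta> t w > 0" and G_nonneg [simp]: "G \<theta> t w \<ge> 0"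
  by (simp_all add: G_def)

lemma G_split: "G \<theta> t w = G \<theta> s w * exp (\<theta> * (W t w - W s w) - \<theta>\<^sup>2 * (t - s) / 2)"
  unfolding G_def by (simp flip: exp_add) (simp add: field_simps)

lemma G_measurable_F: "0 \<le> s \<Longrightarrow> s \<le> t \<Longrightarrow> G \<theta> s \<in> borel_measurable (F t)"
  unfolding G_def using W_measurable_F[of s t] by measurable

lemma G_measurable_M: "0 \<le> s \<Longrightarrow> G \<theta> s \<in> borel_measurable M"
  using G_measurable_F[of s s] measurable_F_M by blast

lemma exp_increment_nn:
  assumes "0 \<le> s" "s \<le> t"
  shows "(\<integral>\<^sup>+w. ennreal (exp (\<theta> * (W t w - W s w) - \<theta>\<^sup>2 * (t - s) / 2)) \<partial>M) = 1"
  using exp_increment(1)[OF assms, of \<theta>]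
  by (subst nn_integral_eq_integral) (auto simp: has_bochner_integral_iff)

text \<open>The version without integrability assumption, as required for consumption: nothing is
  known about \<open>c u * G \<theta> u\<close> before the budget bound is proved.\<close>

lemma G_martingale_nn:
  assumes "0 \<le> s" "s \<le> t" "A \<in> borel_measurable (F s)"
  shows "(\<integral>\<^sup>+w. ennreal (A w * G \<theta> t w) \<partial>M) = (\<integral>\<^sup>+w. ennreal (A w * G \<theta> s w) \<partial>M)"
proof -
  let ?g = "\<lambda>x. exp (\<theta> * x - \<theta>\<^sup>2 * (t - s) / 2)"
  have m: "(\<lambda>w. A w * G \<theta> s w) \<in> borel_measurable (F s)"
    using assms G_measurable_F[of s s] by measurable
  have "(\<integral>\<^sup>+w. ennreal (A w * G \<theta> t w) \<partial>M)
      = (\<integral>\<^sup>+w. ennreal (A w * G \<theta> s w) * ennreal (?g (W t w - W s w)) \<partial>M)"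
    by (subst G_split[of \<theta> t _ s]) (simp add: ennreal_mult'' mult.assoc)
  also have "\<dots> = (\<integral>\<^sup>+w. ennreal (A w * G \<theta> s w) \<partial>M)"
    using exp_increment_nn[OF assms(1,2), of \<theta>]
    by (subst nn_integral_mult_increment[OF assms(1,2) m]) auto
  finally show ?thesis .
qed

lemma G_martingale:
  fixes A :: "'a \<Rightarrow> real"
  assumes "0 \<le> s" "s \<le> t" "A \<in> borel_measurable (F s)" "integrable M (\<lambda>w. A w * G \<theta> s w)"
  shows "integrable M (\<lambda>w. A w * G \<theta> t w)"
    and "expectation (\<lambda>w. A w * G \<theta> t w) = expectation (\<lambda>w. A w * G \<theta> s w)"
proof -
  have m: "(\<lambda>w. A w * G \<theta> s w) \<in> borel_measurable (F s)"
    using assms G_measurable_F[of s s] by measurable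
  have eq: "A w * G \<theta> t w = (A w * G \<theta> s w) * exp (\<theta> * (W t w - W s w) - \<theta>\<^sup>2 * (t - s) / 2)" for w
    by (subst G_split[of \<theta> t _ s]) (simp add: mult.assoc)
  note * = integral_mult_increment[OF assms(1,2) m _ assms(4), of "\<lambda>x. exp (\<theta> * x - \<theta>\<^sup>2 * (t - s) / 2)"]
  show "integrable M (\<lambda>w. A w * G \<theta> t w)"
    "expectation (\<lambda>w. A w * G \<theta> t w) = expectation (\<lambda>w. A w * G \<theta> s w)"
    unfolding eq using * exp_increment(1)[OF assms(1,2), of \<theta>] by (auto simp: has_bochner_integral_iff)
qed

lemma exp_W_mean:
  assumes "0 \<le> t"
  shows "has_bochner_integral M (\<lambda>w. exp (\<theta> * W t w)) (exp (\<theta>\<^sup>2 * t / 2))"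
proof -
  have "has_bochner_integral M (\<lambda>w. exp (\<theta>\<^sup>2 * t / 2) * exp (\<theta> * (W t w - W 0 w) - \<theta>\<^sup>2 * (t - 0) / 2))
     (exp (\<theta>\<^sup>2 * t / 2) * 1)"
    using assms by (intro has_bochner_integral_mult_right exp_increment(1)) auto
  then show ?thesis
    by (subst (asm) has_bochner_integral_cong[OF refl _ refl, where g="\<lambda>w. exp (\<theta> * W t w)"])
      (auto simp: W_0 simp flip: exp_add)
qed

lemma G_mean: "0 \<le> t \<Longrightarrow> has_bochner_integral M (G \<theta> t) 1"
proof -
  assume "0 \<le> t"
  from has_bochner_integral_mult_left[OF exp_W_mean[OF this, of \<theta>], of "exp (- \<theta>\<^sup>2 * t / 2)"]
  show ?thesis unfolding G_def by (simp flip: exp_add)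
qed

lemma G_sq_mean: "0 \<le> t \<Longrightarrow> has_bochner_integral M (\<lambda>w. (G \<theta> t w)\<^sup>2) (exp (\<theta>\<^sup>2 * t))"
proof -
  assume "0 \<le> t"
  from has_bochner_integral_mult_left[OF exp_W_mean[OF this, of "2 * \<theta>"], of "exp (- \<theta>\<^sup>2 * t)"]
  show ?thesis unfolding G_def
    by (simp add: power_mult_distrib algebra_simps power2_eq_square flip: exp_add)
qed

end

section \<open>Mean-square limits and joint measurability\<close>

lemma integrable_mult_square:
  fixes f g :: "'a \<Rightarrow> real"
  assumes [measurable]: "f \<in> borel_measurable N" "g \<in> borel_measurable N"
    and "integrable N (\<lambda>x. (f x)\<^sup>2)" "integrable N (\<lambda>x. (g x)\<^sup>2)"
  shows "integrable N (\<lambda>x. f x * g x)"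
proof (rule Bochner_Integration.integrable_bound)
  show "integrable N (\<lambda>x. (f x)\<^sup>2 + (g x)\<^sup>2)" using assms by simp
  have "\<bar>a * b\<bar> \<le> a\<^sup>2 + b\<^sup>2" for a b :: real
  proof -
    have "2 * \<bar>a\<bar> * \<bar>b\<bar> \<le> a\<^sup>2 + b\<^sup>2" using sum_squares_bound[of "\<bar>a\<bar>" "\<bar>b\<bar>"] by simp
    moreover have "0 \<le> \<bar>a\<bar> * \<bar>b\<bar>" by simp
    ultimately show ?thesis unfolding abs_mult by linarith
  qed
  then show "AE x in N. norm (f x * g x) \<le> norm ((f x)\<^sup>2 + (g x)\<^sup>2)"
    by simp
qed simp

lemma Cauchy_Schwarz_integral:
  fixes f g :: "'a \<Rightarrow> real"
  assumes [measurable]: "f \<in> borel_measurable N" "g \<in> borel_measurable N"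
    and i: "integrable N (\<lambda>x. (f x)\<^sup>2)" "integrable N (\<lambda>x. (g x)\<^sup>2)"
  shows "(\<integral>x. f x * g x \<partial>N)\<^sup>2 \<le> (\<integral>x. (f x)\<^sup>2 \<partial>N) * (\<integral>x. (g x)\<^sup>2 \<partial>N)"
proof -
  have int: "integrable N (\<lambda>x. \<bar>f x\<bar> * \<bar>g x\<bar>)"
    using integrable_mult_square[of "\<lambda>x. \<bar>f x\<bar>" N "\<lambda>x. \<bar>g x\<bar>"] i by simp
  have "(\<integral>\<^sup>+x. ennreal \<bar>f x\<bar> * ennreal \<bar>g x\<bar> \<partial>N) = ennreal (\<integral>x. \<bar>f x\<bar> * \<bar>g x\<bar> \<partial>N)"
    using nn_integral_eq_integral[OF int] by (simp add: ennreal_mult)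
  with Cauchy_Schwarz_nn_integral[of "\<lambda>x. ennreal \<bar>f x\<bar>" N "\<lambda>x. ennreal \<bar>g x\<bar>"]
  have "ennreal ((\<integral>x. \<bar>f x\<bar> * \<bar>g x\<bar> \<partial>N)\<^sup>2) \<le> ennreal ((\<integral>x. (f x)\<^sup>2 \<partial>N) * (\<integral>x. (g x)\<^sup>2 \<partial>N))"
    by (simp add: nn_integral_eq_integral i ennreal_power ennreal_mult)
  then have *: "(\<integral>x. \<bar>f x\<bar> * \<bar>g x\<bar> \<partial>N)\<^sup>2 \<le> (\<integral>x. (f x)\<^sup>2 \<partial>N) * (\<integral>x. (g x)\<^sup>2 \<partial>N)"
    by (subst (asm) ennreal_le_iff) auto
  have "\<bar>\<integral>x. f x * g x \<partial>N\<bar> \<le> (\<integral>x. \<bar>f x\<bar> * \<bar>g x\<bar> \<partial>N)"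
    using integral_norm_bound[of N "\<lambda>x. f x * g x"] by (simp add: abs_mult)
  then have "(\<integral>x. f x * g x \<partial>N)\<^sup>2 \<le> (\<integral>x. \<bar>f x\<bar> * \<bar>g x\<bar> \<partial>N)\<^sup>2"
    by (metis abs_ge_zero power2_abs power_mono)
  with * show ?thesis by linarith
qed

text \<open>The distances are Lebesgue integrals that may be infinite for early k. Finiteness holds
  eventually, and a single good k already makes the limit square integrable.\<close>

lemma L2_limit_integrable:
  fixes f :: "'a \<Rightarrow> real" and u :: "nat \<Rightarrow> 'a \<Rightarrow> real"
  assumes [measurable]: "f \<in> borel_measurable N" "\<And>k. u k \<in> borel_measurable N"
    and i: "\<And>k. integrable N (\<lambda>x. (u k x)\<^sup>2)"
    and lim: "(\<lambda>k. \<integral>\<^sup>+x. ennreal ((u k x - f x)\<^sup>2) \<partial>N) \<longlonglongrightarrow> 0"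
  shows "integrable N (\<lambda>x. (f x)\<^sup>2)"
    and "eventually (\<lambda>k. integrable N (\<lambda>x. (u k x - f x)\<^sup>2)) sequentially"
    and "(\<lambda>k. \<integral>x. (u k x - f x)\<^sup>2 \<partial>N) \<longlonglongrightarrow> 0"
proof -
  have "eventually (\<lambda>k. (\<integral>\<^sup>+x. ennreal ((u k x - f x)\<^sup>2) \<partial>N) < 1) sequentially"
    using order_tendstoD(2)[OF lim, of 1] by simp
  then show ev: "eventually (\<lambda>k. integrable N (\<lambda>x. (u k x - f x)\<^sup>2)) sequentially"
  proof eventually_elim
    case (elim k)
    then have "(\<integral>\<^sup>+x. ennreal ((u k x - f x)\<^sup>2) \<partial>N) < \<infinity>"
      by (rule order.strict_trans) simp
    then show ?case by (intro integrableI_nonneg) auto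
  qed
  then obtain k where k: "integrable N (\<lambda>x. (u k x - f x)\<^sup>2)"
    by (auto simp: eventually_sequentially)
  show "integrable N (\<lambda>x. (f x)\<^sup>2)"
  proof (rule Bochner_Integration.integrable_bound)
    show "integrable N (\<lambda>x. 2 * (u k x)\<^sup>2 + 2 * (u k x - f x)\<^sup>2)" using i k by simp
    \<comment> \<open>The difference of the two sides is the square of 2 * a - b.\<close>
    have "b\<^sup>2 \<le> 2 * a\<^sup>2 + 2 * (a - b)\<^sup>2" for a b :: real
      using zero_le_power2[of "2 * a - b"] by (simp add: power2_eq_square algebra_simps)
    then show "AE x in N. norm ((f x)\<^sup>2) \<le> norm (2 * (u k x)\<^sup>2 + 2 * (u k x - f x)\<^sup>2)"
      by simp
  qed simp
  have "eventually (\<lambda>k. (\<integral>\<^sup>+x. ennreal ((u k x - f x)\<^sup>2) \<partial>N) = ennreal (\<integral>x. (u k x - f x)\<^sup>2 \<partial>N)) sequentially"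
    using ev by eventually_elim (simp add: nn_integral_eq_integral)
  from Lim_transform_eventually[OF lim this]
  have "(\<lambda>k. ennreal (\<integral>x. (u k x - f x)\<^sup>2 \<partial>N)) \<longlonglongrightarrow> ennreal 0" by simp
  then show "(\<lambda>k. \<integral>x. (u k x - f x)\<^sup>2 \<partial>N) \<longlonglongrightarrow> 0"
    by (subst (asm) tendsto_ennreal_iff) auto
qed

text \<open>By Cauchy-Schwarz the pairings differ by at most the norm of \<open>g\<close> times the
  mean-square distance. It serves to extend the pairing identity from step processes to general
  integrands.\<close>

lemma L2_limit_pairing:
  fixes f g :: "'a \<Rightarrow> real" and u :: "nat \<Rightarrow> 'a \<Rightarrow> real"
  assumes [measurable]: "f \<in> borel_measurable N" "\<And>k. u k \<in> borel_measurable N" "g \<in> borel_measurable N"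
    and i: "\<And>k. integrable N (\<lambda>x. (u k x)\<^sup>2)" and g: "integrable N (\<lambda>x. (g x)\<^sup>2)"
    and lim: "(\<lambda>k. \<integral>\<^sup>+x. ennreal ((u k x - f x)\<^sup>2) \<partial>N) \<longlonglongrightarrow> 0"
  shows "(\<lambda>k. \<integral>x. g x * u k x \<partial>N) \<longlonglongrightarrow> (\<integral>x. g x * f x \<partial>N)"
proof -
  note L = L2_limit_integrable[OF assms(1,2) i lim]
  let ?G = "\<integral>x. (g x)\<^sup>2 \<partial>N"
  have gu: "integrable N (\<lambda>x. g x * u k x)" for k by (rule integrable_mult_square) (use g i in auto)
  have gf: "integrable N (\<lambda>x. g x * f x)" by (rule integrable_mult_square) (use g L(1) in auto)
  have "(\<lambda>k. sqrt (?G * (\<integral>x. (u k x - f x)\<^sup>2 \<partial>N))) \<longlonglongrightarrow> sqrt (?G * 0)"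
    by (intro tendsto_intros L)
  then have z: "(\<lambda>k. sqrt (?G * (\<integral>x. (u k x - f x)\<^sup>2 \<partial>N))) \<longlonglongrightarrow> 0" by simp
  have "eventually (\<lambda>k. norm ((\<integral>x. g x * u k x \<partial>N) - (\<integral>x. g x * f x \<partial>N))
      \<le> sqrt (?G * (\<integral>x. (u k x - f x)\<^sup>2 \<partial>N))) sequentially"
    using L(2)
  proof eventually_elim
    case (elim k)
    have "(\<integral>x. g x * u k x \<partial>N) - (\<integral>x. g x * f x \<partial>N) = (\<integral>x. g x * (u k x - f x) \<partial>N)"
      using gu gf by (simp add: right_diff_distrib)
    moreover have "(\<integral>x. g x * (u k x - f x) \<partial>N)\<^sup>2 \<le> ?G * (\<integral>x. (u k x - f x)\<^sup>2 \<partial>N)"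
      by (rule Cauchy_Schwarz_integral) (use g elim in auto)
    ultimately show ?case
      using real_sqrt_le_mono[of "(\<integral>x. g x * (u k x - f x) \<partial>N)\<^sup>2"] by simp
  qed
  from Lim_null_comparison[OF this z] show ?thesis
    by (rule LIM_zero_cancel)
qed

text \<open>Rounding time down to a grid of mesh 1 / (n + 1) leaves countably many time points, so
  the rounded process is jointly measurable; rounding down stays in the half-line, and continuity of
  the paths gives convergence.\<close>

lemma continuous_imp_pair_measurable:
  fixes Z :: "real \<Rightarrow> 'b \<Rightarrow> real"
  assumes m: "\<And>t. 0 \<le> t \<Longrightarrow> Z t \<in> borel_measurable N"
    and c: "\<And>w. w \<in> space N \<Longrightarrow> continuous_on {0..} (\<lambda>t. Z t w)"
  shows "(\<lambda>(w, t). Z t w) \<in> borel_measurable (N \<Otimes>\<^sub>M restrict_space borel {0..})"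
proof (rule borel_measurable_LIMSEQ_real)
  let ?P = "N \<Otimes>\<^sub>M restrict_space borel {0::real..}"
  let ?u = "\<lambda>n (x :: 'b \<times> real). Z (real (nat \<lfloor>snd x * real (Suc n)\<rfloor>) / real (Suc n)) (fst x)"
  show "?u n \<in> borel_measurable ?P" for n
  proof (rule measurable_compose_countable[where f="\<lambda>i x. Z (real i / real (Suc n)) (fst x)"])
    show "(\<lambda>x. Z (real i / real (Suc n)) (fst x)) \<in> borel_measurable ?P" for i
      using measurable_compose[OF measurable_fst m[of "real i / real (Suc n)"]] by simp
    have [measurable]: "(\<lambda>x. snd x) \<in> borel_measurable ?P"
      by (rule measurable_compose[OF measurable_snd, where g="\<lambda>x. x"])
        (simp add: measurable_restrict_space1)
    show "(\<lambda>x. nat \<lfloor>snd x * real (Suc n)\<rfloor>) \<in> measurable ?P (count_space UNIV)"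
      by measurable
  qed
  fix x assume x: "x \<in> space ?P"
  obtain w t where xt: "x = (w, t)" by (cases x)
  have w: "w \<in> space N" and t: "0 \<le> t"
    using x by (auto simp: xt space_pair_measure space_restrict_space)
  have "(\<lambda>n. real (nat \<lfloor>t * real (Suc n)\<rfloor>) / real (Suc n)) \<longlonglongrightarrow> t"
  proof (rule tendsto_sandwich[where f="\<lambda>n. t - 1 / real (Suc n)" and h="\<lambda>n. t"])
    have "(\<lambda>n. t - 1 / real (Suc n)) \<longlonglongrightarrow> t - 0"
      by (intro tendsto_intros LIMSEQ_inverse_real_of_nat[unfolded inverse_eq_divide])
    then show "(\<lambda>n. t - 1 / real (Suc n)) \<longlonglongrightarrow> t" by simp
    have "t - 1 / real (Suc n) \<le> real (nat \<lfloor>t * real (Suc n)\<rfloor>) / real (Suc n) \<and>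
       real (nat \<lfloor>t * real (Suc n)\<rfloor>) / real (Suc n) \<le> t" for n
    proof -
      have "real (nat \<lfloor>t * real (Suc n)\<rfloor>) = of_int \<lfloor>t * real (Suc n)\<rfloor>"
        using t by simp
      then have "t * real (Suc n) - 1 \<le> real (nat \<lfloor>t * real (Suc n)\<rfloor>)"
        "real (nat \<lfloor>t * real (Suc n)\<rfloor>) \<le> t * real (Suc n)" by linarith+
      then have "(t * real (Suc n) - 1) / real (Suc n) \<le> real (nat \<lfloor>t * real (Suc n)\<rfloor>) / real (Suc n)"
        "real (nat \<lfloor>t * real (Suc n)\<rfloor>) / real (Suc n) \<le> t * real (Suc n) / real (Suc n)"
        by (meson divide_right_mono of_nat_0_le_iff)+
      then show ?thesis by (simp add: diff_divide_distrib del: of_nat_Suc)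
    qed
    then show "\<forall>\<^sub>F n in sequentially. t - 1 / real (Suc n) \<le> real (nat \<lfloor>t * real (Suc n)\<rfloor>) / real (Suc n)"
      "\<forall>\<^sub>F n in sequentially. real (nat \<lfloor>t * real (Suc n)\<rfloor>) / real (Suc n) \<le> t" by auto
  qed simp
  from continuous_on_tendsto_compose[OF c[OF w] this]
  show "(\<lambda>n. ?u n x) \<longlonglongrightarrow> (case x of (w, t) \<Rightarrow> Z t w)"
    using t by (simp add: xt)
qed

text \<open>Moves from the half-line, where processes are defined, to the product with
  \<open>lborel\<close>, where Fubini is applied. Composing with \<open>max 0\<close> supplies the
  irrelevant values at negative times.\<close>

lemma pair_measurable_slab:
  fixes Z :: "real \<Rightarrow> 'b \<Rightarrow> real"
  assumes "(\<lambda>(w, t). Z t w) \<in> borel_measurable (N \<Otimes>\<^sub>M restrict_space borel {0..})"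
    and [measurable]: "A \<in> sets borel" and A: "A \<subseteq> {0..}"
  shows "(\<lambda>(w, t). indicator A t * Z t w) \<in> borel_measurable (N \<Otimes>\<^sub>M lborel)"
proof -
  have "(\<lambda>x. (fst x, max 0 (snd x))) \<in> measurable (N \<Otimes>\<^sub>M lborel) (N \<Otimes>\<^sub>M restrict_space borel {0::real..})"
    by (intro measurable_Pair measurable_restrict_space2) auto
  from measurable_compose[OF this assms(1)]
  have [measurable]: "(\<lambda>x. Z (max 0 (snd x)) (fst x)) \<in> borel_measurable (N \<Otimes>\<^sub>M lborel)"
    by simp
  have "(\<lambda>x. indicator A (snd x) * Z (max 0 (snd x)) (fst x)) \<in> borel_measurable (N \<Otimes>\<^sub>M lborel)"
    by measurable
  also have "(\<lambda>x. indicator A (snd x) * Z (max 0 (snd x)) (fst x)) = (\<lambda>(w, t). indicator A t * Z t w)"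
    using A by (auto simp: fun_eq_iff indicator_def max_def)
  finally show ?thesis .
qed

lemmas jointly_measurable_slab = pair_measurable_slab[OF jointly_measurable_def[THEN iffD1]]

section \<open>Step integrals and their limits\<close>

lemma L2_limit_norm:
  fixes f :: "'a \<Rightarrow> real" and u :: "nat \<Rightarrow> 'a \<Rightarrow> real"
  assumes [measurable]: "f \<in> borel_measurable N" "\<And>k. u k \<in> borel_measurable N"
    and i: "\<And>k. integrable N (\<lambda>x. (u k x)\<^sup>2)"
    and lim: "(\<lambda>k. \<integral>\<^sup>+x. ennreal ((u k x - f x)\<^sup>2) \<partial>N) \<longlonglongrightarrow> 0"
  shows "(\<lambda>k. \<integral>x. (u k x)\<^sup>2 \<partial>N) \<longlonglongrightarrow> (\<integral>x. (f x)\<^sup>2 \<partial>N)"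
proof -
  note L = L2_limit_integrable[OF assms(1,2) i lim]
  have fu: "integrable N (\<lambda>x. f x * u k x)" for k
    by (rule integrable_mult_square) (use i L(1) in auto)
  have "(\<lambda>k. (\<integral>x. (u k x - f x)\<^sup>2 \<partial>N) + 2 * (\<integral>x. f x * u k x \<partial>N) - (\<integral>x. (f x)\<^sup>2 \<partial>N))
    \<longlonglongrightarrow> 0 + 2 * (\<integral>x. f x * f x \<partial>N) - (\<integral>x. (f x)\<^sup>2 \<partial>N)"
    by (intro tendsto_intros L L2_limit_pairing[OF assms(1,2,1) i _ lim])
  moreover have "eventually (\<lambda>k. (\<integral>x. (u k x - f x)\<^sup>2 \<partial>N) + 2 * (\<integral>x. f x * u k x \<partial>N)
      - (\<integral>x. (f x)\<^sup>2 \<partial>N) = (\<integral>x. (u k x)\<^sup>2 \<partial>N)) sequentially"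
    using L(2)
  proof eventually_elim
    case (elim k)
    have "(\<integral>x. (u k x)\<^sup>2 \<partial>N) = (\<integral>x. (u k x - f x)\<^sup>2 + 2 * (f x * u k x) - (f x)\<^sup>2 \<partial>N)"
      by (rule Bochner_Integration.integral_cong) (auto simp: power2_eq_square algebra_simps)
    also have "\<dots> = (\<integral>x. (u k x - f x)\<^sup>2 \<partial>N) + 2 * (\<integral>x. f x * u k x \<partial>N) - (\<integral>x. (f x)\<^sup>2 \<partial>N)"
      using elim fu L(1) by simp
    finally show ?case by simp
  qed
  ultimately show ?thesis
    by (subst (asm) filterlim_cong[OF refl refl]) (auto simp: power2_eq_square)
qed

lemma (in prob_space) has_bochner_integral_mult_indicator_Ioc:
  fixes f :: "'a \<Rightarrow> real"
  assumes "integrable M f" "a \<le> b"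
  shows "has_bochner_integral (M \<Otimes>\<^sub>M lborel) (\<lambda>(w, u). f w * indicator {a<..b} u) (expectation f * (b - a))"
proof -
  interpret P: pair_sigma_finite M lborel ..
  have [measurable]: "f \<in> borel_measurable M" using assms by simp
  have "integrable (M \<Otimes>\<^sub>M lborel) (\<lambda>(w, u). f w * indicator {a<..b} u)"
    by (rule P.Fubini_integrable) (use assms in \<open>auto simp: abs_mult\<close>)
  moreover from P.integral_fst'[OF this]
  have "integral\<^sup>L (M \<Otimes>\<^sub>M lborel) (\<lambda>(w, u). f w * indicator {a<..b} u) = expectation f * (b - a)"
    using assms by simp
  ultimately show ?thesis by (simp add: has_bochner_integral_iff)
qed

context brownian
begin

text \<open>Terms with conditionally centred factors are orthogonal, so only the diagonal survives
  in the square. The general \<open>g\<close> covers two uses: the identity for step integrals, and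
  the linearisation error of an exponential increment. Weak monotonicity of \<open>\<tau>\<close>
  admits grids clipped at a final time.\<close>

lemma orthogonal_increments:
  fixes \<tau> :: "nat \<Rightarrow> real" and \<xi> :: "nat \<Rightarrow> 'a \<Rightarrow> real" and g :: "nat \<Rightarrow> real \<Rightarrow> real"
  assumes "0 \<le> \<tau> 0"
    and "\<And>i. i < n \<Longrightarrow> \<tau> i \<le> \<tau> (Suc i)"
    and "\<And>i. i < n \<Longrightarrow> \<xi> i \<in> borel_measurable (F (\<tau> i))"
    and "\<And>i. i < n \<Longrightarrow> integrable M (\<lambda>w. (\<xi> i w)\<^sup>2)"
    and "\<And>i. g i \<in> borel_measurable borel"
    and "\<And>i. i < n \<Longrightarrow> has_bochner_integral M (\<lambda>w. g i (W (\<tau> (Suc i)) w - W (\<tau> i) w)) 0"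
    and "\<And>i. i < n \<Longrightarrow> has_bochner_integral M (\<lambda>w. (g i (W (\<tau> (Suc i)) w - W (\<tau> i) w))\<^sup>2) (v i)"
  shows "has_bochner_integral M (\<lambda>w. (\<Sum>i<n. \<xi> i w * g i (W (\<tau> (Suc i)) w - W (\<tau> i) w))\<^sup>2)
      (\<Sum>i<n. expectation (\<lambda>w. (\<xi> i w)\<^sup>2) * v i)"
proof -
  let ?S = "\<lambda>n w. \<Sum>i<n. \<xi> i w * g i (W (\<tau> (Suc i)) w - W (\<tau> i) w)"
  \<comment> \<open>Measurability of the partial sum at time \<tau> n is carried along because it
    makes \<open>?S n * \<xi> n\<close> independent of the next increment, which kills the cross
    term.\<close>
  have "0 \<le> \<tau> n \<and> ?S n \<in> borel_measurable (F (\<tau> n)) \<and>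
    has_bochner_integral M (\<lambda>w. (?S n w)\<^sup>2) (\<Sum>i<n. expectation (\<lambda>w. (\<xi> i w)\<^sup>2) * v i)"
    using assms(2,3,4,6,7)
  proof (induction n)
    case 0
    then show ?case using assms(1) by (simp add: has_bochner_integral_zero)
  next
    case (Suc n)
    let ?a = "\<tau> n" and ?b = "\<tau> (Suc n)"
    let ?D = "\<lambda>w. W ?b w - W ?a w"
    have IH: "0 \<le> ?a" "?S n \<in> borel_measurable (F ?a)"
      "has_bochner_integral M (\<lambda>w. (?S n w)\<^sup>2) (\<Sum>i<n. expectation (\<lambda>w. (\<xi> i w)\<^sup>2) * v i)"
      using Suc.IH Suc.prems by auto
    have ab: "?a \<le> ?b" and \<xi>: "\<xi> n \<in> borel_measurable (F ?a)" and \<xi>2: "integrable M (\<lambda>w. (\<xi> n w)\<^sup>2)"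
      using Suc.prems by auto
    note [measurable] = assms(5) measurable_F_M[OF IH(1) \<xi>] measurable_F_M[OF IH(1,2)]
    have b: "0 \<le> ?b" using IH(1) ab by simp
    note m = measurable_F_le[OF IH(1) ab]
    have meas: "?S (Suc n) \<in> borel_measurable (F ?b)"
      using m[OF IH(2)] m[OF \<xi>] W_measurable_F[OF b order.refl] W_measurable_F[OF IH(1) ab] assms(5)
      by simp
    have S\<xi>: "integrable M (\<lambda>w. ?S n w * \<xi> n w)"
      using IH(3) \<xi>2 by (intro integrable_mult_square) (auto simp: has_bochner_integral_iff)
    have c: "integrable M (\<lambda>w. g n (?D w))" "expectation (\<lambda>w. g n (?D w)) = 0"
      "integrable M (\<lambda>w. (g n (?D w))\<^sup>2)" "expectation (\<lambda>w. (g n (?D w))\<^sup>2) = v n"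
      using Suc.prems(4)[of n] Suc.prems(5)[of n] by (auto simp: has_bochner_integral_iff)
    have "(\<lambda>w. ?S n w * \<xi> n w) \<in> borel_measurable (F ?a)"
      using IH(2) \<xi> by measurable
    from integral_mult_increment[OF IH(1) ab this assms(5) S\<xi> c(1)]
    have cross: "has_bochner_integral M (\<lambda>w. ?S n w * \<xi> n w * g n (?D w)) 0"
      by (simp add: has_bochner_integral_iff c)
    have "(\<lambda>w. (\<xi> n w)\<^sup>2) \<in> borel_measurable (F ?a)"
      using \<xi> by measurable
    from integral_mult_increment[OF IH(1) ab this _ \<xi>2 c(3)]
    have diag: "has_bochner_integral M (\<lambda>w. (\<xi> n w)\<^sup>2 * (g n (?D w))\<^sup>2)
        (expectation (\<lambda>w. (\<xi> n w)\<^sup>2) * v n)"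
      by (simp add: has_bochner_integral_iff c assms(5))
    have "has_bochner_integral M (\<lambda>w. (?S n w)\<^sup>2 + 2 * (?S n w * \<xi> n w * g n (?D w))
        + (\<xi> n w)\<^sup>2 * (g n (?D w))\<^sup>2)
      ((\<Sum>i<n. expectation (\<lambda>w. (\<xi> i w)\<^sup>2) * v i) + 2 * 0 + expectation (\<lambda>w. (\<xi> n w)\<^sup>2) * v n)"
      by (intro has_bochner_integral_add has_bochner_integral_mult_right IH(3) cross diag)
    also have "(\<lambda>w. (?S n w)\<^sup>2 + 2 * (?S n w * \<xi> n w * g n (?D w)) + (\<xi> n w)\<^sup>2 * (g n (?D w))\<^sup>2)
      = (\<lambda>w. (?S (Suc n) w)\<^sup>2)"
      by (rule ext) (simp add: power2_eq_square algebra_simps)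
    finally show ?case using meas b by simp
  qed
  then show ?thesis by blast
qed

lemma step_data_nonneg:
  assumes "step_data M F n \<tau> \<xi>" "i \<le> n"
  shows "0 \<le> \<tau> i"
  using assms(2)
proof (induction i)
  case 0
  then show ?case using assms(1) by (simp add: step_data_def)
next
  case (Suc i)
  then show ?case using assms(1) unfolding step_data_def
    by (metis Suc_le_eq less_imp_le order.trans)
qed

lemma step_data_measurable_M:
  assumes "step_data M F n \<tau> \<xi>" "i < n"
  shows "\<xi> i \<in> borel_measurable M"
proof -
  have "\<xi> i \<in> borel_measurable (F (\<tau> i))" using assms by (simp add: step_data_def)
  then show ?thesis using measurable_F_M step_data_nonneg[OF assms(1), of i] assms(2) by simp
qed

lemma step_integral_sq:
  assumes sd: "step_data M F n \<tau> \<xi>" and T: "0 \<le> T"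
  shows "has_bochner_integral M (\<lambda>w. (step_integral W n \<tau> \<xi> T w)\<^sup>2)
     (\<Sum>i<n. expectation (\<lambda>w. (\<xi> i w)\<^sup>2) * (min T (\<tau> (Suc i)) - min T (\<tau> i)))"
proof -
  let ?t = "\<lambda>i. min T (\<tau> i)"
  \<comment> \<open>A cell starting after T is clipped to start at T, but its coefficient is only
    measurable at the later time \<tau> i. Its increment is zero after clipping, so the coefficient
    may be replaced by 0.\<close>
  let ?x = "\<lambda>i w. if \<tau> i \<le> T then \<xi> i w else 0"
  have lt: "\<tau> i < \<tau> (Suc i)" if "i < n" for i using sd that by (simp add: step_data_def)
  have "has_bochner_integral M (\<lambda>w. (\<Sum>i<n. ?x i w * (\<lambda>x. x) (W (?t (Suc i)) w - W (?t i) w))\<^sup>2)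
      (\<Sum>i<n. expectation (\<lambda>w. (?x i w)\<^sup>2) * (?t (Suc i) - ?t i))"
  proof (rule orthogonal_increments[where g="\<lambda>i x. x" and \<tau>="?t" and \<xi>="?x"])
    fix i assume i: "i < n"
    note pos = step_data_nonneg[OF sd]
    have p: "0 \<le> ?t i" "?t i \<le> ?t (Suc i)" using T pos[of i] i lt[OF i] by auto
    show "?t i \<le> ?t (Suc i)" by fact
    show "?x i \<in> borel_measurable (F (?t i))"
      using sd i by (cases "\<tau> i \<le> T") (auto simp: step_data_def min_def)
    show "integrable M (\<lambda>w. (?x i w)\<^sup>2)"
      using sd i by (cases "\<tau> i \<le> T") (auto simp: step_data_def)
    show "has_bochner_integral M (\<lambda>w. W (?t (Suc i)) w - W (?t i) w) 0"
      "has_bochner_integral M (\<lambda>w. (W (?t (Suc i)) w - W (?t i) w)\<^sup>2) (?t (Suc i) - ?t i)"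
      by (rule increment_mean[OF p], rule increment_second_moment[OF p])
  qed (use T step_data_nonneg[OF sd, of 0] in auto)
  moreover have "(\<Sum>i<n. ?x i w * (\<lambda>x. x) (W (?t (Suc i)) w - W (?t i) w)) = step_integral W n \<tau> \<xi> T w" for w
    unfolding step_integral_def using lt by (intro sum.cong) (force simp: min_def)+
  moreover have "(\<Sum>i<n. expectation (\<lambda>w. (?x i w)\<^sup>2) * (?t (Suc i) - ?t i))
      = (\<Sum>i<n. expectation (\<lambda>w. (\<xi> i w)\<^sup>2) * (?t (Suc i) - ?t i))"
    using lt by (intro sum.cong) (force simp: min_def)+
  ultimately show ?thesis by simp
qed

lemma slab_Int_Ioc:
  assumes "0 \<le> (a::real)"
  shows "indicator {0..T} u * indicator {a<..b} u = (indicator {min T a<..min T b} u :: real)"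
  using assms by (auto simp: indicator_def)

lemma step_process_slab:
  assumes sd: "step_data M F n \<tau> \<xi>"
  shows "indicator {0..T} u * step_process n \<tau> \<xi> u w
    = (\<Sum>i<n. \<xi> i w * indicator {min T (\<tau> i)<..min T (\<tau> (Suc i))} u)"
proof -
  have "indicator {0..T} u * (\<xi> i w * indicator {\<tau> i<..\<tau> (Suc i)} u)
    = \<xi> i w * indicator {min T (\<tau> i)<..min T (\<tau> (Suc i))} u" if "i < n" for i
    using slab_Int_Ioc[OF step_data_nonneg[OF sd, of i], of T u "\<tau> (Suc i)"] that
    by (simp add: mult.left_commute)
  then show ?thesis
    unfolding step_process_def sum_distrib_left by (intro sum.cong) auto
qed

lemma step_process_slab_measurable:
  assumes sd: "step_data M F n \<tau> \<xi>"
  shows "(\<lambda>(w, u). indicator {0..T} u * step_process n \<tau> \<xi> u w) \<in> borel_measurable (M \<Otimes>\<^sub>M lborel)"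
proof -
  have "(\<lambda>x. \<Sum>i<n. \<xi> i (fst x) * indicator {min T (\<tau> i)<..min T (\<tau> (Suc i))} (snd x))
      \<in> borel_measurable (M \<Otimes>\<^sub>M lborel)"
    using step_data_measurable_M[OF sd]
    by (intro borel_measurable_sum borel_measurable_times measurable_compose[OF measurable_fst]
        measurable_compose[OF measurable_snd]) auto
  then show ?thesis unfolding step_process_slab[OF sd] by (simp add: split_beta')
qed

text \<open>The cells are disjoint, so all mixed products of indicators vanish pointwise, and an
  indicator equals its square.\<close>

lemma step_process_slab_sq:
  assumes sd: "step_data M F n \<tau> \<xi>"
  shows "(indicator {0..T} u * step_process n \<tau> \<xi> u w)\<^sup>2
    = (\<Sum>i<n. (\<xi> i w)\<^sup>2 * indicator {min T (\<tau> i)<..min T (\<tau> (Suc i))} u)"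
proof -
  let ?I = "\<lambda>i. indicator {min T (\<tau> i)<..min T (\<tau> (Suc i))} u :: real"
  have lt: "\<And>i. i < n \<Longrightarrow> \<tau> i < \<tau> (Suc i)" using sd by (simp add: step_data_def)
  have mono: "\<tau> i \<le> \<tau> j" if "i \<le> j" "j \<le> n" for i j
    using that
  proof (induction j)
    case (Suc j)
    then show ?case using lt[of j] by (cases "i = Suc j") auto
  qed simp
  have "(\<Sum>i<m. \<xi> i w * ?I i)\<^sup>2 = (\<Sum>i<m. (\<xi> i w)\<^sup>2 * ?I i)" if "m \<le> n" for m
    using that
  proof (induction m)
    case (Suc m)
    have "?I i * ?I m = 0" if "i < m" for i
      using mono[of "Suc i" m] that Suc.prems by (auto simp: indicator_def)
    then have "(\<Sum>i<m. \<xi> i w * ?I i) * ?I m = 0"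
      unfolding sum_distrib_right mult.assoc by (intro sum.neutral) auto
    moreover have "(?I m)\<^sup>2 = ?I m" by (simp add: indicator_def)
    ultimately show ?case using Suc
      by (simp add: power2_sum power_mult_distrib mult.assoc)
        auto
  qed simp
  then show ?thesis by (simp add: step_process_slab[OF sd])
qed

text \<open>The value coincides with that of \<open>step_integral_sq\<close>; this coincidence is
  the Ito isometry for step processes.\<close>

lemma step_process_sq:
  assumes sd: "step_data M F n \<tau> \<xi>" and T: "0 \<le> T"
  shows "has_bochner_integral (M \<Otimes>\<^sub>M lborel) (\<lambda>(w, u). (indicator {0..T} u * step_process n \<tau> \<xi> u w)\<^sup>2)
     (\<Sum>i<n. expectation (\<lambda>w. (\<xi> i w)\<^sup>2) * (min T (\<tau> (Suc i)) - min T (\<tau> i)))"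
proof -
  have "has_bochner_integral (M \<Otimes>\<^sub>M lborel)
     (\<lambda>x. \<Sum>i<n. case x of (w, u) \<Rightarrow> (\<xi> i w)\<^sup>2 * indicator {min T (\<tau> i)<..min T (\<tau> (Suc i))} u)
     (\<Sum>i<n. expectation (\<lambda>w. (\<xi> i w)\<^sup>2) * (min T (\<tau> (Suc i)) - min T (\<tau> i)))"
    using sd
    by (intro has_bochner_integral_sum has_bochner_integral_mult_indicator_Ioc)
      (auto simp: step_data_def less_imp_le intro!: min.mono)
  then show ?thesis
    unfolding step_process_slab_sq[OF sd] by (simp add: split_beta')
qed

text \<open>The martingale property moves the weight from t back to b, where it factors into
  \<open>G \<theta> a\<close> and a tilted increment with mean \<theta> * (b - a). The remaining
  \<open>G \<theta> a\<close> is moved forward to t again, so that one and the same weight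
  multiplies every cell when the terms are summed.\<close>

lemma G_pair_increment:
  assumes ab: "0 \<le> a" "a \<le> b" "b \<le> t" and A: "A \<in> borel_measurable (F a)" "integrable M (\<lambda>w. (A w)\<^sup>2)"
  shows "has_bochner_integral M (\<lambda>w. G \<theta> t w * (A w * (W b w - W a w)))
    (\<theta> * (expectation (\<lambda>w. G \<theta> t w * A w) * (b - a)))"
proof -
  have AG: "integrable M (\<lambda>w. A w * G \<theta> a w)"
    using A measurable_F_M[OF ab(1) A(1)] G_sq_mean[OF ab(1), of \<theta>] G_measurable_M[OF ab(1)]
    by (intro integrable_mult_square) (auto simp: has_bochner_integral_iff)
  have m: "(\<lambda>w. A w * G \<theta> a w) \<in> borel_measurable (F a)"
    using A(1) G_measurable_F[OF ab(1) order.refl] by measurable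
  let ?g = "\<lambda>x. exp (\<theta> * x - \<theta>\<^sup>2 * (b - a) / 2) * x"
  have e: "integrable M (\<lambda>w. ?g (W b w - W a w))" "expectation (\<lambda>w. ?g (W b w - W a w)) = \<theta> * (b - a)"
    using exp_increment(2)[OF ab(1,2), of \<theta>] by (auto simp: has_bochner_integral_iff)
  have *: "integrable M (\<lambda>w. A w * G \<theta> a w * ?g (W b w - W a w))"
    "expectation (\<lambda>w. A w * G \<theta> a w * ?g (W b w - W a w)) = expectation (\<lambda>w. A w * G \<theta> a w) * (\<theta> * (b - a))"
    using integral_mult_increment[OF ab(1,2) m _ AG e(1)] by (auto simp: e)
  have eq: "A w * G \<theta> a w * ?g (W b w - W a w) = (A w * (W b w - W a w)) * G \<theta> b w" for w
    by (simp add: G_split[of \<theta> b _ a])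
  have b: "0 \<le> b" using ab by simp
  have mb: "(\<lambda>w. A w * (W b w - W a w)) \<in> borel_measurable (F b)"
    using measurable_F_le[OF ab(1,2) A(1)] W_measurable_F[OF ab(1,2)] W_measurable_F[OF b order.refl]
    by measurable
  have at: "a \<le> t" using ab by simp
  have "integrable M (\<lambda>w. A w * (W b w - W a w) * G \<theta> t w)"
    "expectation (\<lambda>w. A w * (W b w - W a w) * G \<theta> t w)
      = expectation (\<lambda>w. A w * G \<theta> t w) * (\<theta> * (b - a))"
    using G_martingale[OF b ab(3) mb, of \<theta>] * G_martingale[OF ab(1) at A(1) AG]
    unfolding eq by auto
  moreover have "(\<lambda>w. A w * (W b w - W a w) * G \<theta> t w) = (\<lambda>w. G \<theta> t w * (A w * (W b w - W a w)))"
    "(\<lambda>w. A w * G \<theta> t w) = (\<lambda>w. G \<theta> t w * A w)"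
    by (simp_all add: fun_eq_iff mult.commute)
  ultimately show ?thesis
    by (simp only: has_bochner_integral_iff) (simp add: mult.left_commute)
qed

text \<open>The elementary form of replacing dW by \<theta> du under the weight
  \<open>G \<theta> t\<close>. The right side is written as an inner product of two functions on the
  product space, ready for \<open>L2_limit_pairing\<close>.\<close>

lemma step_pairing:
  assumes sd: "step_data M F n \<tau> \<xi>" and T: "0 \<le> T" "T \<le> t"
  shows "expectation (\<lambda>w. G \<theta> t w * step_integral W n \<tau> \<xi> T w)
    = \<theta> * (\<integral>x. (case x of (w, u) \<Rightarrow> indicator {0..T} u * G \<theta> t w)
        * (case x of (w, u) \<Rightarrow> indicator {0..T} u * step_process n \<tau> \<xi> u w) \<partial>(M \<Otimes>\<^sub>M lborel))"
proof -
  let ?E = "\<lambda>i. expectation (\<lambda>w. G \<theta> t w * \<xi> i w) * (min T (\<tau> (Suc i)) - min T (\<tau> i))"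
  have t: "0 \<le> t" using T by simp
  have 1: "has_bochner_integral M (\<lambda>w. G \<theta> t w * (\<xi> i w * (W (min T (\<tau> (Suc i))) w - W (min T (\<tau> i)) w))) (\<theta> * ?E i)"
    if i: "i < n" for i
  proof (cases "\<tau> i \<le> T")
    case True
    then have m: "min T (\<tau> i) = \<tau> i" by simp
    show ?thesis unfolding m
      using sd i T True step_data_nonneg[OF sd, of i]
      by (intro G_pair_increment) (auto simp: step_data_def less_imp_le)
  next
    case False
    moreover have "\<tau> i < \<tau> (Suc i)" using sd i by (simp add: step_data_def)
    ultimately show ?thesis by (simp add: has_bochner_integral_zero)
  qed
  have "has_bochner_integral M (\<lambda>w. \<Sum>i<n. G \<theta> t w * (\<xi> i w * (W (min T (\<tau> (Suc i))) w - W (min T (\<tau> i)) w)))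
     (\<Sum>i<n. \<theta> * ?E i)"
    by (intro has_bochner_integral_sum 1) simp
  then have L: "expectation (\<lambda>w. G \<theta> t w * step_integral W n \<tau> \<xi> T w) = \<theta> * (\<Sum>i<n. ?E i)"
    by (simp add: step_integral_def sum_distrib_left has_bochner_integral_iff)
  have "has_bochner_integral (M \<Otimes>\<^sub>M lborel)
     (\<lambda>x. \<Sum>i<n. case x of (w, u) \<Rightarrow> G \<theta> t w * \<xi> i w * indicator {min T (\<tau> i)<..min T (\<tau> (Suc i))} u)
     (\<Sum>i<n. ?E i)"
  proof (intro has_bochner_integral_sum has_bochner_integral_mult_indicator_Ioc)
    fix i assume "i \<in> {..<n}"
    then show "integrable M (\<lambda>w. G \<theta> t w * \<xi> i w)" "min T (\<tau> i) \<le> min T (\<tau> (Suc i))"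
      using sd step_data_measurable_M[OF sd] G_sq_mean[OF t, of \<theta>] G_measurable_M[OF t]
      by (auto simp: step_data_def less_imp_le has_bochner_integral_iff
          intro!: min.mono integrable_mult_square)
  qed
  moreover have "(case x of (w, u) \<Rightarrow> indicator {0..T} u * G \<theta> t w)
        * (case x of (w, u) \<Rightarrow> indicator {0..T} u * step_process n \<tau> \<xi> u w)
     = (\<Sum>i<n. case x of (w, u) \<Rightarrow> G \<theta> t w * \<xi> i w * indicator {min T (\<tau> i)<..min T (\<tau> (Suc i))} u)" for x
  proof -
    obtain w u where x: "x = (w, u)" by (cases x)
    have "indicator {0..T} u * G \<theta> t w * (indicator {0..T} u * step_process n \<tau> \<xi> u w)
      = G \<theta> t w * (indicator {0..T} u * step_process n \<tau> \<xi> u w)"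
      by (simp add: indicator_def)
    also have "\<dots> = (\<Sum>i<n. G \<theta> t w * \<xi> i w * indicator {min T (\<tau> i)<..min T (\<tau> (Suc i))} u)"
      unfolding step_process_slab[OF sd] sum_distrib_left mult.assoc ..
    finally show ?thesis unfolding x by simp
  qed
  ultimately show ?thesis unfolding L by (simp add: has_bochner_integral_iff)
qed

section \<open>Isometry and pairing for general integrands\<close>

lemma L2_loc_slab_measurable:
  assumes "H \<in> L2_loc M F"
  shows "(\<lambda>(w, u). indicator {0..T} u * H u w) \<in> borel_measurable (M \<Otimes>\<^sub>M lborel)"
  using assms by (intro jointly_measurable_slab) (auto simp: L2_loc_def)

lemma nn_integral_slab_sq:
  fixes f :: "real \<Rightarrow> 'a \<Rightarrow> real"
  assumes "(\<lambda>(w, u). indicator {0..T} u * f u w) \<in> borel_measurable (M \<Otimes>\<^sub>M lborel)"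
  shows "(\<integral>\<^sup>+w. (\<integral>\<^sup>+u\<in>{0..T}. ennreal ((f u w)\<^sup>2) \<partial>lborel) \<partial>M)
    = (\<integral>\<^sup>+x. ennreal ((case x of (w, u) \<Rightarrow> indicator {0..T} u * f u w)\<^sup>2) \<partial>(M \<Otimes>\<^sub>M lborel))"
proof -
  have "(\<lambda>x. ennreal ((case x of (w, u) \<Rightarrow> indicator {0..T} u * f u w)\<^sup>2)) \<in> borel_measurable (M \<Otimes>\<^sub>M lborel)"
    using assms by measurable
  then show ?thesis
    by (subst lborel.nn_integral_fst[symmetric])
      (auto simp: indicator_def intro!: nn_integral_cong)
qed

lemma L2_loc_slab_integrable:
  assumes H: "H \<in> L2_loc M F"
  shows "integrable (M \<Otimes>\<^sub>M lborel) (\<lambda>(w, u). (indicator {0..T} u * H u w)\<^sup>2)"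
proof -
  have m: "(\<lambda>(w, u). indicator {0..T} u * H u w) \<in> borel_measurable (M \<Otimes>\<^sub>M lborel)" for T
    by (rule L2_loc_slab_measurable[OF H])
  \<comment> \<open>\<open>L2_loc\<close> bounds the integral only for positive horizons, while T
    may be zero or negative.\<close>
  let ?R = "max T 1"
  have "(\<integral>\<^sup>+x. ennreal ((case x of (w, u) \<Rightarrow> indicator {0..T} u * H u w)\<^sup>2) \<partial>(M \<Otimes>\<^sub>M lborel))
    \<le> (\<integral>\<^sup>+x. ennreal ((case x of (w, u) \<Rightarrow> indicator {0..?R} u * H u w)\<^sup>2) \<partial>(M \<Otimes>\<^sub>M lborel))"
    by (intro nn_integral_mono) (auto simp: indicator_def)
  also have "\<dots> < \<infinity>"
    unfolding nn_integral_slab_sq[OF m, symmetric] using H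
    by (auto simp: L2_loc_def)
  finally show ?thesis
    using m[of T] by (intro integrableI_nonneg) (auto simp: split_beta')
qed

text \<open>All three facts are read off the step data that the definition of the integral supplies
  for the given T: norms and pairings of step processes and of step integrals agree, and each side
  has its own mean-square limit.\<close>

lemma
  assumes I: "ito_integral M F W H I" and T: "0 \<le> T"
  shows ito_integral_sq_integrable: "integrable M (\<lambda>w. (I T w)\<^sup>2)"
    and ito_isometry: "expectation (\<lambda>w. (I T w)\<^sup>2)
      = (\<integral>x. (case x of (w, u) \<Rightarrow> indicator {0..T} u * H u w)\<^sup>2 \<partial>(M \<Otimes>\<^sub>M lborel))"
    and ito_pairing: "T \<le> t \<Longrightarrow> expectation (\<lambda>w. G \<theta> t w * I T w)
      = \<theta> * (\<integral>x. (case x of (w, u) \<Rightarrow> indicator {0..T} u * G \<theta> t w)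
        * (case x of (w, u) \<Rightarrow> indicator {0..T} u * H u w) \<partial>(M \<Otimes>\<^sub>M lborel))"
proof -
  have H: "H \<in> L2_loc M F" and Im: "I T \<in> borel_measurable M"
    using I T measurable_F_M[of T] by (auto simp: ito_integral_def adapted_def)
  obtain n \<tau> \<xi> where sd: "\<And>k::nat. step_data M F (n k) (\<tau> k) (\<xi> k)"
    and l1: "(\<lambda>k. \<integral>\<^sup>+w. (\<integral>\<^sup>+t\<in>{0..T}.
               ennreal ((step_process (n k) (\<tau> k) (\<xi> k) t w - H t w)\<^sup>2) \<partial>lborel) \<partial>M)
          \<longlonglongrightarrow> 0"
    and l2: "(\<lambda>k. \<integral>\<^sup>+w. ennreal ((step_integral W (n k) (\<tau> k) (\<xi> k) T w - I T w)\<^sup>2) \<partial>M)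
          \<longlonglongrightarrow> 0"
    using I T unfolding ito_integral_def by blast
  let ?S = "\<lambda>k. step_integral W (n k) (\<tau> k) (\<xi> k) T"
  let ?P = "\<lambda>k x. case x of (w, u) \<Rightarrow> indicator {0..T} u * step_process (n k) (\<tau> k) (\<xi> k) u w"
  let ?H = "\<lambda>x. case x of (w, u) \<Rightarrow> indicator {0..T} u * H u w"
  let ?N = "M \<Otimes>\<^sub>M lborel"
  have Hm: "?H \<in> borel_measurable ?N" by (rule L2_loc_slab_measurable[OF H])
  have Sm: "?S k \<in> borel_measurable M" for k
    unfolding step_integral_def
    using step_data_measurable_M[OF sd, of _ k] step_data_nonneg[OF sd, of _ k] T
    by (intro borel_measurable_sum borel_measurable_times borel_measurable_diff W_measurable_M) auto
  have Pm: "?P k \<in> borel_measurable ?N" for k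
    by (rule step_process_slab_measurable[OF sd])
  have Si: "integrable M (\<lambda>w. (?S k w)\<^sup>2)" for k
    using step_integral_sq[OF sd T] by (simp add: has_bochner_integral_iff)
  have Pi: "integrable ?N (\<lambda>x. (?P k x)\<^sup>2)" for k
    using step_process_sq[OF sd T] by (simp add: has_bochner_integral_iff split_beta')
  have "(\<integral>\<^sup>+w. (\<integral>\<^sup>+t\<in>{0..T}. ennreal ((step_process (n k) (\<tau> k) (\<xi> k) t w - H t w)\<^sup>2) \<partial>lborel) \<partial>M)
    = (\<integral>\<^sup>+x. ennreal ((?P k x - ?H x)\<^sup>2) \<partial>?N)" for k
  proof -
    have eq: "?P k x - ?H x = (case x of (w, u) \<Rightarrow> indicator {0..T} u * (step_process (n k) (\<tau> k) (\<xi> k) u w - H u w))" for x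
      by (simp add: split_beta' right_diff_distrib)
    have "(\<lambda>x. ?P k x - ?H x) \<in> borel_measurable ?N" using Pm Hm by (intro borel_measurable_diff)
    then show ?thesis unfolding eq by (intro nn_integral_slab_sq)
  qed
  with l1 have l1': "(\<lambda>k. \<integral>\<^sup>+x. ennreal ((?P k x - ?H x)\<^sup>2) \<partial>?N) \<longlonglongrightarrow> 0" by simp
  show "integrable M (\<lambda>w. (I T w)\<^sup>2)" by (rule L2_limit_integrable[OF Im Sm Si l2])
  have "(\<integral>x. (?P k x)\<^sup>2 \<partial>?N) = expectation (\<lambda>w. (?S k w)\<^sup>2)" for k
    using step_process_sq[OF sd T] step_integral_sq[OF sd T]
    by (simp add: has_bochner_integral_iff split_beta')
  with L2_limit_norm[OF Hm Pm Pi l1'] have "(\<lambda>k. expectation (\<lambda>w. (?S k w)\<^sup>2)) \<longlonglongrightarrow> (\<integral>x. (?H x)\<^sup>2 \<partial>?N)"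
    by simp
  with L2_limit_norm[OF Im Sm Si l2] show "expectation (\<lambda>w. (I T w)\<^sup>2) = (\<integral>x. (?H x)\<^sup>2 \<partial>?N)"
    by (rule LIMSEQ_unique)
  assume t: "T \<le> t"
  then have t0: "0 \<le> t" using T by simp
  let ?G = "\<lambda>x. case x of (w, u) \<Rightarrow> indicator {0..T} u * G \<theta> t w"
  have Gm: "?G \<in> borel_measurable ?N"
    using G_measurable_M[OF t0] by (simp add: split_beta')
  have Gi: "integrable ?N (\<lambda>x. (?G x)\<^sup>2)"
  proof -
    have *: "integrable M (\<lambda>w. (G \<theta> t w)\<^sup>2)" using G_sq_mean[OF t0, of \<theta>] by (simp add: has_bochner_integral_iff)
    \<comment> \<open>The available formula concerns half-open intervals, so the slab is enclosed in
      one that starts before 0.\<close>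
    have "has_bochner_integral ?N (\<lambda>(w, u). (G \<theta> t w)\<^sup>2 * indicator {-1<..T} u)
        (expectation (\<lambda>w. (G \<theta> t w)\<^sup>2) * (T - (-1)))"
      using T by (intro has_bochner_integral_mult_indicator_Ioc *) auto
    then have "integrable ?N (\<lambda>(w, u). (G \<theta> t w)\<^sup>2 * indicator {-1<..T} u)" by (simp add: has_bochner_integral_iff)
    then show ?thesis
      by (rule Bochner_Integration.integrable_bound) (use Gm in \<open>auto simp: indicator_def\<close>)
  qed
  have a: "(\<lambda>k. \<theta> * (\<integral>x. ?G x * ?P k x \<partial>?N)) \<longlonglongrightarrow> \<theta> * (\<integral>x. ?G x * ?H x \<partial>?N)"
    by (intro tendsto_intros L2_limit_pairing[OF Hm Pm Gm Pi Gi l1'])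
  have b: "(\<lambda>k. expectation (\<lambda>w. G \<theta> t w * ?S k w)) \<longlonglongrightarrow> expectation (\<lambda>w. G \<theta> t w * I T w)"
    using G_sq_mean[OF t0, of \<theta>]
    by (intro L2_limit_pairing[OF Im Sm _ Si _ l2] G_measurable_M t0) (simp add: has_bochner_integral_iff)
  show "expectation (\<lambda>w. G \<theta> t w * I T w) = \<theta> * (\<integral>x. ?G x * ?H x \<partial>?N)"
    using LIMSEQ_unique[OF b] a unfolding step_pairing[OF sd T t] by blast
qed

end

section \<open>Discounting\<close>

lemma exp_neg_mult_bounds:
  fixes r s t :: real
  assumes "0 \<le> s" "s \<le> t"
  shows "exp (- r * s) \<le> exp (\<bar>r\<bar> * t)"
proof -
  have "- r * s \<le> \<bar>r\<bar> * s" using assms(1) by (intro mult_right_mono) auto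
  also have "\<dots> \<le> \<bar>r\<bar> * t" using assms(2) by (intro mult_left_mono) auto
  finally show ?thesis by simp
qed

lemma exp_discount_LINT:
  fixes r a t :: real
  assumes "a \<le> t"
  shows "(LINT s:{a..t}|lborel. r * exp (- r * s)) = exp (- r * a) - exp (- r * t)"
proof -
  have "has_bochner_integral lborel (\<lambda>s. (r * exp (- r * s)) * indicator {a..t} s)
      ((- exp (- r * t)) - (- exp (- r * a)))"
    using assms by (intro has_bochner_integral_FTC_Icc_real) (auto intro!: derivative_eq_intros)
  then show ?thesis
    unfolding set_lebesgue_integral_def by (simp add: has_bochner_integral_iff mult.commute)
qed

lemma set_integrable_discount:
  fixes f :: "real \<Rightarrow> real"
  assumes "set_integrable lborel {0..t} f"
  shows "set_integrable lborel {0..t} (\<lambda>s. exp (- r * s) * f s)"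
proof -
  have m[measurable]: "(\<lambda>s. indicator {0..t} s * f s) \<in> borel_measurable borel"
    using assms unfolding set_integrable_def by (auto dest: borel_measurable_integrable)
  have i: "integrable lborel (\<lambda>s. exp (\<bar>r\<bar> * t) * (indicator {0..t} s * f s))"
    using assms by (simp add: set_integrable_def)
  have "integrable lborel (\<lambda>s. exp (- r * s) * (indicator {0..t} s * f s))"
  proof (rule Bochner_Integration.integrable_bound[OF i])
    show "AE s in lborel. norm (exp (- r * s) * (indicator {0..t} s * f s))
       \<le> norm (exp (\<bar>r\<bar> * t) * (indicator {0..t} s * f s))"
      using exp_neg_mult_bounds[of _ t r]
      by (auto simp: indicator_def abs_mult intro!: mult_right_mono)
  qed measurable
  then show ?thesis
    by (simp add: set_integrable_def mult.left_commute)
qed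

text \<open>Integration by parts, obtained from Fubini because the primitive of an integrable function
  need not be differentiable everywhere.\<close>

lemma
  fixes f :: "real \<Rightarrow> real"
  assumes f: "set_integrable lborel {0..t} f" and t: "0 \<le> t"
  shows discounted_primitive_integrable:
      "set_integrable lborel {0..t} (\<lambda>s. exp (- r * s) * (LINT u:{0..s}|lborel. f u))"
    and discounted_primitive:
      "exp (- r * t) * (LINT u:{0..t}|lborel. f u)
        + r * (LINT s:{0..t}|lborel. exp (- r * s) * (LINT u:{0..s}|lborel. f u))
      = (LINT u:{0..t}|lborel. exp (- r * u) * f u)"
proof -
  let ?f = "\<lambda>u. indicator {0..t} u * f u"
  have fi: "integrable lborel ?f" using f by (simp add: set_integrable_def)
  then have m[measurable]: "?f \<in> borel_measurable borel" by auto
  \<comment> \<open>A kernel on the triangle u \<le> s \<le> t. The constant c = 1 yields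
    integrability of the primitive, c = r yields the identity; division by a possibly vanishing r is
    thereby avoided.\<close>
  let ?h = "\<lambda>c s u. indicator {0..t} s * (indicator {0..s} u * (c * exp (- r * s) * ?f u)) :: real"
  let ?C = "exp (\<bar>r\<bar> * t)"
  have hm[measurable]: "(\<lambda>(s, u). ?h c s u) \<in> borel_measurable (lborel \<Otimes>\<^sub>M lborel)" for c
  proof -
    have "(\<lambda>(s, u). indicator {0..t} s * (indicator {(s,u). 0 \<le> u \<and> u \<le> s} (s, u) * (c * exp (- r * s) * ?f u)) :: real)
       \<in> borel_measurable (lborel \<Otimes>\<^sub>M lborel)"
      by measurable
    moreover have "(\<lambda>(s, u). indicator {0..t} s * (indicator {(s,u). 0 \<le> u \<and> u \<le> s} (s, u) * (c * exp (- r * s) * ?f u)) :: real)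
      = (\<lambda>(s, u). ?h c s u)" by (auto simp: fun_eq_iff indicator_def)
    ultimately show ?thesis by (simp only:)
  qed
  have hi: "integrable (lborel \<Otimes>\<^sub>M lborel) (\<lambda>(s, u). ?h c s u)" for c
  proof -
    define g where "g u = \<bar>?f u\<bar>" for u
    have gi: "integrable lborel g" and [measurable]: "g \<in> borel_measurable borel"
      and g0: "\<And>u. \<bar>g u\<bar> = g u"
      unfolding g_def using fi by (auto simp del: abs_mult)
    have "integrable (lborel \<Otimes>\<^sub>M lborel) (\<lambda>(s, u). (\<bar>c\<bar> * ?C * indicator {0..t} s) * g u)"
      by (rule lborel_pair.Fubini_integrable)
        (use gi in \<open>auto simp: abs_mult g0 emeasure_lborel_Icc_eq\<close>)
    then have b: "integrable (lborel \<Otimes>\<^sub>M lborel) (\<lambda>(s, u). (\<bar>c\<bar> * ?C * indicator {0..t} s) * \<bar>?f u\<bar>)"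
      by (simp only: g_def)
    show ?thesis
    proof (rule Bochner_Integration.integrable_bound[OF b])
      show "AE x in lborel \<Otimes>\<^sub>M lborel. norm (case x of (s, u) \<Rightarrow> ?h c s u)
         \<le> norm (case x of (s, u) \<Rightarrow> (\<bar>c\<bar> * ?C * indicator {0..t} s) * \<bar>?f u\<bar>)"
      proof (rule AE_I2)
        fix x :: "real \<times> real"
        obtain s u where x: "x = (s, u)" by (cases x)
        show "norm (case x of (s, u) \<Rightarrow> ?h c s u)
            \<le> norm (case x of (s, u) \<Rightarrow> (\<bar>c\<bar> * ?C * indicator {0..t} s) * \<bar>?f u\<bar>)"
        proof (cases "0 \<le> u \<and> u \<le> s \<and> s \<le> t")
          case True
          then have "exp (- r * s) \<le> ?C" by (intro exp_neg_mult_bounds) auto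
          then have "\<bar>c\<bar> * exp (- r * s) * \<bar>f u\<bar> \<le> \<bar>c\<bar> * ?C * \<bar>f u\<bar>"
            by (intro mult_right_mono mult_left_mono) auto
          with True show ?thesis by (simp add: x abs_mult)
        next
          case False
          then have "?h c s u = 0" by (auto simp: indicator_def)
          then show ?thesis by (simp only: x prod.case norm_zero norm_ge_zero)
        qed
      qed
    qed measurable
  qed
  have inner: "(\<integral>u. ?h c s u \<partial>lborel) = indicator {0..t} s * (c * exp (- r * s) * (LINT u:{0..s}|lborel. f u))" for c s
  proof -
    have "(\<integral>u. ?h c s u \<partial>lborel) = (\<integral>u. (indicator {0..t} s * (c * exp (- r * s))) * (indicator {0..s} u * f u) \<partial>lborel)"
      by (rule Bochner_Integration.integral_cong) (auto simp: indicator_def)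
    also have "\<dots> = (indicator {0..t} s * (c * exp (- r * s))) * (LINT u:{0..s}|lborel. f u)"
      unfolding set_lebesgue_integral_def real_scaleR_def by (rule integral_mult_right_zero)
    finally show ?thesis by (simp only: mult.assoc)
  qed
  have "integrable lborel (\<lambda>s. \<integral>u. ?h 1 s u \<partial>lborel)"
    using lborel_pair.integrable_fst'[OF hi[of 1]] by simp
  then show "set_integrable lborel {0..t} (\<lambda>s. exp (- r * s) * (LINT u:{0..s}|lborel. f u))"
    unfolding inner by (simp add: set_integrable_def)
  \<comment> \<open>Integrating over s from u to t first leaves a difference of exponentials, whose
    two halves become the two terms of the claim.\<close>
  have outer: "(\<integral>s. ?h r s u \<partial>lborel) = ?f u * (exp (- r * u) - exp (- r * t))" for u
  proof (cases "0 \<le> u \<and> u \<le> t")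
    case True
    then have "(\<integral>s. ?h r s u \<partial>lborel) = (\<integral>s. f u * (indicator {u..t} s * (r * exp (- r * s))) \<partial>lborel)"
      by (intro Bochner_Integration.integral_cong) (auto simp: indicator_def)
    also have "\<dots> = f u * (exp (- r * u) - exp (- r * t))"
      using exp_discount_LINT[of u t r] True
      unfolding set_lebesgue_integral_def real_scaleR_def integral_mult_right_zero by simp
    finally show ?thesis using True by simp
  next
    case False
    then have "?f u = 0" by (auto simp: indicator_def)
    then show ?thesis by (simp only: mult_zero_right mult_zero_left Bochner_Integration.integral_zero)
  qed
  have e: "integrable lborel (\<lambda>u. exp (- r * u) * ?f u)"
    using set_integrable_discount[OF f, of r] by (simp add: set_integrable_def mult.left_commute)
  have "r * (LINT s:{0..t}|lborel. exp (- r * s) * (LINT u:{0..s}|lborel. f u)) = (\<integral>s. (\<integral>u. ?h r s u \<partial>lborel) \<partial>lborel)"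
    unfolding inner set_lebesgue_integral_def
    by (subst integral_mult_right_zero[symmetric]) (rule Bochner_Integration.integral_cong, auto)
  also have "\<dots> = (\<integral>u. (\<integral>s. ?h r s u \<partial>lborel) \<partial>lborel)"
    using lborel_pair.Fubini_integral[OF hi[of r]] by simp
  also have "\<dots> = (\<integral>u. exp (- r * u) * ?f u - exp (- r * t) * ?f u \<partial>lborel)"
    unfolding outer by (simp add: algebra_simps)
  also have "\<dots> = (LINT u:{0..t}|lborel. exp (- r * u) * f u) - exp (- r * t) * (LINT u:{0..t}|lborel. f u)"
  proof -
    have "(\<integral>u. exp (- r * u) * ?f u - exp (- r * t) * ?f u \<partial>lborel)
        = (\<integral>u. exp (- r * u) * ?f u \<partial>lborel) - exp (- r * t) * (\<integral>u. ?f u \<partial>lborel)"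
      using e fi by (subst Bochner_Integration.integral_diff) (simp_all only: integral_mult_right_zero integrable_mult_right)
    then show ?thesis by (simp add: set_lebesgue_integral_def mult.left_commute)
  qed
  finally show "exp (- r * t) * (LINT u:{0..t}|lborel. f u)
        + r * (LINT s:{0..t}|lborel. exp (- r * s) * (LINT u:{0..s}|lborel. f u))
      = (LINT u:{0..t}|lborel. exp (- r * u) * f u)" by simp
qed

text \<open>Variation of constants with a forcing path \<open>J\<close> that is merely continuous.
  Since dJ has no pathwise meaning, the integral of exp(- r s) against it appears integrated by
  parts, as the last two terms. For the wealth equation \<open>J\<close> is a path of the Ito
  integral.\<close>

lemma linear_integral_equation:
  fixes X f J :: "real \<Rightarrow> real"
  assumes X: "continuous_on {0..} X"
    and i: "\<And>s. 0 \<le> s \<Longrightarrow> set_integrable lborel {0..s} (\<lambda>u. r * X u + f u)"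
    and eq: "\<And>s. 0 \<le> s \<Longrightarrow> X s = x + (LINT u:{0..s}|lborel. r * X u + f u) + J s"
    and J: "continuous_on {0..} J" and t: "0 \<le> t"
  shows "set_integrable lborel {0..t} f"
    and "exp (- r * t) * X t = x + (LINT s:{0..t}|lborel. exp (- r * s) * f s) + exp (- r * t) * J t
      + r * (LINT s:{0..t}|lborel. exp (- r * s) * J s)"
proof -
  have Xi: "set_integrable lborel {0..s} X" if "0 \<le> s" for s
    by (rule borel_integrable_atLeastAtMost')(rule continuous_on_subset[OF X], auto)
  have Ji: "set_integrable lborel {0..s} J" if "0 \<le> s" for s
    by (rule borel_integrable_atLeastAtMost')(rule continuous_on_subset[OF J], auto)
  \<comment> \<open>Only the sum \<open>r * X u + f u\<close> is given as integrable; continuity of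
    \<open>X\<close> isolates \<open>f\<close>.\<close>
  have fi: "set_integrable lborel {0..s} f" if "0 \<le> s" for s
    using set_integral_diff(1)[OF i[OF that] set_integrable_mult_right[OF Xi[OF that], of r]] by simp
  show "set_integrable lborel {0..t} f" by (rule fi[OF t])
  define P Y where "P s = (LINT u:{0..s}|lborel. f u)" and "Y s = (LINT u:{0..s}|lborel. X u)" for s
  have X_eq: "X s = x + r * Y s + P s + J s" if "0 \<le> s" for s
    using eq[OF that] set_integral_add(2)[OF set_integrable_mult_right[OF Xi[OF that], of r] fi[OF that]]
    by (simp add: P_def Y_def)
  let ?L = "\<lambda>g. (LINT s:{0..t}|lborel. exp (- r * s) * g s)"
  have iP: "set_integrable lborel {0..t} (\<lambda>s. exp (- r * s) * P s)" and iY: "set_integrable lborel {0..t} (\<lambda>s. exp (- r * s) * Y s)"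
    unfolding P_def Y_def by (rule discounted_primitive_integrable[OF fi[OF t] t], rule discounted_primitive_integrable[OF Xi[OF t] t])
  have iJ: "set_integrable lborel {0..t} (\<lambda>s. exp (- r * s) * J s)"
    by (rule set_integrable_discount[OF Ji[OF t]])
  have i1: "set_integrable lborel {0..t} (\<lambda>s. exp (- r * s))"
    by (rule borel_integrable_atLeastAtMost') (auto intro!: continuous_intros)
  have "?L X = (LINT s:{0..t}|lborel. x * exp (- r * s) + r * (exp (- r * s) * Y s) + exp (- r * s) * P s + exp (- r * s) * J s)"
    by (rule set_lebesgue_integral_cong) (auto simp: X_eq algebra_simps)
  also have "\<dots> = x * (LINT s:{0..t}|lborel. exp (- r * s)) + r * ?L Y + ?L P + ?L J"
    using i1 iP iY iJ by (simp add: set_integral_add)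
  finally have LX: "?L X = x * (LINT s:{0..t}|lborel. exp (- r * s)) + r * ?L Y + ?L P + ?L J" .
  have Y: "exp (- r * t) * Y t + r * ?L Y = ?L X"
    using discounted_primitive[OF Xi[OF t] t, of r] by (simp add: Y_def)
  have P: "exp (- r * t) * P t + r * ?L P = ?L f"
    using discounted_primitive[OF fi[OF t] t, of r] by (simp add: P_def)
  have E: "r * (LINT s:{0..t}|lborel. exp (- r * s)) = 1 - exp (- r * t)"
    using exp_discount_LINT[OF t, of r] by simp
  have "exp (- r * t) * X t = exp (- r * t) * x + r * (exp (- r * t) * Y t) + exp (- r * t) * P t + exp (- r * t) * J t"
    using X_eq[OF t] by (simp add: algebra_simps)
  also have "exp (- r * t) * Y t = x * (LINT s:{0..t}|lborel. exp (- r * s)) + ?L P + ?L J"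
    using LX Y by simp
  also have "r * \<dots> = x * (1 - exp (- r * t)) + r * ?L P + r * ?L J"
    unfolding E[symmetric] by (simp add: algebra_simps)
  also have "exp (- r * t) * P t = ?L f - r * ?L P" using P by simp
  finally show "exp (- r * t) * X t = x + ?L f + exp (- r * t) * J t + r * ?L J"
    by (simp add: algebra_simps)
qed

text \<open>On a slab of finite length a square-integrable weight times a square-integrable process
  is integrable, and the discount factor is bounded there, so Fubini applies. The instance r = 0
  gives the undiscounted statements.\<close>

lemma (in prob_space)
  fixes f :: "real \<Rightarrow> 'a \<Rightarrow> real" and Y :: "'a \<Rightarrow> real"
  assumes m: "(\<lambda>(w, u). indicator {0..t} u * f u w) \<in> borel_measurable (M \<Otimes>\<^sub>M lborel)"
    and i: "integrable (M \<Otimes>\<^sub>M lborel) (\<lambda>(w, u). (indicator {0..t} u * f u w)\<^sup>2)"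
    and Y[measurable]: "Y \<in> borel_measurable M" and Y2: "integrable M (\<lambda>w. (Y w)\<^sup>2)"
  shows slab_mult_integrable: "integrable (M \<Otimes>\<^sub>M lborel) (\<lambda>(w, u). Y w * (indicator {0..t} u * (exp (- r * u) * f u w)))"
    and slab_AE_integrable: "AE w in M. set_integrable lborel {0..t} (\<lambda>u. f u w)"
    and slab_integrable: "integrable M (\<lambda>w. Y w * (LINT u:{0..t}|lborel. exp (- r * u) * f u w))"
    and slab_Fubini: "expectation (\<lambda>w. Y w * (LINT u:{0..t}|lborel. exp (- r * u) * f u w))
      = (LINT u:{0..t}|lborel. exp (- r * u) * expectation (\<lambda>w. Y w * f u w))"
    and slab_pairing_integrable: "set_integrable lborel {0..t} (\<lambda>u. expectation (\<lambda>w. Y w * f u w))"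
proof -
  interpret P: pair_sigma_finite M lborel ..
  let ?N = "M \<Otimes>\<^sub>M lborel"
  let ?f = "\<lambda>x. case x of (w, u) \<Rightarrow> indicator {0..t} u * f u w"
  note [measurable] = m
  have Z: "integrable ?N (\<lambda>(w, u). Z w * (indicator {0..t} u * (exp (- r * u) * f u w)))"
    if [measurable]: "Z \<in> borel_measurable M" and Z2: "integrable M (\<lambda>w. (Z w)\<^sup>2)" for Z :: "'a \<Rightarrow> real" and r
  proof -
    \<comment> \<open>The weight is cut off to a finite interval containing {0..t}, whatever the
      sign of t, so that it is square integrable on the product space.\<close>
    let ?Z = "\<lambda>x. case x of (w, u) \<Rightarrow> Z w * indicator {-\<bar>t\<bar> - 1<..\<bar>t\<bar>} u"
    have "has_bochner_integral ?N (\<lambda>(w, u). (Z w)\<^sup>2 * indicator {-\<bar>t\<bar> - 1<..\<bar>t\<bar>} u)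
        (expectation (\<lambda>w. (Z w)\<^sup>2) * (\<bar>t\<bar> - (-\<bar>t\<bar> - 1)))"
      by (intro has_bochner_integral_mult_indicator_Ioc Z2) auto
    moreover have "(\<lambda>(w, u). (Z w)\<^sup>2 * indicator {-\<bar>t\<bar> - 1<..\<bar>t\<bar>} u) = (\<lambda>x. (?Z x)\<^sup>2)"
      by (auto simp: fun_eq_iff indicator_def)
    ultimately have "integrable ?N (\<lambda>x. (?Z x)\<^sup>2)" by (simp add: has_bochner_integral_iff)
    then have "integrable ?N (\<lambda>x. ?Z x * ?f x)"
      using i by (intro integrable_mult_square) (auto simp: split_beta')
    then have b: "integrable ?N (\<lambda>x. exp (\<bar>r\<bar> * t) * (?Z x * ?f x))" by simp
    have "integrable ?N (\<lambda>x. exp (- r * snd x) * (Z (fst x) * ?f x))"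
    proof (rule Bochner_Integration.integrable_bound[OF b])
      show "AE x in ?N. norm (exp (- r * snd x) * (Z (fst x) * ?f x)) \<le> norm (exp (\<bar>r\<bar> * t) * (?Z x * ?f x))"
      proof (rule AE_I2)
        fix x :: "'a \<times> real"
        obtain w u where x: "x = (w, u)" by (cases x)
        show "norm (exp (- r * snd x) * (Z (fst x) * ?f x)) \<le> norm (exp (\<bar>r\<bar> * t) * (?Z x * ?f x))"
          using exp_neg_mult_bounds[of u t r]
          by (cases "0 \<le> u \<and> u \<le> t") (auto simp: x abs_mult intro!: mult_right_mono)
      qed
    qed measurable
    then show ?thesis by (simp add: split_beta' mult_ac)
  qed
  note A = Z[OF Y Y2]
  show "integrable ?N (\<lambda>(w, u). Y w * (indicator {0..t} u * (exp (- r * u) * f u w)))" by (rule A)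
  show "AE w in M. set_integrable lborel {0..t} (\<lambda>u. f u w)"
    using P.AE_integrable_fst'[OF Z[of "\<lambda>_. 1" 0]] by (simp add: set_integrable_def)
  have eq: "(\<integral>u. Y w * (indicator {0..t} u * (exp (- r * u) * f u w)) \<partial>lborel)
      = Y w * (LINT u:{0..t}|lborel. exp (- r * u) * f u w)" for w r
    by (simp add: set_lebesgue_integral_def)
  have eq2: "expectation (\<lambda>w. Y w * (indicator {0..t} u * (exp (- r * u) * f u w)))
     = indicator {0..t} u * (exp (- r * u) * expectation (\<lambda>w. Y w * f u w))" for u r
  proof -
    have "expectation (\<lambda>w. Y w * (indicator {0..t} u * (exp (- r * u) * f u w)))
      = expectation (\<lambda>w. (indicator {0..t} u * exp (- r * u)) * (Y w * f u w))"
      by (rule Bochner_Integration.integral_cong) auto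
    then show ?thesis by simp
  qed
  show "integrable M (\<lambda>w. Y w * (LINT u:{0..t}|lborel. exp (- r * u) * f u w))"
    using P.integrable_fst'[OF A[of r]] unfolding prod.case eq .
  show "expectation (\<lambda>w. Y w * (LINT u:{0..t}|lborel. exp (- r * u) * f u w))
      = (LINT u:{0..t}|lborel. exp (- r * u) * expectation (\<lambda>w. Y w * f u w))"
    using P.Fubini_integral[OF A[of r]] unfolding eq eq2 by (simp add: set_lebesgue_integral_def)
  have "integrable lborel (\<lambda>u. expectation (\<lambda>w. Y w * (indicator {0..t} u * (exp (- 0 * u) * f u w))))"
    using P.integrable_snd[OF A[of 0]] .
  then show "set_integrable lborel {0..t} (\<lambda>u. expectation (\<lambda>w. Y w * f u w))"
    unfolding eq2 by (simp add: set_integrable_def)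
qed

section \<open>The budget constraint\<close>

text \<open>An Ito integral has continuous paths only almost surely. Setting it to 0 on a null set
  makes every path continuous, which is what joint measurability requires.\<close>

lemma (in prob_space) continuous_modification:
  fixes I :: "real \<Rightarrow> 'a \<Rightarrow> real"
  assumes "continuous_paths M I"
  obtains N where "N \<in> null_sets M"
    and "\<And>w. w \<in> space M \<Longrightarrow> continuous_on {0..} (\<lambda>t. if w \<in> N then 0 else I t w)"
proof -
  from assms obtain N where N: "N \<in> null_sets M" "{w \<in> space M. \<not> continuous_on {0..} (\<lambda>t. I t w)} \<subseteq> N"
    unfolding continuous_paths_def eventually_ae_filter by blast
  have "continuous_on {0..} (\<lambda>t. if w \<in> N then 0 else I t w)" if "w \<in> space M" for w
    using N(2) that by (cases "w \<in> N") auto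
  with N(1) show thesis by (rule that)
qed

lemma measurable_off_null_set:
  assumes "N \<in> null_sets M" "f \<in> borel_measurable M"
  shows "(\<lambda>w. if w \<in> N then 0 else f w :: real) \<in> borel_measurable M"
  using assms by (intro measurable_If_set) auto

context brownian
begin

lemma G_slab_measurable:
  assumes "A \<in> sets borel" "A \<subseteq> {0..}"
  shows "(\<lambda>(w, u). indicator A u * G \<theta> u w) \<in> borel_measurable (M \<Otimes>\<^sub>M lborel)"
proof (rule pair_measurable_slab[OF continuous_imp_pair_measurable])
  show "0 \<le> t \<Longrightarrow> G \<theta> t \<in> borel_measurable M" for t by (rule G_measurable_M)
  show "continuous_on {0..} (\<lambda>t. G \<theta> t w)" if "w \<in> space M" for w
    unfolding G_def by (intro continuous_intros W_continuous that) auto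
qed (use assms in auto)

text \<open>Tonelli with time as the outer variable: a uniform second-moment bound times the finite
  length of the slab.\<close>

lemma slab_sq_integrable:
  fixes J :: "real \<Rightarrow> 'a \<Rightarrow> real"
  assumes m: "(\<lambda>(w, u). indicator {0..t} u * J u w) \<in> borel_measurable (M \<Otimes>\<^sub>M lborel)"
    and i: "\<And>s. 0 \<le> s \<Longrightarrow> s \<le> t \<Longrightarrow> integrable M (\<lambda>w. (J s w)\<^sup>2)"
    and B: "\<And>s. 0 \<le> s \<Longrightarrow> s \<le> t \<Longrightarrow> expectation (\<lambda>w. (J s w)\<^sup>2) \<le> B"
  shows "integrable (M \<Otimes>\<^sub>M lborel) (\<lambda>(w, u). (indicator {0..t} u * J u w)\<^sup>2)"
proof -
  interpret P: pair_sigma_finite M lborel ..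
  let ?f = "\<lambda>w u. ennreal ((indicator {0..t} u * J u w)\<^sup>2)"
  have m2: "(\<lambda>(w, u). (indicator {0..t} u * J u w)\<^sup>2) \<in> borel_measurable (M \<Otimes>\<^sub>M lborel)"
    using borel_measurable_power[OF m, of 2] by (simp add: split_beta')
  have le: "(\<integral>\<^sup>+w. ?f w u \<partial>M) \<le> ennreal B * indicator {0..t} u" for u
  proof (cases "0 \<le> u \<and> u \<le> t")
    case True
    then have "(\<integral>\<^sup>+w. ?f w u \<partial>M) = ennreal (expectation (\<lambda>w. (J u w)\<^sup>2))"
      using nn_integral_eq_integral[OF i[of u]] by simp
    then show ?thesis using True B[of u] by (simp add: ennreal_leI)
  qed auto
  have "(\<integral>\<^sup>+x. (case x of (w, u) \<Rightarrow> ?f w u) \<partial>(M \<Otimes>\<^sub>M lborel)) = (\<integral>\<^sup>+u. (\<integral>\<^sup>+w. ?f w u \<partial>M) \<partial>lborel)"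
    using m2 by (subst P.nn_integral_snd[symmetric]) (auto simp: split_beta')
  also have "\<dots> \<le> (\<integral>\<^sup>+u. ennreal B * indicator {0..t} u \<partial>lborel)"
    by (intro nn_integral_mono le)
  also have "\<dots> < \<infinity>"
    by (simp add: nn_integral_cmult emeasure_lborel_Icc_eq ennreal_mult_less_top)
  finally show ?thesis
    using m2 by (intro integrableI_nonneg) (auto simp: split_beta')
qed

text \<open>The weight is frozen at the terminal time t, so each term of the solved wealth equation
  can be paired with it. In expectation the market drift lam * H cancels against the paired Ito
  terms and only x remains; nonnegativity of the terminal wealth turns the resulting equality into
  the bound.\<close>

lemma wealth_state_price_bound:
  assumes wp: "wealth_process M F W r \<sigma> lam x c \<pi> X" and X0: "AE w in M. \<forall>t\<ge>0. 0 \<le> X t w"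
    and c: "c \<in> L1_loc_nonneg M F" and t: "0 \<le> t"
  shows "(\<integral>\<^sup>+w. ennreal (G (- lam) t w) * (\<integral>\<^sup>+u\<in>{0..t}. ennreal (exp (- r * u) * c u w) \<partial>lborel) \<partial>M) \<le> ennreal x"
proof -
  interpret P: pair_sigma_finite M lborel ..
  obtain I where I: "ito_integral M F W (\<lambda>t w. \<sigma> * \<pi> t w) I" and
    Xeq: "AE w in M. \<forall>t\<ge>0.
           set_integrable lborel {0..t} (\<lambda>s. r * X s w + \<sigma> * lam * \<pi> s w - c s w) \<and>
           X t w = x + (LINT s:{0..t}|lborel. r * X s w + \<sigma> * lam * \<pi> s w - c s w) + I t w"
    using wp unfolding wealth_process_def by blast
  have Xc: "continuous_paths M X" using wp by (simp add: wealth_process_def)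
  let ?H = "\<lambda>t w. \<sigma> * \<pi> t w"
  let ?\<theta> = "- lam"
  let ?Z = "G ?\<theta> t"
  have H: "?H \<in> L2_loc M F" and Ic: "continuous_paths M I" and Ia: "adapted F I"
    using I by (auto simp: ito_integral_def)
  obtain N where N: "N \<in> null_sets M"
    and Nc: "\<And>w. w \<in> space M \<Longrightarrow> continuous_on {0..} (\<lambda>t. if w \<in> N then 0 else I t w)"
    using continuous_modification[OF Ic] by blast
  define J where "J s w = (if w \<in> N then 0 else I s w)" for s w
  have AEN: "AE w in M. w \<notin> N" by (rule AE_not_in[OF N])
  have Im: "I s \<in> borel_measurable M" if "0 \<le> s" for s
    using Ia that measurable_F_M by (auto simp: adapted_def)
  have Jm: "J s \<in> borel_measurable M" if "0 \<le> s" for s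
    unfolding J_def by (intro measurable_off_null_set N Im that)
  have JI: "AE w in M. J s w = I s w" for s
    using AEN by eventually_elim (simp add: J_def)
  have Zm[measurable]: "?Z \<in> borel_measurable M" by (rule G_measurable_M[OF t])
  have Z2: "integrable M (\<lambda>w. (?Z w)\<^sup>2)"
    using G_sq_mean[OF t, of ?\<theta>] by (simp add: has_bochner_integral_iff)
  have Hs: "(\<lambda>(w, u). indicator {0..s} u * ?H u w) \<in> borel_measurable (M \<Otimes>\<^sub>M lborel)"
     "integrable (M \<Otimes>\<^sub>M lborel) (\<lambda>(w, u). (indicator {0..s} u * ?H u w)\<^sup>2)" for s
    by (rule L2_loc_slab_measurable[OF H], rule L2_loc_slab_integrable[OF H])
  have Js: "(\<lambda>(w, u). indicator {0..t} u * J u w) \<in> borel_measurable (M \<Otimes>\<^sub>M lborel)"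
    by (rule pair_measurable_slab[OF continuous_imp_pair_measurable])
      (use Jm Nc[folded J_def] in auto)
  have J2: "integrable M (\<lambda>w. (J s w)\<^sup>2)" if "0 \<le> s" for s
    using ito_integral_sq_integrable[OF I that] Jm[OF that] Im[OF that] JI[of s]
    by (subst integrable_cong_AE[where g="\<lambda>w. (I s w)\<^sup>2"]) auto
  \<comment> \<open>By the isometry the second moments of the Ito integral grow with time, so the
    value at t bounds all earlier ones.\<close>
  define B where "B = (\<integral>x. (case x of (w, u) \<Rightarrow> indicator {0..t} u * ?H u w)\<^sup>2 \<partial>(M \<Otimes>\<^sub>M lborel))"
  have JB: "expectation (\<lambda>w. (J s w)\<^sup>2) \<le> B" if "0 \<le> s" "s \<le> t" for s
  proof -
    have "expectation (\<lambda>w. (J s w)\<^sup>2) = expectation (\<lambda>w. (I s w)\<^sup>2)"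
      using Jm[OF that(1)] Im[OF that(1)] JI[of s] by (intro integral_cong_AE) auto
    also have "\<dots> = (\<integral>x. (case x of (w, u) \<Rightarrow> indicator {0..s} u * ?H u w)\<^sup>2 \<partial>(M \<Otimes>\<^sub>M lborel))"
      by (rule ito_isometry[OF I that(1)])
    also have "\<dots> \<le> B"
      unfolding B_def
    proof (rule integral_mono)
      have "integrable (M \<Otimes>\<^sub>M lborel) (\<lambda>x. (case x of (w, u) \<Rightarrow> indicator {0..s} u * ?H u w)\<^sup>2)" for s
        using Hs(2)[of s] by (simp add: split_beta')
      note Hi = this
      show "integrable (M \<Otimes>\<^sub>M lborel) (\<lambda>x. (case x of (w, u) \<Rightarrow> indicator {0..s} u * ?H u w)\<^sup>2)"
        "integrable (M \<Otimes>\<^sub>M lborel) (\<lambda>x. (case x of (w, u) \<Rightarrow> indicator {0..t} u * ?H u w)\<^sup>2)"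
        by (rule Hi)+
      show "(case x of (w, u) \<Rightarrow> indicator {0..s} u * ?H u w)\<^sup>2 \<le> (case x of (w, u) \<Rightarrow> indicator {0..t} u * ?H u w)\<^sup>2" for x
        using that by (cases x) (auto simp: indicator_def)
    qed
    finally show ?thesis .
  qed
  have Ji: "integrable (M \<Otimes>\<^sub>M lborel) (\<lambda>(w, u). (indicator {0..t} u * J u w)\<^sup>2)"
    by (rule slab_sq_integrable[OF Js J2 JB])
  \<comment> \<open>The mean of the diffusion coefficient under the weight. Both the drift term and
    the Ito terms are expressed through this one deterministic function.\<close>
  define p where "p u = expectation (\<lambda>w. ?Z w * ?H u w)" for u
  have p: "set_integrable lborel {0..t} p"
    unfolding p_def by (rule slab_pairing_integrable[OF Hs[of t] Zm Z2])
  have pair: "expectation (\<lambda>w. ?Z w * J s w) = ?\<theta> * (LINT u:{0..s}|lborel. p u)" if s: "0 \<le> s" "s \<le> t" for s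
  proof -
    have "expectation (\<lambda>w. ?Z w * J s w) = expectation (\<lambda>w. ?Z w * I s w)"
      using Jm[OF s(1)] Im[OF s(1)] JI[of s] by (intro integral_cong_AE) auto
    also have "\<dots> = ?\<theta> * (\<integral>x. (case x of (w, u) \<Rightarrow> indicator {0..s} u * ?Z w)
        * (case x of (w, u) \<Rightarrow> indicator {0..s} u * ?H u w) \<partial>(M \<Otimes>\<^sub>M lborel))"
      by (rule ito_pairing[OF I s])
    also have "(\<integral>x. (case x of (w, u) \<Rightarrow> indicator {0..s} u * ?Z w)
        * (case x of (w, u) \<Rightarrow> indicator {0..s} u * ?H u w) \<partial>(M \<Otimes>\<^sub>M lborel))
      = (\<integral>x. (case x of (w, u) \<Rightarrow> ?Z w * (indicator {0..s} u * (exp (- 0 * u) * ?H u w))) \<partial>(M \<Otimes>\<^sub>M lborel))"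
      by (intro Bochner_Integration.integral_cong) (auto simp: indicator_def)
    also have "\<dots> = expectation (\<lambda>w. ?Z w * (LINT u:{0..s}|lborel. exp (- 0 * u) * ?H u w))"
      using P.integral_fst'[OF slab_mult_integrable[OF Hs[of s] Zm Z2, of 0]]
      unfolding set_lebesgue_integral_def real_scaleR_def by (simp only: prod.case integral_mult_right_zero)
    also have "\<dots> = (LINT u:{0..s}|lborel. p u)"
      using slab_Fubini[OF Hs[of s] Zm Z2, of 0] by (simp add: p_def)
    finally show ?thesis .
  qed
  define A1 A2 where "A1 w = (LINT u:{0..t}|lborel. exp (- r * u) * ?H u w)"
    and "A2 w = (LINT u:{0..t}|lborel. exp (- r * u) * J u w)" for w
  have i1: "integrable M (\<lambda>w. ?Z w * A1 w)"
    and e1: "expectation (\<lambda>w. ?Z w * A1 w) = (LINT u:{0..t}|lborel. exp (- r * u) * p u)"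
    unfolding A1_def p_def by (rule slab_integrable[OF Hs[of t] Zm Z2], rule slab_Fubini[OF Hs[of t] Zm Z2])
  have i2: "integrable M (\<lambda>w. ?Z w * A2 w)"
    unfolding A2_def by (rule slab_integrable[OF Js Ji Zm Z2])
  have "expectation (\<lambda>w. ?Z w * A2 w) = (LINT u:{0..t}|lborel. exp (- r * u) * expectation (\<lambda>w. ?Z w * J u w))"
    unfolding A2_def by (rule slab_Fubini[OF Js Ji Zm Z2])
  also have "\<dots> = (LINT u:{0..t}|lborel. ?\<theta> * (exp (- r * u) * (LINT v:{0..u}|lborel. p v)))"
    by (rule set_lebesgue_integral_cong) (auto simp: pair)
  finally have e2: "expectation (\<lambda>w. ?Z w * A2 w) = ?\<theta> * (LINT u:{0..t}|lborel. exp (- r * u) * (LINT v:{0..u}|lborel. p v))"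
    by (simp only: set_integral_mult_right)
  have i3: "integrable M (\<lambda>w. ?Z w * J t w)"
    using J2[OF t] Jm[OF t] Z2 by (intro integrable_mult_square) auto
  have i4: "integrable M ?Z" "expectation ?Z = 1"
    using G_mean[OF t, of ?\<theta>] by (auto simp: has_bochner_integral_iff)
  \<comment> \<open>Almost surely this is \<open>?Z w\<close> times the sum of discounted wealth and
    discounted consumption, as the solved wealth equation shows. Written in this form it contains
    neither \<open>X\<close> nor \<open>c\<close>, so its integrability is known.\<close>
  define R where "R w = ?Z w * x + lam * (?Z w * A1 w) + exp (- r * t) * (?Z w * J t w) + r * (?Z w * A2 w)" for w
  have Ri: "integrable M R" unfolding R_def using i1 i2 i3 i4(1) by auto
  have "expectation R = x + lam * (LINT u:{0..t}|lborel. exp (- r * u) * p u)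
     + ?\<theta> * (exp (- r * t) * (LINT u:{0..t}|lborel. p u)
        + r * (LINT u:{0..t}|lborel. exp (- r * u) * (LINT v:{0..u}|lborel. p v)))"
  proof -
    have "expectation R = expectation ?Z * x + lam * expectation (\<lambda>w. ?Z w * A1 w)
        + exp (- r * t) * expectation (\<lambda>w. ?Z w * J t w) + r * expectation (\<lambda>w. ?Z w * A2 w)"
      unfolding R_def using i1 i2 i3 i4(1) by simp
    moreover have "1 * x + lam * a + e * (- lam * b) + r * (- lam * d)
        = x + lam * a + - lam * (e * b + r * d)" for a b d e :: real by algebra
    ultimately show ?thesis unfolding e1 e2 pair[OF t order.refl] i4(2) by (simp only:)
  qed
  \<comment> \<open>The Ito part is - lam times the left side of
    \<open>discounted_primitive\<close>, hence the negative of the drift part.\<close>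
  also have "\<dots> = x" using discounted_primitive[OF p t, of r] by simp
  finally have ER: "expectation R = x" .
  have key: "AE w in M. ennreal (?Z w) * (\<integral>\<^sup>+u\<in>{0..t}. ennreal (exp (- r * u) * c u w) \<partial>lborel) \<le> ennreal (R w)
      \<and> 0 \<le> R w"
    using Xeq X0 Xc[unfolded continuous_paths_def] AEN slab_AE_integrable[OF Hs[of t] Zm Z2] AE_space
  proof eventually_elim
    case (elim w)
    let ?f = "\<lambda>u. lam * ?H u w - c u w"
    have Jc: "continuous_on {0..} (\<lambda>s. J s w)" using Nc[OF elim(6)] unfolding J_def .
    have rw: "r * X s w + \<sigma> * lam * \<pi> s w - c s w = r * X s w + ?f s" for s by simp
    have "set_integrable lborel {0..t} ?f"
      and X: "exp (- r * t) * X t w = x + (LINT s:{0..t}|lborel. exp (- r * s) * ?f s) + exp (- r * t) * J t w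
      + r * (LINT s:{0..t}|lborel. exp (- r * s) * J s w)"
      using elim(1,4) unfolding rw
      by (intro linear_integral_equation[OF elim(3) _ _ Jc t]; simp add: J_def)+
    then have ci: "set_integrable lborel {0..t} (\<lambda>u. c u w)"
      using set_integral_diff(1)[OF set_integrable_mult_right[OF elim(5), of lam]] by fastforce
    have di: "set_integrable lborel {0..t} (\<lambda>u. exp (- r * u) * c u w)"
      by (rule set_integrable_discount[OF ci])
    define D where "D = (LINT u:{0..t}|lborel. exp (- r * u) * c u w)"
    have "(LINT s:{0..t}|lborel. exp (- r * s) * ?f s) = (LINT s:{0..t}|lborel. lam * (exp (- r * s) * ?H s w) - exp (- r * s) * c s w)"
      by (simp add: algebra_simps)
    also have "\<dots> = lam * A1 w - D"
      unfolding A1_def D_def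
      by (subst set_integral_diff(2)[OF set_integrable_mult_right[OF set_integrable_discount[OF elim(5)]] di])
        (simp only: set_integral_mult_right)
    finally have XD: "exp (- r * t) * X t w + D = x + lam * A1 w + exp (- r * t) * J t w + r * A2 w"
      using X by (simp add: A2_def)
    have c0: "0 \<le> c u w" if "0 \<le> u" for u
      using c that elim(6) by (simp add: L1_loc_nonneg_def)
    have "(\<integral>\<^sup>+u\<in>{0..t}. ennreal (exp (- r * u) * c u w) \<partial>lborel)
       = (\<integral>\<^sup>+u. ennreal (indicator {0..t} u * (exp (- r * u) * c u w)) \<partial>lborel)"
      by (intro nn_integral_cong) (auto simp: indicator_def)
    also have "\<dots> = ennreal D"
      unfolding D_def set_lebesgue_integral_def real_scaleR_def
      using di c0 by (intro nn_integral_eq_integral) (auto simp: set_integrable_def indicator_def)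
    finally have nn: "(\<integral>\<^sup>+u\<in>{0..t}. ennreal (exp (- r * u) * c u w) \<partial>lborel) = ennreal D" .
    have D0: "0 \<le> D" unfolding D_def set_lebesgue_integral_def
      using c0 by (intro integral_nonneg_AE) (auto simp: indicator_def)
    have "R w = ?Z w * (exp (- r * t) * X t w + D)"
      unfolding XD R_def by (simp add: algebra_simps)
    \<comment> \<open>The only place where admissibility, in the form of nonnegative wealth,
      enters.\<close>
    moreover have "0 \<le> exp (- r * t) * X t w" using elim(2) t by simp
    ultimately have "?Z w * D \<le> R w" "0 \<le> ?Z w * D" using D0 by (auto intro!: mult_left_mono)
    moreover from this have "0 \<le> R w" by linarith
    ultimately show ?case unfolding nn by (auto simp: ennreal_mult[symmetric] D0 intro!: ennreal_leI)
  qed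
  have "(\<integral>\<^sup>+w. ennreal (?Z w) * (\<integral>\<^sup>+u\<in>{0..t}. ennreal (exp (- r * u) * c u w) \<partial>lborel) \<partial>M)
      \<le> (\<integral>\<^sup>+w. ennreal (R w) \<partial>M)"
    using key by (intro nn_integral_mono_AE) auto
  also have "\<dots> = ennreal x"
    using Ri key ER by (subst nn_integral_eq_integral) auto
  finally show ?thesis .
qed

text \<open>On a finite horizon, Tonelli exposes the expectation at each fixed u, where the terminal
  weight can be exchanged for the weight at u; swapping back gives
  \<open>wealth_state_price_bound\<close>. Monotone convergence over integer horizons removes the
  truncation.\<close>

theorem budget_constraint:
  assumes wp: "wealth_process M F W r \<sigma> lam x c \<pi> X" and X0: "AE w in M. \<forall>t\<ge>0. 0 \<le> X t w"
    and c: "c \<in> L1_loc_nonneg M F"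
  shows "(\<integral>\<^sup>+w. (\<integral>\<^sup>+u\<in>{0..}. ennreal (exp (- r * u) * G (- lam) u w * c u w) \<partial>lborel) \<partial>M) \<le> ennreal x"
proof -
  interpret P: pair_sigma_finite M lborel ..
  have jm: "jointly_measurable M c" and ca: "\<And>u. 0 \<le> u \<Longrightarrow> c u \<in> borel_measurable (F u)"
    using c by (auto simp: L1_loc_nonneg_def L1_loc_def adapted_def)
  have fin: "(\<integral>\<^sup>+w. (\<integral>\<^sup>+u\<in>{0..t}. ennreal (exp (- r * u) * G (- lam) u w * c u w) \<partial>lborel) \<partial>M) \<le> ennreal x"
    if t: "0 \<le> t" for t
  proof -
    note [measurable] = jointly_measurable_slab[OF jm, of "{0..t}"] G_slab_measurable[of "{0..t}" "- lam"] G_measurable_M[OF t]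
    let ?c = "\<lambda>x. case x of (w, u) \<Rightarrow> indicator {0..t} u * c u w"
    let ?g = "\<lambda>x. case x of (w, u) \<Rightarrow> indicator {0..t} u * G (- lam) u w"
    have m: "(\<lambda>x. ennreal (exp (- r * snd x) * (?g x * ?c x))) \<in> borel_measurable (M \<Otimes>\<^sub>M lborel)"
      "(\<lambda>x. ennreal (exp (- r * snd x) * (G (- lam) t (fst x) * ?c x))) \<in> borel_measurable (M \<Otimes>\<^sub>M lborel)"
      by measurable
    have "(\<integral>\<^sup>+w. (\<integral>\<^sup>+u\<in>{0..t}. ennreal (exp (- r * u) * G (- lam) u w * c u w) \<partial>lborel) \<partial>M)
      = (\<integral>\<^sup>+w. (\<integral>\<^sup>+u. ennreal (exp (- r * u) * (?g (w, u) * ?c (w, u))) \<partial>lborel) \<partial>M)"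
      by (intro nn_integral_cong) (auto simp: indicator_def mult.assoc)
    also have "\<dots> = (\<integral>\<^sup>+u. (\<integral>\<^sup>+w. ennreal (exp (- r * u) * (?g (w, u) * ?c (w, u))) \<partial>M) \<partial>lborel)"
      using P.Fubini[OF m(1)] by simp
    also have "\<dots> = (\<integral>\<^sup>+u. (\<integral>\<^sup>+w. ennreal (exp (- r * u) * (G (- lam) t w * ?c (w, u))) \<partial>M) \<partial>lborel)"
    proof (rule nn_integral_cong)
      fix u :: real
      show "(\<integral>\<^sup>+w. ennreal (exp (- r * u) * (?g (w, u) * ?c (w, u))) \<partial>M)
          = (\<integral>\<^sup>+w. ennreal (exp (- r * u) * (G (- lam) t w * ?c (w, u))) \<partial>M)"
      proof (cases "0 \<le> u \<and> u \<le> t")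
        case True
        \<comment> \<open>Adaptedness of consumption is what allows the martingale property to
          replace time t by time u.\<close>
        then have "(\<lambda>w. exp (- r * u) * c u w) \<in> borel_measurable (F u)" using ca[of u] by simp
        from G_martingale_nn[OF _ _ this, of t "- lam"] True show ?thesis
          by (simp add: mult.assoc mult.commute[of "G _ _ _"])
      qed auto
    qed
    also have "\<dots> = (\<integral>\<^sup>+w. (\<integral>\<^sup>+u. ennreal (exp (- r * u) * (G (- lam) t w * ?c (w, u))) \<partial>lborel) \<partial>M)"
      using P.Fubini[OF m(2)] by simp
    also have "\<dots> = (\<integral>\<^sup>+w. ennreal (G (- lam) t w) * (\<integral>\<^sup>+u\<in>{0..t}. ennreal (exp (- r * u) * c u w) \<partial>lborel) \<partial>M)"
    proof (rule nn_integral_cong)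
      fix w assume "w \<in> space M"
      have cm: "(\<lambda>u. indicator {0..t} u * c u w) \<in> borel_measurable lborel"
        using measurable_Pair2[OF jointly_measurable_slab[OF jm, of "{0..t}"] \<open>w \<in> space M\<close>] by simp
      have "(\<integral>\<^sup>+u. ennreal (exp (- r * u) * (G (- lam) t w * ?c (w, u))) \<partial>lborel)
        = (\<integral>\<^sup>+u. ennreal (G (- lam) t w) * ennreal (exp (- r * u) * (indicator {0..t} u * c u w)) \<partial>lborel)"
        by (intro nn_integral_cong) (simp add: ennreal_mult'[symmetric] mult_ac)
      also have "\<dots> = ennreal (G (- lam) t w) * (\<integral>\<^sup>+u. ennreal (exp (- r * u) * (indicator {0..t} u * c u w)) \<partial>lborel)"
        by (intro nn_integral_cmult measurable_compose[OF _ measurable_ennreal] borel_measurable_times[OF _ cm]) auto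
      also have "(\<integral>\<^sup>+u. ennreal (exp (- r * u) * (indicator {0..t} u * c u w)) \<partial>lborel)
        = (\<integral>\<^sup>+u\<in>{0..t}. ennreal (exp (- r * u) * c u w) \<partial>lborel)"
        by (intro nn_integral_cong) (auto simp: indicator_def)
      finally show "(\<integral>\<^sup>+u. ennreal (exp (- r * u) * (G (- lam) t w * ?c (w, u))) \<partial>lborel)
        = ennreal (G (- lam) t w) * (\<integral>\<^sup>+u\<in>{0..t}. ennreal (exp (- r * u) * c u w) \<partial>lborel)" .
    qed
    also have "\<dots> \<le> ennreal x"
      by (rule wealth_state_price_bound[OF wp X0 c t])
    finally show ?thesis .
  qed
  let ?k = "\<lambda>x. case x of (w, u) \<Rightarrow> ennreal (exp (- r * u) * G (- lam) u w * c u w) * indicator {0..} u"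
  let ?kn = "\<lambda>n x. case x of (w, u) \<Rightarrow> ennreal (exp (- r * u) * G (- lam) u w * c u w) * indicator {0..real n} u"
  have km: "(\<lambda>(w, u). ennreal (exp (- r * u) * G (- lam) u w * c u w) * indicator A u) \<in> borel_measurable (M \<Otimes>\<^sub>M lborel)"
    if A: "A \<in> sets borel" "A \<subseteq> {0..}" for A
  proof -
    note [measurable] = jointly_measurable_slab[OF jm A] G_slab_measurable[OF A, of "- lam"]
    have "(\<lambda>x. ennreal (exp (- r * snd x) * ((case x of (w, u) \<Rightarrow> indicator A u * G (- lam) u w) *
        (case x of (w, u) \<Rightarrow> indicator A u * c u w)))) \<in> borel_measurable (M \<Otimes>\<^sub>M lborel)"
      by measurable
    also have "(\<lambda>x. ennreal (exp (- r * snd x) * ((case x of (w, u) \<Rightarrow> indicator A u * G (- lam) u w) *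
        (case x of (w, u) \<Rightarrow> indicator A u * c u w))))
      = (\<lambda>(w, u). ennreal (exp (- r * u) * G (- lam) u w * c u w) * indicator A u)"
      by (auto simp: fun_eq_iff indicator_def mult.assoc)
    finally show ?thesis .
  qed
  have "(\<integral>\<^sup>+w. (\<integral>\<^sup>+u\<in>{0..}. ennreal (exp (- r * u) * G (- lam) u w * c u w) \<partial>lborel) \<partial>M)
    = (\<integral>\<^sup>+x. ?k x \<partial>(M \<Otimes>\<^sub>M lborel))"
    using lborel.nn_integral_fst[OF km[of "{0..}"]] by simp
  also have "\<dots> = (\<integral>\<^sup>+x. (SUP n. ?kn n x) \<partial>(M \<Otimes>\<^sub>M lborel))"
  proof (intro nn_integral_cong)
    fix x :: "'a \<times> real"
    obtain w u where x: "x = (w, u)" by (cases x)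
    obtain n :: nat where "u \<le> real n" using real_arch_simple by blast
    then have "?k x \<le> ?kn n x" by (auto simp: x indicator_def)
    then have "?k x \<le> (SUP n. ?kn n x)" by (rule SUP_upper2[OF UNIV_I])
    moreover have "(SUP n. ?kn n x) \<le> ?k x" by (rule SUP_least) (auto simp: x indicator_def)
    ultimately show "?k x = (SUP n. ?kn n x)" by (rule antisym)
  qed
  also have "\<dots> = (SUP n. \<integral>\<^sup>+x. ?kn n x \<partial>(M \<Otimes>\<^sub>M lborel))"
    by (intro nn_integral_monotone_convergence_SUP km) (auto simp: incseq_def le_fun_def indicator_def)
  also have "\<dots> \<le> ennreal x"
  proof (rule SUP_least)
    fix n :: nat
    show "(\<integral>\<^sup>+x. ?kn n x \<partial>(M \<Otimes>\<^sub>M lborel)) \<le> ennreal x"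
      using lborel.nn_integral_fst[OF km[of "{0..real n}"]] fin[of "real n"] by simp
  qed
  finally show ?thesis .
qed

end

section \<open>Geometric Brownian motion\<close>

lemma abs_exp_minus_one_le: "\<bar>exp z - 1\<bar> \<le> exp \<bar>z\<bar> - (1::real)"
proof (cases "0 \<le> z")
  case False
  have "1 + z \<le> exp z" "1 + (- z) \<le> exp (- z)" by (rule exp_ge_add_one_self)+
  moreover have "\<bar>z\<bar> = - z" "\<bar>exp z - 1\<bar> = 1 - exp z" using False by auto
  ultimately show ?thesis by linarith
qed simp

lemma exp_mult_le_abs:
  fixes \<alpha> s T :: real
  assumes "0 \<le> s" "s \<le> T"
  shows "exp (\<alpha> * s) \<le> exp (\<bar>\<alpha>\<bar> * T)"
  using exp_neg_mult_bounds[OF assms, of "- \<alpha>"] by simp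

context brownian
begin

lemma exp_increment_sq_mean:
  assumes "0 \<le> s" "s \<le> t"
  shows "has_bochner_integral M (\<lambda>w. (exp (\<theta> * (W t w - W s w) - \<theta>\<^sup>2 * (t - s) / 2))\<^sup>2) (exp (\<theta>\<^sup>2 * (t - s)))"
proof -
  have eq: "(exp (\<theta> * d - \<theta>\<^sup>2 * (t - s) / 2))\<^sup>2
    = exp (2 * \<theta> * d - (2 * \<theta>)\<^sup>2 * (t - s) / 2) * exp (\<theta>\<^sup>2 * (t - s))" for d
  proof -
    have "2 * (\<theta> * d - \<theta>\<^sup>2 * (t - s) / 2) = 2 * \<theta> * d - (2 * \<theta>)\<^sup>2 * (t - s) / 2 + \<theta>\<^sup>2 * (t - s)"
      by (simp add: power2_eq_square field_simps)
    then show ?thesis by (simp only: exp_double[symmetric] exp_add[symmetric])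
  qed
  show ?thesis
    unfolding eq using has_bochner_integral_mult_left[OF exp_increment(1)[OF assms, of "2 * \<theta>"]] by simp
qed

text \<open>The solution of dX = \<delta> X dt + \<theta> X dW with X 0 = x. Multiples stay in the
  family, so candidate wealth, consumption and portfolio are all of this form.\<close>

definition gbm :: "real \<Rightarrow> real \<Rightarrow> real \<Rightarrow> real \<Rightarrow> 'a \<Rightarrow> real" where
  "gbm x \<theta> \<delta> t w = x * exp (\<delta> * t) * G \<theta> t w"

lemma gbm_measurable_F: "0 \<le> s \<Longrightarrow> s \<le> t \<Longrightarrow> gbm x \<theta> \<delta> s \<in> borel_measurable (F t)"
  unfolding gbm_def using G_measurable_F[of s t] by measurable

lemma gbm_measurable_M: "0 \<le> s \<Longrightarrow> gbm x \<theta> \<delta> s \<in> borel_measurable M"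
  using gbm_measurable_F[of s s] measurable_F_M by blast

lemma gbm_continuous: "w \<in> space M \<Longrightarrow> continuous_on {0..} (\<lambda>t. gbm x \<theta> \<delta> t w)"
  unfolding gbm_def G_def by (intro continuous_intros W_continuous) auto

lemma gbm_0: "w \<in> space M \<Longrightarrow> gbm x \<theta> \<delta> 0 w = x"
  by (simp add: gbm_def G_def W_0)

lemma gbm_sq_mean:
  assumes "0 \<le> t"
  shows "has_bochner_integral M (\<lambda>w. (gbm x \<theta> \<delta> t w)\<^sup>2) (x\<^sup>2 * exp ((2 * \<delta> + \<theta>\<^sup>2) * t))"
proof -
  have "has_bochner_integral M (\<lambda>w. (x * exp (\<delta> * t))\<^sup>2 * (G \<theta> t w)\<^sup>2) ((x * exp (\<delta> * t))\<^sup>2 * exp (\<theta>\<^sup>2 * t))"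
    by (intro has_bochner_integral_mult_right G_sq_mean assms)
  moreover have "(x * exp (\<delta> * t))\<^sup>2 * exp (\<theta>\<^sup>2 * t) = x\<^sup>2 * exp ((2 * \<delta> + \<theta>\<^sup>2) * t)"
    by (simp add: power_mult_distrib algebra_simps flip: exp_add exp_double)
  ultimately have "has_bochner_integral M (\<lambda>w. (x * exp (\<delta> * t))\<^sup>2 * (G \<theta> t w)\<^sup>2) (x\<^sup>2 * exp ((2 * \<delta> + \<theta>\<^sup>2) * t))"
    by (simp only:)
  then show ?thesis by (simp add: gbm_def power_mult_distrib)
qed

lemma gbm_split:
  "gbm x \<theta> \<delta> t w = gbm x \<theta> \<delta> s w * (exp (\<delta> * (t - s)) * exp (\<theta> * (W t w - W s w) - \<theta>\<^sup>2 * (t - s) / 2))"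
proof -
  have "exp (\<delta> * t) = exp (\<delta> * s) * exp (\<delta> * (t - s))"
    by (simp add: algebra_simps flip: exp_add)
  then show ?thesis
    unfolding gbm_def by (subst G_split[of \<theta> t w s]) simp
qed

text \<open>The factor \<open>b\<close> serves two comparisons: b = 1 for replacing the process by
  its value at a grid point, and a discount factor for comparing with the discounted right
  endpoint.\<close>

lemma gbm_difference_sq_mean:
  assumes st: "0 \<le> s" "s \<le> t"
  shows "has_bochner_integral M (\<lambda>w. (b * gbm x \<theta> \<delta> t w - gbm x \<theta> \<delta> s w)\<^sup>2)
    (x\<^sup>2 * exp ((2 * \<delta> + \<theta>\<^sup>2) * s) * (b\<^sup>2 * exp ((2 * \<delta> + \<theta>\<^sup>2) * (t - s)) - 2 * b * exp (\<delta> * (t - s)) + 1))"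
proof -
  let ?e = "\<lambda>y. exp (\<theta> * y - \<theta>\<^sup>2 * (t - s) / 2)" and ?D = "\<lambda>w. W t w - W s w"
  let ?d = "b * exp (\<delta> * (t - s))"
  let ?g = "\<lambda>y. ?d\<^sup>2 * (?e y)\<^sup>2 - 2 * ?d * ?e y + 1"
  have "has_bochner_integral M (\<lambda>w. ?g (?D w)) (?d\<^sup>2 * exp (\<theta>\<^sup>2 * (t - s)) - 2 * ?d * 1 + 1)"
    using exp_increment(1)[OF st, of \<theta>] exp_increment_sq_mean[OF st, of \<theta>]
    by (intro has_bochner_integral_add has_bochner_integral_diff has_bochner_integral_mult_right)
      (auto simp: has_bochner_integral_iff prob_space)
  moreover have "?d\<^sup>2 * exp (\<theta>\<^sup>2 * (t - s)) - 2 * ?d * 1 + 1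
      = b\<^sup>2 * exp ((2 * \<delta> + \<theta>\<^sup>2) * (t - s)) - 2 * b * exp (\<delta> * (t - s)) + 1"
    by (simp add: power_mult_distrib algebra_simps flip: exp_add exp_double)
  ultimately have g: "has_bochner_integral M (\<lambda>w. ?g (?D w))
      (b\<^sup>2 * exp ((2 * \<delta> + \<theta>\<^sup>2) * (t - s)) - 2 * b * exp (\<delta> * (t - s)) + 1)" by (simp only:)
  have m: "(\<lambda>w. (gbm x \<theta> \<delta> s w)\<^sup>2) \<in> borel_measurable (F s)"
    using gbm_measurable_F[OF st(1) order.refl] by measurable
  have "has_bochner_integral M (\<lambda>w. (gbm x \<theta> \<delta> s w)\<^sup>2 * ?g (?D w))
    (x\<^sup>2 * exp ((2 * \<delta> + \<theta>\<^sup>2) * s) * (b\<^sup>2 * exp ((2 * \<delta> + \<theta>\<^sup>2) * (t - s)) - 2 * b * exp (\<delta> * (t - s)) + 1))"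
    using integral_mult_increment[OF st m, of ?g] g gbm_sq_mean[OF st(1), of x \<theta> \<delta>]
    unfolding has_bochner_integral_iff by simp
  moreover have "(gbm x \<theta> \<delta> s w)\<^sup>2 * ?g (?D w) = (b * gbm x \<theta> \<delta> t w - gbm x \<theta> \<delta> s w)\<^sup>2" for w
    unfolding gbm_split[of x \<theta> \<delta> t w s] by (simp add: power2_eq_square algebra_simps)
  ultimately show ?thesis by simp
qed

lemma gbm_pair_measurable:
  "(\<lambda>(w, t). gbm x \<theta> \<delta> t w) \<in> borel_measurable (M \<Otimes>\<^sub>M restrict_space borel {0..})"
  by (intro continuous_imp_pair_measurable gbm_measurable_M gbm_continuous)

lemma gbm_sq_bound:
  assumes "0 \<le> s" "s \<le> T"
  shows "expectation (\<lambda>w. (gbm x \<theta> \<delta> s w)\<^sup>2) \<le> x\<^sup>2 * exp (\<bar>2 * \<delta> + \<theta>\<^sup>2\<bar> * T)"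
  using gbm_sq_mean[OF assms(1), of x \<theta> \<delta>] exp_mult_le_abs[OF assms]
  by (auto simp: has_bochner_integral_iff intro!: mult_left_mono)

lemma gbm_scale: "(\<lambda>t w. b * gbm x \<theta> \<delta> t w) = gbm (b * x) \<theta> \<delta>"
  by (simp add: fun_eq_iff gbm_def)

lemma gbm_adapted: "adapted F (gbm x \<theta> \<delta>)"
  unfolding adapted_def using gbm_measurable_F by blast

lemma gbm_jointly_measurable: "jointly_measurable M (gbm x \<theta> \<delta>)"
  unfolding jointly_measurable_def by (rule gbm_pair_measurable)

lemma gbm_L2_loc: "gbm x \<theta> \<delta> \<in> L2_loc M F"
proof -
  let ?S = "gbm x \<theta> \<delta>"
  have "(\<integral>\<^sup>+w. (\<integral>\<^sup>+t\<in>{0..R}. ennreal (\<bar>?S t w\<bar>\<^sup>2) \<partial>lborel) \<partial>M) < \<infinity>" for R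
  proof -
    have m: "(\<lambda>(w, u). indicator {0..R} u * ?S u w) \<in> borel_measurable (M \<Otimes>\<^sub>M lborel)"
      by (rule jointly_measurable_slab[OF gbm_jointly_measurable]) auto
    have "integrable (M \<Otimes>\<^sub>M lborel) (\<lambda>(w, u). (indicator {0..R} u * ?S u w)\<^sup>2)"
      by (rule slab_sq_integrable[OF m _ gbm_sq_bound])
        (use gbm_sq_mean[of _ x \<theta> \<delta>] in \<open>auto simp: has_bochner_integral_iff\<close>)
    then have "(\<integral>\<^sup>+x. ennreal ((case x of (w, u) \<Rightarrow> indicator {0..R} u * ?S u w)\<^sup>2) \<partial>(M \<Otimes>\<^sub>M lborel)) < \<infinity>"
      by (auto simp: integrable_iff_bounded split_beta')
    then show ?thesis
      unfolding nn_integral_slab_sq[OF m, symmetric] by simp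
  qed
  then show ?thesis using gbm_adapted gbm_jointly_measurable by (simp add: L2_loc_def)
qed

text \<open>What the equation dX = \<delta> X dt + \<theta> X dW forces the integral of \<theta> X
  against W to be. Continuity and adaptedness are then immediate, and only the mean-square
  approximation by step integrals remains to be proved.\<close>

definition gbm_ito :: "real \<Rightarrow> real \<Rightarrow> real \<Rightarrow> real \<Rightarrow> 'a \<Rightarrow> real" where
  "gbm_ito x \<theta> \<delta> t w = gbm x \<theta> \<delta> t w - x - \<delta> * (LINT s:{0..t}|lborel. gbm x \<theta> \<delta> s w)"

lemma gbm_set_integrable:
  assumes "w \<in> space M" "0 \<le> a"
  shows "set_integrable lborel {a..b} (\<lambda>s. gbm x \<theta> \<delta> s w)"
  by (rule borel_integrable_atLeastAtMost')
    (rule continuous_on_subset[OF gbm_continuous[OF assms(1)]], use assms in auto)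

lemma gbm_LINT_eq:
  assumes "w \<in> space M" "0 \<le> a"
  shows "(LINT s:{a..b}|lborel. gbm x \<theta> \<delta> s w) = integral {a..b} (\<lambda>s. gbm x \<theta> \<delta> s w)"
  by (rule set_borel_integral_eq_integral(2)[OF gbm_set_integrable[OF assms]])

lemma gbm_integral_continuous:
  assumes w: "w \<in> space M"
  shows "continuous_on {0..} (\<lambda>t. LINT s:{0..t}|lborel. gbm x \<theta> \<delta> s w)"
proof -
  have "continuous (at t within {0..}) (\<lambda>t. integral {0..t} (\<lambda>s. gbm x \<theta> \<delta> s w))" if "0 \<le> t" for t
  proof -
    have "continuous_on {0..t + 1} (\<lambda>t. integral {0..t} (\<lambda>s. gbm x \<theta> \<delta> s w))"
      by (intro indefinite_integral_continuous_1 integrable_continuous_interval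
          continuous_on_subset[OF gbm_continuous[OF w]]) auto
    then have "continuous (at t within {0..t + 1}) (\<lambda>t. integral {0..t} (\<lambda>s. gbm x \<theta> \<delta> s w))"
      using that by (simp add: continuous_on_eq_continuous_within)
    moreover have "at t within {0..t + 1} = at t within {0..}"
      by (rule at_within_nhd[of t "{..<t + 1}"]) (use that in auto)
    ultimately show ?thesis by simp
  qed
  then show ?thesis
    unfolding gbm_LINT_eq[OF w order.refl] by (simp add: continuous_on_eq_continuous_within)
qed

text \<open>Stopping time at t by \<open>min s t\<close> makes every value measurable at t without
  changing the process on {0..t}; joint measurability over \<open>F t\<close> then makes the time
  integral measurable there.\<close>

lemma gbm_integral_adapted:
  assumes t: "0 \<le> t"
  shows "(\<lambda>w. LINT s:{0..t}|lborel. gbm x \<theta> \<delta> s w) \<in> borel_measurable (F t)"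
proof -
  have sp: "space (F t) = space M" using subalgebra_F[OF t] by (simp add: subalgebra_def)
  have "(\<lambda>(w, s). indicator {0..t} s * gbm x \<theta> \<delta> (min s t) w) \<in> borel_measurable (F t \<Otimes>\<^sub>M lborel)"
  proof (rule pair_measurable_slab[OF continuous_imp_pair_measurable])
    show "gbm x \<theta> \<delta> (min s t) \<in> borel_measurable (F t)" if "0 \<le> s" for s
      using that t by (intro gbm_measurable_F) auto
    show "continuous_on {0..} (\<lambda>s. gbm x \<theta> \<delta> (min s t) w)" if "w \<in> space (F t)" for w
      using that t unfolding sp
      by (intro continuous_on_compose2[OF gbm_continuous]) (auto intro!: continuous_intros)
  qed auto
  also have "(\<lambda>(w, s). indicator {0..t} s * gbm x \<theta> \<delta> (min s t) w) = (\<lambda>(w, s). indicator {0..t} s * gbm x \<theta> \<delta> s w)"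
    by (auto simp: fun_eq_iff indicator_def min_def)
  finally show ?thesis
    unfolding set_lebesgue_integral_def real_scaleR_def by (rule lborel.borel_measurable_lebesgue_integral)
qed

lemma gbm_ito_adapted: "0 \<le> t \<Longrightarrow> gbm_ito x \<theta> \<delta> t \<in> borel_measurable (F t)"
  unfolding gbm_ito_def
  by (intro borel_measurable_diff borel_measurable_times gbm_integral_adapted gbm_measurable_F) auto

lemma gbm_ito_continuous:
  "w \<in> space M \<Longrightarrow> continuous_on {0..} (\<lambda>t. gbm_ito x \<theta> \<delta> t w)"
  unfolding gbm_ito_def by (intro continuous_intros gbm_continuous gbm_integral_continuous)

text \<open>The variance is \<open>O((t - s)\<^sup>2)\<close>, so summed over a grid of mesh \<open>h\<close> it is \<open>O(h)\<close>.\<close>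

lemma exp_increment_linearisation:
  fixes \<theta> :: real
  assumes st: "0 \<le> s" "s \<le> t"
  defines "f \<equiv> \<lambda>y. \<theta> * y + 1 - exp (\<theta> * y - \<theta>\<^sup>2 * (t - s) / 2)"
  shows "has_bochner_integral M (\<lambda>w. f (W t w - W s w)) 0"
    and "has_bochner_integral M (\<lambda>w. (f (W t w - W s w))\<^sup>2) (exp (\<theta>\<^sup>2 * (t - s)) - 1 - \<theta>\<^sup>2 * (t - s))"
proof -
  let ?D = "\<lambda>w. W t w - W s w"
  let ?e = "\<lambda>w. exp (\<theta> * ?D w - \<theta>\<^sup>2 * (t - s) / 2)"
  have one: "has_bochner_integral M (\<lambda>w. 1::real) 1"
    by (simp add: has_bochner_integral_iff prob_space)
  note D = increment_mean[OF st] increment_second_moment[OF st] exp_increment[OF st, of \<theta>]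
    exp_increment_sq_mean[OF st, of \<theta>]
  have "has_bochner_integral M (\<lambda>w. \<theta> * ?D w + 1 - ?e w) (\<theta> * 0 + 1 - 1)"
    by (intro has_bochner_integral_add has_bochner_integral_diff has_bochner_integral_mult_right D one)
  then show "has_bochner_integral M (\<lambda>w. f (?D w)) 0" by (simp add: f_def)
  have "has_bochner_integral M
      (\<lambda>w. \<theta>\<^sup>2 * (?D w)\<^sup>2 + 1 + (?e w)\<^sup>2 + 2 * \<theta> * ?D w - 2 * \<theta> * (?e w * ?D w) - 2 * ?e w)
      (\<theta>\<^sup>2 * (t - s) + 1 + exp (\<theta>\<^sup>2 * (t - s)) + 2 * \<theta> * 0 - 2 * \<theta> * (\<theta> * (t - s)) - 2 * 1)"
    by (intro has_bochner_integral_add has_bochner_integral_diff has_bochner_integral_mult_right D one)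
  moreover have "(\<lambda>w. \<theta>\<^sup>2 * (?D w)\<^sup>2 + 1 + (?e w)\<^sup>2 + 2 * \<theta> * ?D w - 2 * \<theta> * (?e w * ?D w) - 2 * ?e w)
     = (\<lambda>w. (f (?D w))\<^sup>2)"
  proof (rule ext)
    fix w
    have "\<theta>\<^sup>2 * d\<^sup>2 + 1 + e\<^sup>2 + 2 * \<theta> * d - 2 * \<theta> * (e * d) - 2 * e = (\<theta> * d + 1 - e)\<^sup>2" for d e :: real
      by algebra
    then show "\<theta>\<^sup>2 * (?D w)\<^sup>2 + 1 + (?e w)\<^sup>2 + 2 * \<theta> * ?D w - 2 * \<theta> * (?e w * ?D w) - 2 * ?e w = (f (?D w))\<^sup>2"
      by (simp only: f_def)
  qed
  moreover have "\<theta>\<^sup>2 * (t - s) + 1 + exp (\<theta>\<^sup>2 * (t - s)) + 2 * \<theta> * 0 - 2 * \<theta> * (\<theta> * (t - s)) - 2 * 1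
     = exp (\<theta>\<^sup>2 * (t - s)) - 1 - \<theta>\<^sup>2 * (t - s)"
    by (simp add: power2_eq_square algebra_simps)
  ultimately show "has_bochner_integral M (\<lambda>w. (f (?D w))\<^sup>2) (exp (\<theta>\<^sup>2 * (t - s)) - 1 - \<theta>\<^sup>2 * (t - s))"
    by (simp only:)
qed

text \<open>Bounds the error of replacing the path on a cell by its right-end value discounted
  backwards. Cauchy-Schwarz in time gives one factor b - a, integrating the variance over the cell
  gives the second, and the variance itself is O(b - a).\<close>

lemma gbm_interval_error:
  assumes ab: "0 \<le> a" "a \<le> b" "b \<le> T"
  shows "(\<integral>\<^sup>+w. ennreal ((LINT s:{a..b}|lborel. gbm x \<theta> \<delta> s w - exp (- \<delta> * (b - s)) * gbm x \<theta> \<delta> b w)\<^sup>2) \<partial>M)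
    \<le> ennreal ((b - a)\<^sup>2 * (x\<^sup>2 * exp (\<bar>2 * \<delta> + \<theta>\<^sup>2\<bar> * T) * (exp (\<theta>\<^sup>2 * (b - a)) - 1)))"
    (is "_ \<le> ennreal ((b - a)\<^sup>2 * ?B)")
proof -
  interpret P: pair_sigma_finite M lborel ..
  let ?k = "\<lambda>s w. gbm x \<theta> \<delta> s w - exp (- \<delta> * (b - s)) * gbm x \<theta> \<delta> b w"
  have b: "0 \<le> b" using ab by simp
  have kc: "continuous_on {0..} (\<lambda>s. ?k s w)" if "w \<in> space M" for w
    by (intro continuous_intros gbm_continuous that)
  have km: "(\<lambda>(w, s). indicator {a..b} s * ?k s w) \<in> borel_measurable (M \<Otimes>\<^sub>M lborel)"
    using ab b kc
    by (intro pair_measurable_slab[OF continuous_imp_pair_measurable] borel_measurable_diff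
        borel_measurable_times gbm_measurable_M) auto
  have km2: "(\<lambda>(w, s). ennreal ((indicator {a..b} s * ?k s w)\<^sup>2)) \<in> borel_measurable (M \<Otimes>\<^sub>M lborel)"
    using measurable_compose[OF borel_measurable_power[OF km, of 2] measurable_ennreal] by (simp add: split_beta')
  have CS: "(LINT s:{a..b}|lborel. ?k s w)\<^sup>2 \<le> (b - a) * (\<integral>s. (indicator {a..b} s * ?k s w)\<^sup>2 \<partial>lborel)"
    and ki: "integrable lborel (\<lambda>s. (indicator {a..b} s * ?k s w)\<^sup>2)"
    if w: "w \<in> space M" for w
  proof -
    have sq: "(\<lambda>s. (indicator {a..b} s * ?k s w)\<^sup>2) = (\<lambda>s. indicator {a..b} s * (?k s w)\<^sup>2)"
      by (auto simp: fun_eq_iff indicator_def)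
    have c: "continuous_on {a..b} (\<lambda>s. ?k s w)" using kc[OF w] ab by (auto intro: continuous_on_subset)
    have "set_integrable lborel {a..b} (\<lambda>s. (?k s w)\<^sup>2)"
      by (intro borel_integrable_atLeastAtMost' continuous_on_power c)
    then show ki: "integrable lborel (\<lambda>s. (indicator {a..b} s * ?k s w)\<^sup>2)"
      unfolding sq by (simp add: set_integrable_def)
    have "set_integrable lborel {a..b} (\<lambda>s. ?k s w)"
      by (intro borel_integrable_atLeastAtMost' c)
    then have m: "(\<lambda>s. indicator {a..b} s * ?k s w) \<in> borel_measurable lborel"
      unfolding set_integrable_def by auto
    have ind: "(\<lambda>s. (indicator {a..b} s)\<^sup>2) = (indicator {a..b} :: real \<Rightarrow> real)"
      by (auto simp: fun_eq_iff indicator_def)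
    have "(\<integral>s. indicator {a..b} s * (indicator {a..b} s * ?k s w) \<partial>lborel)\<^sup>2
       \<le> (\<integral>s. (indicator {a..b} s)\<^sup>2 \<partial>lborel) * (\<integral>s. (indicator {a..b} s * ?k s w)\<^sup>2 \<partial>lborel)"
      using m ki by (intro Cauchy_Schwarz_integral) (auto simp: ind emeasure_lborel_Icc_eq)
    moreover have "(\<integral>s. indicator {a..b} s * (indicator {a..b} s * ?k s w) \<partial>lborel) = (LINT s:{a..b}|lborel. ?k s w)"
      unfolding set_lebesgue_integral_def by (intro Bochner_Integration.integral_cong) (auto simp: indicator_def)
    ultimately show "(LINT s:{a..b}|lborel. ?k s w)\<^sup>2 \<le> (b - a) * (\<integral>s. (indicator {a..b} s * ?k s w)\<^sup>2 \<partial>lborel)"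
      using ab by (simp only: ind) simp
  qed
  have E: "(\<integral>\<^sup>+w. ennreal ((indicator {a..b} s * ?k s w)\<^sup>2) \<partial>M) \<le> ennreal ?B * indicator {a..b} s" for s
  proof (cases "a \<le> s \<and> s \<le> b")
    case True
    then have s: "0 \<le> s" "s \<le> b" "s \<le> T" using ab by auto
    have *: "has_bochner_integral M (\<lambda>w. (?k s w)\<^sup>2) (x\<^sup>2 * exp ((2 * \<delta> + \<theta>\<^sup>2) * s) * (exp (\<theta>\<^sup>2 * (b - s)) - 1))"
    proof -
      \<comment> \<open>Discounting removes \<delta> from the bracket in
        \<open>gbm_difference_sq_mean\<close>, which collapses to exp(\<theta>^2 * (b - s)) -
        1.\<close>
      have "(exp (- \<delta> * (b - s)))\<^sup>2 * exp ((2 * \<delta> + \<theta>\<^sup>2) * (b - s)) = exp (\<theta>\<^sup>2 * (b - s))"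
        "exp (- \<delta> * (b - s)) * exp (\<delta> * (b - s)) = 1"
        by (simp_all add: algebra_simps flip: exp_add exp_double)
      then show ?thesis
        using gbm_difference_sq_mean[OF s(1,2), of "exp (- \<delta> * (b - s))" x \<theta> \<delta>]
        by (simp add: power2_commute mult.assoc)
    qed
    have "x\<^sup>2 * exp ((2 * \<delta> + \<theta>\<^sup>2) * s) * (exp (\<theta>\<^sup>2 * (b - s)) - 1) \<le> ?B"
    proof (intro mult_mono mult_left_mono)
      show "exp ((2 * \<delta> + \<theta>\<^sup>2) * s) \<le> exp (\<bar>2 * \<delta> + \<theta>\<^sup>2\<bar> * T)" by (rule exp_mult_le_abs[OF s(1,3)])
      have "\<theta>\<^sup>2 * (b - s) \<le> \<theta>\<^sup>2 * (b - a)" using True by (intro mult_left_mono) auto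
      then show "exp (\<theta>\<^sup>2 * (b - s)) - 1 \<le> exp (\<theta>\<^sup>2 * (b - a)) - 1" by simp
      show "0 \<le> exp (\<theta>\<^sup>2 * (b - s)) - 1" using s by simp
    qed auto
    then show ?thesis
      using True * nn_integral_eq_integral[of M "\<lambda>w. (?k s w)\<^sup>2"]
      by (simp add: has_bochner_integral_iff ennreal_leI)
  qed auto
  have "(\<integral>\<^sup>+w. ennreal ((LINT s:{a..b}|lborel. ?k s w)\<^sup>2) \<partial>M)
    \<le> (\<integral>\<^sup>+w. ennreal (b - a) * (\<integral>\<^sup>+s. ennreal ((indicator {a..b} s * ?k s w)\<^sup>2) \<partial>lborel) \<partial>M)"
  proof (rule nn_integral_mono)
    fix w assume w: "w \<in> space M"
    have "ennreal ((LINT s:{a..b}|lborel. ?k s w)\<^sup>2) \<le> ennreal ((b - a) * (\<integral>s. (indicator {a..b} s * ?k s w)\<^sup>2 \<partial>lborel))"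
      by (rule ennreal_leI[OF CS[OF w]])
    also have "\<dots> = ennreal (b - a) * (\<integral>\<^sup>+s. ennreal ((indicator {a..b} s * ?k s w)\<^sup>2) \<partial>lborel)"
      using ab nn_integral_eq_integral[OF ki[OF w]] by (simp add: ennreal_mult)
    finally show "ennreal ((LINT s:{a..b}|lborel. ?k s w)\<^sup>2) \<le> ennreal (b - a) * (\<integral>\<^sup>+s. ennreal ((indicator {a..b} s * ?k s w)\<^sup>2) \<partial>lborel)" .
  qed
  also have "\<dots> = ennreal (b - a) * (\<integral>\<^sup>+w. (\<integral>\<^sup>+s. ennreal ((indicator {a..b} s * ?k s w)\<^sup>2) \<partial>lborel) \<partial>M)"
    using lborel.borel_measurable_nn_integral_fst[OF km2] by (intro nn_integral_cmult) simp
  also have "(\<integral>\<^sup>+w. (\<integral>\<^sup>+s. ennreal ((indicator {a..b} s * ?k s w)\<^sup>2) \<partial>lborel) \<partial>M)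
     = (\<integral>\<^sup>+s. (\<integral>\<^sup>+w. ennreal ((indicator {a..b} s * ?k s w)\<^sup>2) \<partial>M) \<partial>lborel)"
    using P.Fubini[OF km2] by simp
  also have "\<dots> \<le> (\<integral>\<^sup>+s. ennreal ?B * indicator {a..b} s \<partial>lborel)"
    by (intro nn_integral_mono E)
  also have "\<dots> = ennreal (?B * (b - a))"
    using ab by (simp add: nn_integral_cmult ennreal_mult'')
  finally have "(\<integral>\<^sup>+w. ennreal ((LINT s:{a..b}|lborel. ?k s w)\<^sup>2) \<partial>M) \<le> ennreal (b - a) * ennreal (?B * (b - a))"
    by (simp add: mult_left_mono)
  also have "\<dots> = ennreal ((b - a)\<^sup>2 * ?B)"
    using ab by (simp add: ennreal_mult'[symmetric] power2_eq_square mult_ac)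
  finally show ?thesis .
qed

end

section \<open>The Ito integral of geometric Brownian motion\<close>

lemma sum_sq_le_card_mult_sum_sq:
  fixes f :: "nat \<Rightarrow> real"
  shows "(\<Sum>i<n. f i)\<^sup>2 \<le> real n * (\<Sum>i<n. (f i)\<^sup>2)"
  using sum_squared_le_sum_of_squares[of f "{..<n}"] by (simp add: mult.commute)

context brownian
begin

lemma gbm_ito_telescope:
  assumes w: "w \<in> space M" and \<tau>: "\<tau> 0 = 0" "\<And>i. i < m \<Longrightarrow> \<tau> i \<le> \<tau> (Suc i)"
  shows "0 \<le> \<tau> m \<and> (\<Sum>i<m. gbm x \<theta> \<delta> (\<tau> (Suc i)) w - gbm x \<theta> \<delta> (\<tau> i) w
      - \<delta> * (LINT s:{\<tau> i..\<tau> (Suc i)}|lborel. gbm x \<theta> \<delta> s w)) = gbm_ito x \<theta> \<delta> (\<tau> m) w"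
  using \<tau>(2)
proof (induction m)
  case 0
  have "set_lebesgue_integral lborel {0..0::real} (\<lambda>s. gbm x \<theta> \<delta> s w) = 0"
    using gbm_LINT_eq[OF w, of 0 0 x \<theta> \<delta>] by simp
  then show ?case using \<tau>(1) by (simp add: gbm_ito_def gbm_0[OF w] del: atLeastAtMost_singleton)
next
  case (Suc m)
  let ?S = "\<lambda>s. gbm x \<theta> \<delta> s w"
  have IH: "0 \<le> \<tau> m" "(\<Sum>i<m. ?S (\<tau> (Suc i)) - ?S (\<tau> i)
      - \<delta> * (LINT s:{\<tau> i..\<tau> (Suc i)}|lborel. ?S s)) = gbm_ito x \<theta> \<delta> (\<tau> m) w"
    using Suc by auto
  have le: "\<tau> m \<le> \<tau> (Suc m)" using Suc.prems by simp
  have "integral {0..\<tau> m} ?S + integral {\<tau> m..\<tau> (Suc m)} ?S = integral {0..\<tau> (Suc m)} ?S"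
    using IH(1) le
    by (intro Henstock_Kurzweil_Integration.integral_combine integrable_continuous_interval
        continuous_on_subset[OF gbm_continuous[OF w]]) auto
  then have "(LINT s:{0..\<tau> (Suc m)}|lborel. ?S s) = (LINT s:{0..\<tau> m}|lborel. ?S s) + (LINT s:{\<tau> m..\<tau> (Suc m)}|lborel. ?S s)"
    using gbm_LINT_eq[OF w] IH(1) by simp
  then show ?case using IH le by (simp add: gbm_ito_def algebra_simps)
qed

text \<open>An exact splitting of a left-endpoint term into the increment of \<open>gbm_ito\<close>
  and two errors: a linearisation error, centred given the past, and a time-integration error. The
  exponential weight in the latter is chosen because its integral is explicit after multiplication
  by \<delta>, even when \<delta> = 0.\<close>

lemma gbm_increment_identity:
  assumes w: "w \<in> space M" and ab: "0 \<le> a" "a \<le> b"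
  shows "\<theta> * gbm x \<theta> \<delta> a w * (W b w - W a w)
    = gbm x \<theta> \<delta> b w - gbm x \<theta> \<delta> a w - \<delta> * (LINT s:{a..b}|lborel. gbm x \<theta> \<delta> s w)
      + gbm x \<theta> \<delta> a w * (\<theta> * (W b w - W a w) + 1 - exp (\<theta> * (W b w - W a w) - \<theta>\<^sup>2 * (b - a) / 2))
      + \<delta> * (LINT s:{a..b}|lborel. gbm x \<theta> \<delta> s w - exp (- \<delta> * (b - s)) * gbm x \<theta> \<delta> b w)"
proof -
  let ?S = "\<lambda>s. gbm x \<theta> \<delta> s w"
  let ?e = "exp (\<theta> * (W b w - W a w) - \<theta>\<^sup>2 * (b - a) / 2)"
  have ei: "set_integrable lborel {a..b} (\<lambda>s. exp (- \<delta> * (b - s)) * ?S b)"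
    by (intro borel_integrable_atLeastAtMost' continuous_intros)
  have "\<delta> * (LINT s:{a..b}|lborel. exp (- \<delta> * (b - s))) = 1 - exp (- \<delta> * (b - a))"
  proof -
    have e: "\<delta> * (LINT s:{a..b}|lborel. exp (\<delta> * s)) = exp (\<delta> * b) - exp (\<delta> * a)"
      using exp_discount_LINT[OF ab(2), of "- \<delta>"] unfolding set_integral_mult_right minus_minus by simp
    have "(LINT s:{a..b}|lborel. exp (- \<delta> * (b - s))) = (LINT s:{a..b}|lborel. exp (- \<delta> * b) * exp (\<delta> * s))"
      by (simp add: algebra_simps flip: exp_add)
    also have "\<dots> = exp (- \<delta> * b) * (LINT s:{a..b}|lborel. exp (\<delta> * s))" by simp
    finally have "\<delta> * (LINT s:{a..b}|lborel. exp (- \<delta> * (b - s))) = exp (- \<delta> * b) * (exp (\<delta> * b) - exp (\<delta> * a))"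
      using e by (simp add: mult.left_commute)
    also have "\<dots> = 1 - exp (- \<delta> * (b - a))"
      by (simp add: algebra_simps flip: exp_add)
    finally show ?thesis .
  qed
  note e = this
  have "(LINT s:{a..b}|lborel. ?S s - exp (- \<delta> * (b - s)) * ?S b)
      = (LINT s:{a..b}|lborel. ?S s) - (LINT s:{a..b}|lborel. exp (- \<delta> * (b - s))) * ?S b"
    using set_integral_diff(2)[OF gbm_set_integrable[OF w ab(1)] ei]
    by (simp only: set_integral_mult_left)
  then have "\<delta> * (LINT s:{a..b}|lborel. ?S s - exp (- \<delta> * (b - s)) * ?S b)
      = \<delta> * (LINT s:{a..b}|lborel. ?S s) - (\<delta> * (LINT s:{a..b}|lborel. exp (- \<delta> * (b - s)))) * ?S b"
    by (simp only: right_diff_distrib mult.assoc)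
  then have "\<delta> * (LINT s:{a..b}|lborel. ?S s - exp (- \<delta> * (b - s)) * ?S b)
      = \<delta> * (LINT s:{a..b}|lborel. ?S s) - (1 - exp (- \<delta> * (b - a))) * ?S b"
    by (simp only: e)
  \<comment> \<open>Here the two errors fit together: the discounted right-end value left over by
    the time integral is the exponential subtracted in the linearisation error.\<close>
  moreover have "exp (- \<delta> * (b - a)) * ?S b = ?S a * ?e"
  proof -
    have "exp (- \<delta> * (b - a)) * exp (\<delta> * (b - a)) = 1" by (simp flip: exp_add)
    moreover have "p * (A * (q * E)) = A * E" if "p * q = 1" for p q A E :: real
      using that by (metis mult.assoc mult.commute mult_1)
    ultimately show ?thesis unfolding gbm_split[of x \<theta> \<delta> b w a] by blast
  qed
  moreover have "\<theta> * A * D = B - A - L + A * (\<theta> * D + 1 - E) + (L - (1 - e) * B)"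
    if "e * B = A * E" for A B D E L e :: real
    using that by (simp add: algebra_simps)
  ultimately show ?thesis by (simp only:)
qed

lemma gbm_interval_error_measurable:
  assumes "0 \<le> a" "a \<le> b"
  shows "(\<lambda>w. LINT s:{a..b}|lborel. gbm x \<theta> \<delta> s w - exp (- \<delta> * (b - s)) * gbm x \<theta> \<delta> b w) \<in> borel_measurable M"
proof -
  have "(\<lambda>(w, s). indicator {a..b} s * (gbm x \<theta> \<delta> s w - exp (- \<delta> * (b - s)) * gbm x \<theta> \<delta> b w)) \<in> borel_measurable (M \<Otimes>\<^sub>M lborel)"
    using assms
    by (intro pair_measurable_slab[OF continuous_imp_pair_measurable] borel_measurable_diff
        borel_measurable_times gbm_measurable_M continuous_intros gbm_continuous) auto
  then show ?thesis
    unfolding set_lebesgue_integral_def real_scaleR_def by (rule lborel.borel_measurable_lebesgue_integral)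
qed

text \<open>With h = T / n, the linearisation errors are orthogonal, so their n variances of order
  h^2 add up to O(h). The cell errors are not; the crude bound of a squared sum by n times the sum
  of squares gives n * n * h^2 = T^2 times a quantity of order h.\<close>

lemma gbm_step_integral_error:
  fixes n :: nat and x \<theta> \<delta> :: real
  assumes T: "0 < T" and n: "0 < n"
  defines "\<tau> \<equiv> \<lambda>i. real i * (T / real n)" and "C \<equiv> x\<^sup>2 * exp (\<bar>2 * \<delta> + \<theta>\<^sup>2\<bar> * T)" and "y \<equiv> \<theta>\<^sup>2 * (T / real n)"
  shows "(\<integral>\<^sup>+w. ennreal ((step_integral W n \<tau> (\<lambda>i w. \<theta> * gbm x \<theta> \<delta> (\<tau> i) w) T w - gbm_ito x \<theta> \<delta> T w)\<^sup>2) \<partial>M)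
    \<le> ennreal (2 * (real n * (C * (exp y - 1 - y))) + 2 * \<delta>\<^sup>2 * (T\<^sup>2 * (C * (exp y - 1))))"
proof -
  let ?h = "T / real n"
  let ?S = "gbm x \<theta> \<delta>"
  have h: "0 \<le> ?h" using T by simp
  have \<tau>0: "0 \<le> \<tau> i" and \<tau>le: "\<tau> i \<le> \<tau> (Suc i)" and \<tau>d: "\<tau> (Suc i) - \<tau> i = ?h" for i
    using T n by (auto simp: \<tau>_def field_simps)
  have \<tau>T: "\<tau> i \<le> T" if "i \<le> n" for i
  proof -
    have "\<tau> i \<le> real n * ?h" unfolding \<tau>_def using that h by (intro mult_right_mono) auto
    then show ?thesis using n by simp
  qed
  have \<tau>n: "\<tau> n = T" using n by (simp add: \<tau>_def)
  let ?D = "\<lambda>i w. W (\<tau> (Suc i)) w - W (\<tau> i) w"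
  let ?f = "\<lambda>y. \<theta> * y + 1 - exp (\<theta> * y - \<theta>\<^sup>2 * ?h / 2)"
  let ?b = "\<lambda>i w. LINT s:{\<tau> i..\<tau> (Suc i)}|lborel. ?S s w - exp (- \<delta> * (\<tau> (Suc i) - s)) * ?S (\<tau> (Suc i)) w"
  define A where "A w = (\<Sum>i<n. ?S (\<tau> i) w * ?f (?D i w))" for w
  have C0: "0 \<le> C" by (simp add: C_def)
  have y0: "0 \<le> y" using T by (simp add: y_def)
  have ey: "0 \<le> exp y - 1 - y" using exp_ge_add_one_self[of y] by linarith
  have "has_bochner_integral M (\<lambda>w. (\<Sum>i<n. ?S (\<tau> i) w * (\<lambda>i. ?f) i (W (\<tau> (Suc i)) w - W (\<tau> i) w))\<^sup>2)
      (\<Sum>i<n. expectation (\<lambda>w. (?S (\<tau> i) w)\<^sup>2) * (exp y - 1 - y))"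
  proof (rule orthogonal_increments)
    show "?S (\<tau> i) \<in> borel_measurable (F (\<tau> i))" for i by (rule gbm_measurable_F[OF \<tau>0 order.refl])
    show "integrable M (\<lambda>w. (?S (\<tau> i) w)\<^sup>2)" for i
      using gbm_sq_mean[OF \<tau>0, of x \<theta> \<delta> i] by (simp add: has_bochner_integral_iff)
    show "has_bochner_integral M (\<lambda>w. ?f (W (\<tau> (Suc i)) w - W (\<tau> i) w)) 0" for i
      using exp_increment_linearisation(1)[OF \<tau>0 \<tau>le, of \<theta> i] by (simp only: \<tau>d)
    show "has_bochner_integral M (\<lambda>w. (?f (W (\<tau> (Suc i)) w - W (\<tau> i) w))\<^sup>2) (exp y - 1 - y)" for i
      using exp_increment_linearisation(2)[OF \<tau>0 \<tau>le, of \<theta> i] by (simp only: \<tau>d y_def)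
  qed (auto simp: \<tau>0 \<tau>le)
  then have A2: "has_bochner_integral M (\<lambda>w. (A w)\<^sup>2) (\<Sum>i<n. expectation (\<lambda>w. (?S (\<tau> i) w)\<^sup>2) * (exp y - 1 - y))"
    by (simp only: A_def)
  have "(\<Sum>i<n. expectation (\<lambda>w. (?S (\<tau> i) w)\<^sup>2) * (exp y - 1 - y)) \<le> (\<Sum>i<n. C * (exp y - 1 - y))"
    using \<tau>T gbm_sq_bound[OF \<tau>0, of _ T x \<theta> \<delta>] ey
    by (intro sum_mono mult_right_mono) (auto simp: C_def)
  then have A2b: "(\<integral>\<^sup>+w. ennreal ((A w)\<^sup>2) \<partial>M) \<le> ennreal (real n * (C * (exp y - 1 - y)))"
    using A2 by (subst nn_integral_eq_integral) (auto simp: has_bochner_integral_iff ennreal_leI)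
  have bm: "?b i \<in> borel_measurable M" for i by (rule gbm_interval_error_measurable[OF \<tau>0 \<tau>le])
  have Am: "A \<in> borel_measurable M"
    unfolding A_def using gbm_measurable_M[OF \<tau>0] W_measurable_M[OF \<tau>0] by measurable
  have be: "(\<integral>\<^sup>+w. ennreal ((?b i w)\<^sup>2) \<partial>M) \<le> ennreal (?h\<^sup>2 * (C * (exp y - 1)))" if "i < n" for i
    using gbm_interval_error[OF \<tau>0 \<tau>le \<tau>T, of i x \<theta> \<delta>] that by (simp add: \<tau>d C_def y_def)
  have decomp: "step_integral W n \<tau> (\<lambda>i w. \<theta> * ?S (\<tau> i) w) T w - gbm_ito x \<theta> \<delta> T w = A w + \<delta> * (\<Sum>i<n. ?b i w)"
    if w: "w \<in> space M" for w
  proof -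
    have "step_integral W n \<tau> (\<lambda>i w. \<theta> * ?S (\<tau> i) w) T w = (\<Sum>i<n. \<theta> * ?S (\<tau> i) w * ?D i w)"
      unfolding step_integral_def
    proof (rule sum.cong)
      fix i assume "i \<in> {..<n}"
      then have "min T (\<tau> i) = \<tau> i" "min T (\<tau> (Suc i)) = \<tau> (Suc i)" using \<tau>T by auto
      then show "\<theta> * ?S (\<tau> i) w * (W (min T (\<tau> (Suc i))) w - W (min T (\<tau> i)) w) = \<theta> * ?S (\<tau> i) w * ?D i w"
        by simp
    qed simp
    also have "\<dots> = (\<Sum>i<n. ?S (\<tau> (Suc i)) w - ?S (\<tau> i) w - \<delta> * (LINT s:{\<tau> i..\<tau> (Suc i)}|lborel. ?S s w)
       + ?S (\<tau> i) w * ?f (?D i w) + \<delta> * ?b i w)"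
      using gbm_increment_identity[OF w \<tau>0 \<tau>le, of \<theta> x \<delta>] by (intro sum.cong refl) (simp only: \<tau>d)
    also have "\<dots> = gbm_ito x \<theta> \<delta> T w + A w + \<delta> * (\<Sum>i<n. ?b i w)"
      using gbm_ito_telescope[of w \<tau> n x \<theta> \<delta>] w \<tau>le \<tau>n
      by (simp only: sum.distrib A_def sum_distrib_left) (simp add: \<tau>_def)
    finally show ?thesis by simp
  qed
  have pw: "(a + \<delta> * s)\<^sup>2 \<le> 2 * a\<^sup>2 + 2 * \<delta>\<^sup>2 * s\<^sup>2" for a s :: real
    using zero_le_power2[of "a - \<delta> * s"] by (simp add: power2_eq_square algebra_simps)
  have "(\<integral>\<^sup>+w. ennreal ((step_integral W n \<tau> (\<lambda>i w. \<theta> * ?S (\<tau> i) w) T w - gbm_ito x \<theta> \<delta> T w)\<^sup>2) \<partial>M)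
     \<le> (\<integral>\<^sup>+w. ennreal 2 * ennreal ((A w)\<^sup>2) + ennreal (2 * \<delta>\<^sup>2 * real n) * (\<Sum>i<n. ennreal ((?b i w)\<^sup>2)) \<partial>M)"
  proof (rule nn_integral_mono)
    fix w assume w: "w \<in> space M"
    have "(A w + \<delta> * (\<Sum>i<n. ?b i w))\<^sup>2 \<le> 2 * (A w)\<^sup>2 + 2 * \<delta>\<^sup>2 * (\<Sum>i<n. ?b i w)\<^sup>2" by (rule pw)
    also have "\<dots> \<le> 2 * (A w)\<^sup>2 + 2 * \<delta>\<^sup>2 * (real n * (\<Sum>i<n. (?b i w)\<^sup>2))"
      by (intro add_left_mono mult_left_mono sum_sq_le_card_mult_sum_sq) auto
    finally have "ennreal ((A w + \<delta> * (\<Sum>i<n. ?b i w))\<^sup>2)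
      \<le> ennreal (2 * (A w)\<^sup>2 + 2 * \<delta>\<^sup>2 * real n * (\<Sum>i<n. (?b i w)\<^sup>2))"
      by (intro ennreal_leI) (simp only: mult.assoc)
    also have "\<dots> = ennreal 2 * ennreal ((A w)\<^sup>2) + ennreal (2 * \<delta>\<^sup>2 * real n) * (\<Sum>i<n. ennreal ((?b i w)\<^sup>2))"
      by (subst ennreal_plus) (auto simp: ennreal_mult' sum_nonneg simp del: ennreal_numeral intro!: mult_nonneg_nonneg)
    finally show "ennreal ((step_integral W n \<tau> (\<lambda>i w. \<theta> * ?S (\<tau> i) w) T w - gbm_ito x \<theta> \<delta> T w)\<^sup>2)
      \<le> ennreal 2 * ennreal ((A w)\<^sup>2) + ennreal (2 * \<delta>\<^sup>2 * real n) * (\<Sum>i<n. ennreal ((?b i w)\<^sup>2))"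
      unfolding decomp[OF w] .
  qed
  also have "\<dots> = ennreal 2 * (\<integral>\<^sup>+w. ennreal ((A w)\<^sup>2) \<partial>M)
      + ennreal (2 * \<delta>\<^sup>2 * real n) * (\<Sum>i<n. \<integral>\<^sup>+w. ennreal ((?b i w)\<^sup>2) \<partial>M)"
  proof -
    have m: "(\<lambda>w. ennreal ((A w)\<^sup>2)) \<in> borel_measurable M" using Am by measurable
    have mb: "(\<lambda>w. ennreal ((?b i w)\<^sup>2)) \<in> borel_measurable M" for i
      by (intro measurable_compose[OF _ measurable_ennreal] borel_measurable_power bm)
    show ?thesis
      using m mb by (simp add: nn_integral_add nn_integral_cmult nn_integral_sum del: ennreal_numeral sum_ennreal)
  qed
  also have "\<dots> \<le> ennreal 2 * ennreal (real n * (C * (exp y - 1 - y)))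
      + ennreal (2 * \<delta>\<^sup>2 * real n) * (\<Sum>i<n. ennreal (?h\<^sup>2 * (C * (exp y - 1))))"
    by (intro add_mono mult_left_mono A2b sum_mono be) auto
  also have "\<dots> = ennreal (2 * (real n * (C * (exp y - 1 - y))) + 2 * \<delta>\<^sup>2 * real n * (\<Sum>i<n. ?h\<^sup>2 * (C * (exp y - 1))))"
  proof -
    have 1: "0 \<le> ?h\<^sup>2 * (C * (exp y - 1))" using C0 y0 by simp
    have 2: "0 \<le> real n * (C * (exp y - 1 - y))" using C0 ey by simp
    have 3: "(\<Sum>i<n. ennreal (?h\<^sup>2 * (C * (exp y - 1)))) = ennreal (\<Sum>i<n. ?h\<^sup>2 * (C * (exp y - 1)))"
      using 1 by (intro sum_ennreal) auto
    have 4: "0 \<le> (\<Sum>i<n. ?h\<^sup>2 * (C * (exp y - 1)))" using 1 by (intro sum_nonneg) auto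
    show ?thesis unfolding 3 using 2 4
      by (subst ennreal_plus) (auto simp: ennreal_mult' simp del: ennreal_numeral sum_constant intro!: mult_nonneg_nonneg)
  qed
  also have "2 * (real n * (C * (exp y - 1 - y))) + 2 * \<delta>\<^sup>2 * real n * (\<Sum>i<n. ?h\<^sup>2 * (C * (exp y - 1)))
      = 2 * (real n * (C * (exp y - 1 - y))) + 2 * \<delta>\<^sup>2 * (T\<^sup>2 * (C * (exp y - 1)))"
    using n by (simp add: power2_eq_square)
  finally show ?thesis .
qed

lemma uniform_grid_cell:
  assumes "0 < (h::real)" "0 < u" "u \<le> real n * h"
  obtains i where "i < n" "real i * h < u" "u \<le> real (Suc i) * h"
proof -
  \<comment> \<open>The ceiling, not the floor, because the cells of a step process are open on the
    left and closed on the right.\<close>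
  define i where "i = nat (\<lceil>u / h\<rceil> - 1)"
  have pos: "1 \<le> \<lceil>u / h\<rceil>" using assms by (simp add: one_le_ceiling)
  have ri: "real i = of_int \<lceil>u / h\<rceil> - 1" using pos by (simp add: i_def)
  have "u / h \<le> real n" using assms by (simp add: field_simps)
  then have "\<lceil>u / h\<rceil> \<le> int n" by (simp add: ceiling_le_iff)
  then have "i < n" unfolding i_def using pos by linarith
  moreover have "real i < u / h" "u / h \<le> real (Suc i)" unfolding of_nat_Suc ri by linarith+
  ultimately show thesis using assms(1) by (intro that[of i]) (auto simp: field_simps)
qed

text \<open>On each cell the process is compared with its value at the left grid point; the second
  moment of the difference tends to 0 uniformly as the mesh shrinks.\<close>

lemma gbm_step_process_error:
  fixes n :: nat and x \<theta> \<delta> :: real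
  assumes T: "0 < T" and n: "0 < n"
  defines "\<tau> \<equiv> \<lambda>i. real i * (T / real n)" and "C \<equiv> x\<^sup>2 * exp (\<bar>2 * \<delta> + \<theta>\<^sup>2\<bar> * T)"
  assumes sd: "step_data M F n \<tau> (\<lambda>i w. \<theta> * gbm x \<theta> \<delta> (\<tau> i) w)"
  shows "(\<integral>\<^sup>+w. (\<integral>\<^sup>+u\<in>{0..T}. ennreal ((step_process n \<tau> (\<lambda>i w. \<theta> * gbm x \<theta> \<delta> (\<tau> i) w) u w - \<theta> * gbm x \<theta> \<delta> u w)\<^sup>2) \<partial>lborel) \<partial>M)
    \<le> ennreal (\<theta>\<^sup>2 * (C * ((exp (\<bar>2 * \<delta> + \<theta>\<^sup>2\<bar> * (T / real n)) - 1) + 2 * (exp (\<bar>\<delta>\<bar> * (T / real n)) - 1))) * T)"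
    (is "_ \<le> ennreal (?Q * T)")
proof -
  interpret P: pair_sigma_finite M lborel ..
  let ?h = "T / real n"
  let ?S = "gbm x \<theta> \<delta>"
  let ?P = "step_process n \<tau> (\<lambda>i w. \<theta> * ?S (\<tau> i) w)"
  have h: "0 < ?h" using T n by simp
  have eq: "(\<lambda>(w, u). indicator {0..T} u * (?P u w - \<theta> * ?S u w))
      = (\<lambda>x. (case x of (w, u) \<Rightarrow> indicator {0..T} u * ?P u w) - (case x of (w, u) \<Rightarrow> indicator {0..T} u * (\<theta> * ?S u w)))"
    by (simp add: fun_eq_iff right_diff_distrib)
  have m2: "(\<lambda>(w, u). indicator {0..T} u * (\<theta> * ?S u w)) \<in> borel_measurable (M \<Otimes>\<^sub>M lborel)"
    using jointly_measurable_slab[OF gbm_jointly_measurable[of "\<theta> * x" \<theta> \<delta>], of "{0..T}"]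
    by (simp flip: gbm_scale)
  have m: "(\<lambda>(w, u). indicator {0..T} u * (?P u w - \<theta> * ?S u w)) \<in> borel_measurable (M \<Otimes>\<^sub>M lborel)"
    unfolding eq by (intro borel_measurable_diff step_process_slab_measurable[OF sd] m2)
  have m': "(\<lambda>(w, u). ennreal ((indicator {0..T} u * (?P u w - \<theta> * ?S u w))\<^sup>2)) \<in> borel_measurable (M \<Otimes>\<^sub>M lborel)"
    using measurable_compose[OF borel_measurable_power[OF m, of 2] measurable_ennreal] by (simp add: split_beta')
  \<comment> \<open>The time u = 0 lies in no cell, and the step process vanishes there; a single
    point does not affect the time integral.\<close>
  have E: "(\<integral>\<^sup>+w. ennreal ((indicator {0..T} u * (?P u w - \<theta> * ?S u w))\<^sup>2) \<partial>M) \<le> ennreal ?Q * indicator {0..T} u"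
    if "u \<noteq> 0" for u
  proof (cases "0 \<le> u \<and> u \<le> T")
    case True
    then have u: "0 < u" "u \<le> real n * ?h" using that n by auto
    obtain i where i: "i < n" "real i * ?h < u" "u \<le> real (Suc i) * ?h"
      using uniform_grid_cell[OF h u] .
    have P: "?P u w = \<theta> * ?S (\<tau> i) w" for w
    proof -
      have "indicator {\<tau> j<..\<tau> (Suc j)} u = (if j = i then 1 else 0 :: real)" for j
      proof -
        have "\<not> (\<tau> j < u \<and> u \<le> \<tau> (Suc j))" if "j \<noteq> i"
        proof (cases "j < i")
          case True
          then have "\<tau> (Suc j) \<le> \<tau> i" unfolding \<tau>_def using h by (intro mult_right_mono) auto
          then show ?thesis using i(2) by (simp add: \<tau>_def)
        next
          case False
          then have "\<tau> (Suc i) \<le> \<tau> j" unfolding \<tau>_def using h that by (intro mult_right_mono) auto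
          then show ?thesis using i(3) by (simp add: \<tau>_def)
        qed
        then show ?thesis using i(2,3) by (auto simp: indicator_def \<tau>_def)
      qed
      moreover have "(\<Sum>j<n. a j * (if j = i then 1 else 0)) = a i" for a :: "nat \<Rightarrow> real"
        using i(1) by (subst sum.remove[of _ i]) auto
      ultimately show ?thesis unfolding step_process_def by (simp only:)
    qed
    have s: "0 \<le> \<tau> i" "\<tau> i \<le> u" "\<tau> i \<le> T" "u - \<tau> i \<le> ?h" using i h True by (auto simp: \<tau>_def algebra_simps add_divide_distrib)
    let ?\<alpha> = "2 * \<delta> + \<theta>\<^sup>2"
    let ?q = "exp (?\<alpha> * (u - \<tau> i)) - 2 * exp (\<delta> * (u - \<tau> i)) + 1"
    have bb: "\<bar>exp (\<alpha> * (u - \<tau> i)) - 1\<bar> \<le> exp (\<bar>\<alpha>\<bar> * ?h) - 1" for \<alpha>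
    proof -
      have "\<bar>\<alpha> * (u - \<tau> i)\<bar> \<le> \<bar>\<alpha>\<bar> * ?h" 
        unfolding abs_mult using s by (intro mult_left_mono) auto
      with abs_exp_minus_one_le[of "\<alpha> * (u - \<tau> i)"] show ?thesis
        by (meson diff_right_mono exp_le_cancel_iff order_trans)
    qed
    \<comment> \<open>\<open>?q\<close> is the difference of exp(..) - 1 for the first exponent and
      twice exp(..) - 1 for the second; each is bounded in absolute value at the full mesh by
      \<open>bb\<close>.\<close>
    have q: "?q \<le> (exp (\<bar>?\<alpha>\<bar> * ?h) - 1) + 2 * (exp (\<bar>\<delta>\<bar> * ?h) - 1)"
    proof -
      have "A - 1 \<le> P \<Longrightarrow> - (B - 1) \<le> Q \<Longrightarrow> A - 2 * B + 1 \<le> P + 2 * Q" for A B P Q :: real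
        by linarith
      then show ?thesis using abs_le_D1[OF bb[of ?\<alpha>]] abs_le_D2[OF bb[of \<delta>]] by blast
    qed
    have d: "has_bochner_integral M (\<lambda>w. (?S u w - ?S (\<tau> i) w)\<^sup>2) (x\<^sup>2 * exp (?\<alpha> * \<tau> i) * ?q)"
      using gbm_difference_sq_mean[OF s(1,2), of 1 x \<theta> \<delta>] by simp
    have "(\<integral>\<^sup>+w. ennreal ((indicator {0..T} u * (?P u w - \<theta> * ?S u w))\<^sup>2) \<partial>M)
      = (\<integral>\<^sup>+w. ennreal (\<theta>\<^sup>2 * (?S u w - ?S (\<tau> i) w)\<^sup>2) \<partial>M)"
      unfolding P using True
      by (intro nn_integral_cong arg_cong[where f=ennreal]) (simp add: power2_eq_square algebra_simps)
    also have "\<dots> = ennreal (\<theta>\<^sup>2 * (x\<^sup>2 * exp (?\<alpha> * \<tau> i) * ?q))"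
      using has_bochner_integral_mult_right[OF d, of "\<theta>\<^sup>2"]
      by (subst nn_integral_eq_integral) (auto simp: has_bochner_integral_iff)
    also have "\<dots> \<le> ennreal ?Q"
    proof (intro ennreal_leI mult_left_mono)
      have "x\<^sup>2 * exp (?\<alpha> * \<tau> i) * ?q \<le> x\<^sup>2 * exp (?\<alpha> * \<tau> i) * ((exp (\<bar>?\<alpha>\<bar> * ?h) - 1) + 2 * (exp (\<bar>\<delta>\<bar> * ?h) - 1))"
        using q by (intro mult_left_mono) auto
      also have "\<dots> \<le> C * ((exp (\<bar>?\<alpha>\<bar> * ?h) - 1) + 2 * (exp (\<bar>\<delta>\<bar> * ?h) - 1))"
        unfolding C_def using T exp_mult_le_abs[OF s(1,3), of ?\<alpha>]
        by (intro mult_right_mono mult_left_mono add_nonneg_nonneg) auto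
      finally show "x\<^sup>2 * exp (?\<alpha> * \<tau> i) * ?q \<le> C * ((exp (\<bar>?\<alpha>\<bar> * ?h) - 1) + 2 * (exp (\<bar>\<delta>\<bar> * ?h) - 1))" .
    qed simp
    finally show ?thesis using True by simp
  qed auto
  have "(\<integral>\<^sup>+w. (\<integral>\<^sup>+u\<in>{0..T}. ennreal ((?P u w - \<theta> * ?S u w)\<^sup>2) \<partial>lborel) \<partial>M)
     = (\<integral>\<^sup>+w. (\<integral>\<^sup>+u. ennreal ((indicator {0..T} u * (?P u w - \<theta> * ?S u w))\<^sup>2) \<partial>lborel) \<partial>M)"
    by (intro nn_integral_cong) (auto simp: indicator_def)
  also have "\<dots> = (\<integral>\<^sup>+u. (\<integral>\<^sup>+w. ennreal ((indicator {0..T} u * (?P u w - \<theta> * ?S u w))\<^sup>2) \<partial>M) \<partial>lborel)"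
    using P.Fubini[OF m'] by simp
  also have "\<dots> \<le> (\<integral>\<^sup>+u. ennreal ?Q * indicator {0..T} u \<partial>lborel)"
    by (rule nn_integral_mono_AE, rule eventually_mono[OF AE_lborel_singleton[of 0]], rule E)
  also have "\<dots> = ennreal (?Q * T)"
    using T by (simp add: nn_integral_cmult ennreal_mult'')
  finally show ?thesis .
qed

lemma gbm_ito_integral:
  "ito_integral M F W (\<lambda>t w. \<theta> * gbm x \<theta> \<delta> t w) (gbm_ito x \<theta> \<delta>)"
proof -
  let ?S = "gbm x \<theta> \<delta>"
  have approx: "\<exists>n \<tau> \<xi>. (\<forall>k::nat. step_data M F (n k) (\<tau> k) (\<xi> k)) \<and>
        (\<lambda>k. \<integral>\<^sup>+w. (\<integral>\<^sup>+t\<in>{0..T}.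
               ennreal ((step_process (n k) (\<tau> k) (\<xi> k) t w - \<theta> * ?S t w)\<^sup>2) \<partial>lborel) \<partial>M)
          \<longlonglongrightarrow> 0 \<and>
        (\<lambda>k. \<integral>\<^sup>+w. ennreal ((step_integral W (n k) (\<tau> k) (\<xi> k) T w - gbm_ito x \<theta> \<delta> T w)\<^sup>2) \<partial>M)
          \<longlonglongrightarrow> 0" if "0 \<le> T" for T
  \<comment> \<open>For T = 0 a uniform grid would degenerate, while step data must increase
    strictly; the empty step process is used instead.\<close>
  proof (cases "T = 0")
    case True
    have "gbm_ito x \<theta> \<delta> 0 w = 0" if "w \<in> space M" for w
      using gbm_ito_telescope[OF that, of "\<lambda>_. 0" 0 x \<theta> \<delta>] by simp
    then have "(\<integral>\<^sup>+w. ennreal ((step_integral W 0 (\<lambda>_. 0) (\<lambda>_ _. 0) T w - gbm_ito x \<theta> \<delta> T w)\<^sup>2) \<partial>M) = (\<integral>\<^sup>+w. 0 \<partial>M)"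
      using True by (intro nn_integral_cong) (simp add: step_integral_def)
    moreover have "(\<integral>\<^sup>+t\<in>{0..T}. f t \<partial>lborel) = 0" for f :: "real \<Rightarrow> ennreal"
    proof -
      have "(\<integral>\<^sup>+t\<in>{0..T}. f t \<partial>lborel) = (\<integral>\<^sup>+t. 0 \<partial>(lborel :: real measure))"
        using AE_lborel_singleton[of 0] True
        by (intro nn_integral_cong_AE) (auto elim!: eventually_mono simp: indicator_def)
      then show ?thesis by simp
    qed
    ultimately show ?thesis
      by (intro exI[of _ "\<lambda>_. 0"] exI[of _ "\<lambda>_ _. 0"] exI[of _ "\<lambda>_ _ _. 0"]) (simp add: step_data_def)
  next
    case False
    then have T: "0 < T" using that by simp
    define \<tau> where "\<tau> k i = real i * (T / real (Suc k))" for k i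
    define \<xi> where "\<xi> k i w = \<theta> * ?S (\<tau> k i) w" for k i w
    have sd: "step_data M F (Suc k) (\<tau> k) (\<xi> k)" for k
    proof -
      have p: "0 \<le> \<tau> k i" for i using T by (simp add: \<tau>_def)
      have "\<tau> k i < \<tau> k (Suc i)" for i using T by (auto simp: \<tau>_def intro!: divide_strict_right_mono)
      moreover have "\<xi> k i \<in> borel_measurable (F (\<tau> k i))" for i
        unfolding \<xi>_def using gbm_measurable_F[OF p order.refl] by measurable
      moreover have "integrable M (\<lambda>w. (\<xi> k i w)\<^sup>2)" for i
        unfolding \<xi>_def power_mult_distrib using gbm_sq_mean[OF p, of x \<theta> \<delta>] by (simp add: has_bochner_integral_iff)
      ultimately show ?thesis using p by (simp add: step_data_def)
    qed
    let ?C = "x\<^sup>2 * exp (\<bar>2 * \<delta> + \<theta>\<^sup>2\<bar> * T)"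
    have h0: "(\<lambda>k. c * (T / real (Suc k))) \<longlonglongrightarrow> 0" for c
      using tendsto_mult_right_zero[OF LIMSEQ_inverse_real_of_nat, of "c * T"] by (simp add: field_simps)
    have e0: "(\<lambda>k. exp (c * (T / real (Suc k))) - 1) \<longlonglongrightarrow> 0" for c
      using tendsto_diff[OF tendsto_exp[OF h0[of c]] tendsto_const[of 1]] by simp
    have "(\<lambda>k. ennreal (\<theta>\<^sup>2 * (?C * ((exp (\<bar>2 * \<delta> + \<theta>\<^sup>2\<bar> * (T / real (Suc k))) - 1)
         + 2 * (exp (\<bar>\<delta>\<bar> * (T / real (Suc k))) - 1))) * T)) \<longlonglongrightarrow> ennreal (\<theta>\<^sup>2 * (?C * (0 + 2 * 0)) * T)"
      by (intro tendsto_ennrealI tendsto_intros e0)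
    then have b1: "(\<lambda>k. ennreal (\<theta>\<^sup>2 * (?C * ((exp (\<bar>2 * \<delta> + \<theta>\<^sup>2\<bar> * (T / real (Suc k))) - 1)
         + 2 * (exp (\<bar>\<delta>\<bar> * (T / real (Suc k))) - 1))) * T)) \<longlonglongrightarrow> 0" by simp
    have l1: "(\<lambda>k. \<integral>\<^sup>+w. (\<integral>\<^sup>+t\<in>{0..T}.
               ennreal ((step_process (Suc k) (\<tau> k) (\<xi> k) t w - \<theta> * ?S t w)\<^sup>2) \<partial>lborel) \<partial>M) \<longlonglongrightarrow> 0"
    proof (rule tendsto_sandwich[OF _ _ tendsto_const b1])
      show "\<forall>\<^sub>F k in sequentially. (\<integral>\<^sup>+w. (\<integral>\<^sup>+t\<in>{0..T}.
               ennreal ((step_process (Suc k) (\<tau> k) (\<xi> k) t w - \<theta> * ?S t w)\<^sup>2) \<partial>lborel) \<partial>M)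
         \<le> ennreal (\<theta>\<^sup>2 * (?C * ((exp (\<bar>2 * \<delta> + \<theta>\<^sup>2\<bar> * (T / real (Suc k))) - 1)
         + 2 * (exp (\<bar>\<delta>\<bar> * (T / real (Suc k))) - 1))) * T)"
        using gbm_step_process_error[OF T zero_less_Suc sd[unfolded \<tau>_def \<xi>_def]]
        unfolding \<tau>_def \<xi>_def by (intro always_eventually allI)
    qed simp
    let ?y = "\<lambda>k. \<theta>\<^sup>2 * (T / real (Suc k))"
    have ey: "(\<lambda>k. real (Suc k) * (?C * (exp (?y k) - 1 - ?y k))) \<longlonglongrightarrow> 0"
    proof (rule tendsto_sandwich[where f="\<lambda>_. 0" and h="\<lambda>k. ?C * (\<theta>\<^sup>2 * T) * ?y k"])
      show "\<forall>\<^sub>F k in sequentially. 0 \<le> real (Suc k) * (?C * (exp (?y k) - 1 - ?y k))"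
      proof (intro always_eventually allI mult_nonneg_nonneg)
        show "0 \<le> exp (?y k) - 1 - ?y k" for k using exp_ge_add_one_self[of "?y k"] by linarith
      qed auto
      \<comment> \<open>The quadratic bound exp y - 1 - y \<le> y^2 is used on [0, 1]. One factor y
        absorbs the number of cells, since \<open>real (Suc k) * ?y k\<close> is constant; the other
        tends to 0.\<close>
      have "\<forall>\<^sub>F k in sequentially. ?y k < 1" using order_tendstoD(2)[OF h0[of "\<theta>\<^sup>2"], of 1] by simp
      then show "\<forall>\<^sub>F k in sequentially. real (Suc k) * (?C * (exp (?y k) - 1 - ?y k)) \<le> ?C * (\<theta>\<^sup>2 * T) * ?y k"
      proof eventually_elim
        case (elim k)
        have "0 \<le> ?y k" using T by simp
        with elim have "exp (?y k) - 1 - ?y k \<le> (?y k)\<^sup>2" using exp_bound[of "?y k"] by simp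
        then have "real (Suc k) * (?C * (exp (?y k) - 1 - ?y k)) \<le> real (Suc k) * (?C * (?y k)\<^sup>2)"
          by (intro mult_left_mono) auto
        also have "\<dots> = ?C * (real (Suc k) * ?y k) * ?y k" by (simp add: power2_eq_square mult_ac)
        also have "real (Suc k) * ?y k = \<theta>\<^sup>2 * T" by (simp del: of_nat_Suc)
        finally show ?case .
      qed
      show "(\<lambda>k. ?C * (\<theta>\<^sup>2 * T) * ?y k) \<longlonglongrightarrow> 0"
        by (intro tendsto_mult_right_zero h0)
    qed simp
    have "(\<lambda>k. ennreal (2 * (real (Suc k) * (?C * (exp (?y k) - 1 - ?y k))) + 2 * \<delta>\<^sup>2 * (T\<^sup>2 * (?C * (exp (?y k) - 1)))))
       \<longlonglongrightarrow> ennreal (2 * 0 + 2 * \<delta>\<^sup>2 * (T\<^sup>2 * (?C * 0)))"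
      by (intro tendsto_ennrealI tendsto_intros ey e0)
    then have b2: "(\<lambda>k. ennreal (2 * (real (Suc k) * (?C * (exp (?y k) - 1 - ?y k))) + 2 * \<delta>\<^sup>2 * (T\<^sup>2 * (?C * (exp (?y k) - 1)))))
       \<longlonglongrightarrow> 0" by simp
    have l2: "(\<lambda>k. \<integral>\<^sup>+w. ennreal ((step_integral W (Suc k) (\<tau> k) (\<xi> k) T w - gbm_ito x \<theta> \<delta> T w)\<^sup>2) \<partial>M) \<longlonglongrightarrow> 0"
    proof (rule tendsto_sandwich[OF _ _ tendsto_const b2])
      show "\<forall>\<^sub>F k in sequentially. (\<integral>\<^sup>+w. ennreal ((step_integral W (Suc k) (\<tau> k) (\<xi> k) T w - gbm_ito x \<theta> \<delta> T w)\<^sup>2) \<partial>M)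
         \<le> ennreal (2 * (real (Suc k) * (?C * (exp (?y k) - 1 - ?y k))) + 2 * \<delta>\<^sup>2 * (T\<^sup>2 * (?C * (exp (?y k) - 1))))"
        using gbm_step_integral_error[OF T zero_less_Suc]
        unfolding \<tau>_def \<xi>_def by (intro always_eventually allI)
    qed simp
    show ?thesis
      using sd l1 l2 by (intro exI[of _ Suc] exI[of _ \<tau>] exI[of _ \<xi>]) blast
  qed
  moreover have "(\<lambda>t w. \<theta> * ?S t w) \<in> L2_loc M F" unfolding gbm_scale by (rule gbm_L2_loc)
  moreover have "adapted F (gbm_ito x \<theta> \<delta>)" using gbm_ito_adapted by (simp add: adapted_def)
  moreover have "continuous_paths M (gbm_ito x \<theta> \<delta>)"
    unfolding continuous_paths_def by (intro AE_I2 gbm_ito_continuous)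
  ultimately show ?thesis unfolding ito_integral_def by blast
qed

end

section \<open>Duality\<close>

text \<open>The negated discounted utility, nonnegative for \<gamma> > 1, so that the duality can be
  carried out with extended nonnegative integrals and zero consumption costs infinity.\<close>

definition disutility :: "real \<Rightarrow> real \<Rightarrow> real \<Rightarrow> real \<Rightarrow> ennreal" where
  "disutility \<rho> \<gamma> s y = e2ennreal (- (ereal (exp (- \<rho> * s)) * utility \<gamma> y))"

lemma disutility_pos:
  assumes "y > 0"
  shows "disutility \<rho> \<gamma> s y = ennreal (exp (- \<rho> * s) * (y powr (1 - \<gamma>) / (\<gamma> - 1)))"
proof -
  have "- (ereal (exp (- \<rho> * s)) * utility \<gamma> y) = ereal (exp (- \<rho> * s) * (y powr (1 - \<gamma>) / (\<gamma> - 1)))"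
  proof -
    have "- (y powr (1 - \<gamma>) / (1 - \<gamma>)) = y powr (1 - \<gamma>) / (\<gamma> - 1)"
      by (metis minus_diff_eq minus_divide_right)
    moreover have "- (ereal u * ereal v) = ereal (u * - v)" for u v by simp
    ultimately show ?thesis using assms by (simp only: utility_def if_False less_imp_neq[symmetric] not_False_eq_True)
  qed
  then show ?thesis by (simp add: disutility_def)
qed

lemma disutility_0: "disutility \<rho> \<gamma> s 0 = \<infinity>"
  by (simp add: disutility_def utility_def)

lemma disutility_measurable:
  "(\<lambda>x. disutility \<rho> \<gamma> (fst x) (snd x)) \<in> borel_measurable (borel \<Otimes>\<^sub>M borel)"
  unfolding disutility_def utility_def by measurable

lemma Bernoulli_powr_neg:
  fixes z p :: real
  assumes "0 < z" "p \<le> 0"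
  shows "1 + p * (z - 1) \<le> z powr p"
proof -
  have "p * (z - 1) \<le> p * ln z" using assms ln_le_minus_one[of z] by (simp add: mult_left_mono_neg)
  also have "1 + p * ln z \<le> exp (p * ln z)" by (rule exp_ge_add_one_self)
  finally show ?thesis using assms by (simp add: powr_def)
qed

text \<open>The function y powr (1 - \<gamma>) / (\<gamma> - 1) is convex with slope - z powr (-
  \<gamma>) at z. The tangent there is rearranged without subtraction, so that it survives in
  \<open>ennreal\<close>; collecting the terms in z produces the factor \<gamma>.\<close>

lemma power_utility_tangent:
  fixes \<gamma> y z :: real
  assumes "0 < y" "0 < z" "1 < \<gamma>"
  shows "\<gamma> * (z powr (1 - \<gamma>) / (\<gamma> - 1)) \<le> y powr (1 - \<gamma>) / (\<gamma> - 1) + z powr (- \<gamma>) * y"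
proof -
  have zz: "z powr (1 - \<gamma>) = z powr (- \<gamma>) * z"
    using assms by (simp add: powr_diff powr_minus field_simps)
  have "1 + (1 - \<gamma>) * (y / z - 1) \<le> (y / z) powr (1 - \<gamma>)"
    using assms by (intro Bernoulli_powr_neg) auto
  also have "\<dots> = y powr (1 - \<gamma>) / z powr (1 - \<gamma>)" using assms by (simp add: powr_divide)
  finally have "z powr (1 - \<gamma>) * (1 + (1 - \<gamma>) * (y / z - 1)) \<le> y powr (1 - \<gamma>)"
    using assms by (simp add: field_simps)
  moreover have "z powr (1 - \<gamma>) * (1 + (1 - \<gamma>) * (y / z - 1)) = \<gamma> * z powr (1 - \<gamma>) - (\<gamma> - 1) * (z powr (- \<gamma>) * y)"
    unfolding zz using assms by (simp add: field_simps)
  ultimately have "\<gamma> * z powr (1 - \<gamma>) \<le> y powr (1 - \<gamma>) + (\<gamma> - 1) * (z powr (- \<gamma>) * y)" by simp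
  then have "\<gamma> * z powr (1 - \<gamma>) / (\<gamma> - 1) \<le> (y powr (1 - \<gamma>) + (\<gamma> - 1) * (z powr (- \<gamma>) * y)) / (\<gamma> - 1)"
    using assms by (intro divide_right_mono) auto
  then show ?thesis using assms by (simp add: add_divide_distrib)
qed

lemma objective_disutility:
  "objective M \<rho> \<gamma> c = - enn2ereal (\<integral>\<^sup>+w. (\<integral>\<^sup>+s\<in>{0..}. disutility \<rho> \<gamma> s (c s w) \<partial>lborel) \<partial>M)"
  by (simp add: objective_def disutility_def)

context brownian
begin

section \<open>Admissibility and disutility of the candidate\<close>

lemma gbm_L1_loc_nonneg:
  assumes "0 \<le> x"
  shows "gbm x \<theta> \<delta> \<in> L1_loc_nonneg M F"
proof -
  let ?S = "gbm x \<theta> \<delta>"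
  have S0: "0 \<le> ?S t w" for t w using assms by (simp add: gbm_def)
  have "(\<integral>\<^sup>+w. (\<integral>\<^sup>+t\<in>{0..R}. ennreal \<bar>?S t w\<bar> \<partial>lborel) \<partial>M) < \<infinity>" for R
  proof -
    have "integrable (M \<Otimes>\<^sub>M lborel) (\<lambda>(w, u). 1 * (indicator {0..R} u * (exp (- 0 * u) * ?S u w)))"
      by (intro slab_mult_integrable L2_loc_slab_measurable L2_loc_slab_integrable gbm_L2_loc) auto
    then have i: "integrable (M \<Otimes>\<^sub>M lborel) (\<lambda>(w, u). indicator {0..R} u * ?S u w)" by simp
    then have m: "(\<lambda>x. ennreal (norm (case x of (w, u) \<Rightarrow> indicator {0..R} u * ?S u w))) \<in> borel_measurable (M \<Otimes>\<^sub>M lborel)"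
      by simp
    have "(\<integral>\<^sup>+w. (\<integral>\<^sup>+t\<in>{0..R}. ennreal \<bar>?S t w\<bar> \<partial>lborel) \<partial>M)
      = (\<integral>\<^sup>+x. ennreal (norm (case x of (w, u) \<Rightarrow> indicator {0..R} u * ?S u w)) \<partial>(M \<Otimes>\<^sub>M lborel))"
      by (subst lborel.nn_integral_fst[OF m, symmetric])
        (auto simp: indicator_def intro!: nn_integral_cong)
    also have "\<dots> < \<infinity>" using i by (simp add: integrable_iff_bounded)
    finally show ?thesis .
  qed
  then show ?thesis
    using S0 gbm_adapted gbm_jointly_measurable by (simp add: L1_loc_nonneg_def L1_loc_def)
qed

text \<open>Constant proportions: consuming k times wealth and holding \<theta> / \<sigma> times
  wealth makes the drift rate r + lam * \<theta> - k and the volatility \<theta>, for which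
  \<open>gbm_ito\<close> is the stochastic integral.\<close>

lemma gbm_wealth_process:
  assumes \<sigma>: "\<sigma> \<noteq> 0" and \<delta>: "\<delta> = r + lam * \<theta> - k"
  shows "wealth_process M F W r \<sigma> lam x (gbm (k * x) \<theta> \<delta>) (gbm (\<theta> / \<sigma> * x) \<theta> \<delta>) (gbm x \<theta> \<delta>)"
proof -
  let ?S = "gbm x \<theta> \<delta>"
  have H: "(\<lambda>t w. \<sigma> * gbm (\<theta> / \<sigma> * x) \<theta> \<delta> t w) = (\<lambda>t w. \<theta> * ?S t w)"
    using \<sigma> by (simp add: fun_eq_iff gbm_def)
  have f: "r * ?S s w + \<sigma> * lam * gbm (\<theta> / \<sigma> * x) \<theta> \<delta> s w - gbm (k * x) \<theta> \<delta> s w = \<delta> * ?S s w" for s w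
    using \<sigma> by (simp add: gbm_def \<delta> algebra_simps)
  have "AE w in M. \<forall>t\<ge>0. set_integrable lborel {0..t} (\<lambda>s. \<delta> * ?S s w) \<and>
           ?S t w = x + (LINT s:{0..t}|lborel. \<delta> * ?S s w) + gbm_ito x \<theta> \<delta> t w"
    by (rule AE_I2) (auto simp: gbm_ito_def intro!: set_integrable_mult_right gbm_set_integrable)
  moreover have "continuous_paths M ?S"
    unfolding continuous_paths_def by (intro AE_I2 gbm_continuous)
  ultimately show ?thesis
    unfolding wealth_process_def H f using gbm_adapted gbm_ito_integral by blast
qed

lemma gbm_admissible:
  assumes "\<sigma> \<noteq> 0" "\<delta> = r + lam * \<theta> - k" "0 \<le> x" "0 \<le> k"
  shows "(gbm (k * x) \<theta> \<delta>, gbm (\<theta> / \<sigma> * x) \<theta> \<delta>) \<in> admissible M F W r \<sigma> lam x"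
proof -
  have "0 \<le> gbm x \<theta> \<delta> t w" for t w using assms by (simp add: gbm_def)
  then show ?thesis
    unfolding admissible_def
    using gbm_wealth_process[OF assms(1,2), of x] gbm_L1_loc_nonneg[of "k * x" \<theta> \<delta>] gbm_L2_loc assms
    by auto
qed

lemma disutility_slab_measurable:
  assumes "jointly_measurable M c"
  shows "(\<lambda>(w, s). disutility \<rho> \<gamma> s (c s w) * indicator {0..} s) \<in> borel_measurable (M \<Otimes>\<^sub>M lborel)"
proof -
  note [measurable] = jointly_measurable_slab[OF assms, of "{0..}"] disutility_measurable
  have "(\<lambda>x. (snd x, case x of (w, s) \<Rightarrow> indicator {0..} s * c s w)) \<in> measurable (M \<Otimes>\<^sub>M lborel) (borel \<Otimes>\<^sub>M borel)"
    by measurable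
  from measurable_compose[OF this disutility_measurable[of \<rho> \<gamma>]]
  have "(\<lambda>x. disutility \<rho> \<gamma> (snd x) (case x of (w, s) \<Rightarrow> indicator {0..} s * c s w)) \<in> borel_measurable (M \<Otimes>\<^sub>M lborel)"
    by simp
  then have "(\<lambda>x. disutility \<rho> \<gamma> (snd x) (case x of (w, s) \<Rightarrow> indicator {0..} s * c s w) * indicator {0..} (snd x)) \<in> borel_measurable (M \<Otimes>\<^sub>M lborel)"
    by measurable
  also have "(\<lambda>x. disutility \<rho> \<gamma> (snd x) (case x of (w, s) \<Rightarrow> indicator {0..} s * c s w) * indicator {0..} (snd x))
     = (\<lambda>(w, s). disutility \<rho> \<gamma> s (c s w) * indicator {0..} s)"
    by (auto simp: fun_eq_iff indicator_def)
  finally show ?thesis .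
qed

text \<open>The left side of the hypothesis \<open>e\<close> is the exponential rate of the mean
  disutility: time preference, deterministic growth, and the Gaussian moment of exp((1 - \<gamma>) *
  \<theta> * W). The mean thus decays like exp(- k * s), which integrates to 1 / k.\<close>

lemma gbm_disutility:
  assumes \<gamma>: "1 < \<gamma>" and z: "0 < z" and k: "0 < k"
    and e: "- \<rho> + (1 - \<gamma>) * (\<delta> - \<theta>\<^sup>2 / 2) + ((1 - \<gamma>) * \<theta>)\<^sup>2 / 2 = - k"
  shows "(\<integral>\<^sup>+w. (\<integral>\<^sup>+s\<in>{0..}. disutility \<rho> \<gamma> s (gbm z \<theta> \<delta> s w) \<partial>lborel) \<partial>M)
    = ennreal (z powr (1 - \<gamma>) / (\<gamma> - 1) / k)"
proof -
  interpret P: pair_sigma_finite M lborel ..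
  let ?A = "z powr (1 - \<gamma>) / (\<gamma> - 1)"
  let ?b = "- \<rho> + (1 - \<gamma>) * (\<delta> - \<theta>\<^sup>2 / 2)"
  have pos: "0 < gbm z \<theta> \<delta> s w" for s w using z by (simp add: gbm_def)
  have d: "disutility \<rho> \<gamma> s (gbm z \<theta> \<delta> s w) = ennreal (?A * exp (?b * s) * exp ((1 - \<gamma>) * \<theta> * W s w))" for s w
  proof -
    have g: "gbm z \<theta> \<delta> s w = z * exp ((\<delta> - \<theta>\<^sup>2 / 2) * s + \<theta> * W s w)"
      unfolding gbm_def G_def by (simp add: mult.assoc algebra_simps flip: exp_add)
    have "(gbm z \<theta> \<delta> s w) powr (1 - \<gamma>) = z powr (1 - \<gamma>) * exp ((1 - \<gamma>) * ((\<delta> - \<theta>\<^sup>2 / 2) * s + \<theta> * W s w))"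
      unfolding g powr_mult by (simp add: powr_def)
    moreover have "exp (- \<rho> * s) * exp ((1 - \<gamma>) * ((\<delta> - \<theta>\<^sup>2 / 2) * s + \<theta> * W s w)) = exp (?b * s) * exp ((1 - \<gamma>) * \<theta> * W s w)"
      unfolding exp_add[symmetric] by (rule arg_cong[where f=exp]) algebra
    moreover have "e * (Z * E / (\<gamma> - 1)) = Z / (\<gamma> - 1) * (e * E)" for e E Z :: real by simp
    ultimately have "exp (- \<rho> * s) * ((gbm z \<theta> \<delta> s w) powr (1 - \<gamma>) / (\<gamma> - 1)) = ?A * exp (?b * s) * exp ((1 - \<gamma>) * \<theta> * W s w)"
      by (simp only: mult.assoc)
    then show ?thesis unfolding disutility_pos[OF pos] by (simp only:)
  qed
  have E: "(\<integral>\<^sup>+w. disutility \<rho> \<gamma> s (gbm z \<theta> \<delta> s w) * indicator {0..} s \<partial>M) = ennreal (?A * exp (- k * s)) * indicator {0..} s" for s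
  proof (cases "0 \<le> s")
    case True
    have "has_bochner_integral M (\<lambda>w. ?A * exp (?b * s) * exp ((1 - \<gamma>) * \<theta> * W s w)) (?A * exp (?b * s) * exp (((1 - \<gamma>) * \<theta>)\<^sup>2 * s / 2))"
      by (intro has_bochner_integral_mult_right exp_W_mean True)
    moreover have "exp (?b * s) * exp (((1 - \<gamma>) * \<theta>)\<^sup>2 * s / 2) = exp (- k * s)"
      unfolding exp_add[symmetric] e[symmetric] by (simp add: algebra_simps)
    ultimately have "has_bochner_integral M (\<lambda>w. ?A * exp (?b * s) * exp ((1 - \<gamma>) * \<theta> * W s w)) (?A * exp (- k * s))"
      by (simp only: mult.assoc)
    then show ?thesis unfolding d using True \<gamma>
      by (simp add: nn_integral_eq_integral has_bochner_integral_iff)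
  qed simp
  have "(\<integral>\<^sup>+w. (\<integral>\<^sup>+s\<in>{0..}. disutility \<rho> \<gamma> s (gbm z \<theta> \<delta> s w) \<partial>lborel) \<partial>M)
      = (\<integral>\<^sup>+s. (\<integral>\<^sup>+w. disutility \<rho> \<gamma> s (gbm z \<theta> \<delta> s w) * indicator {0..} s \<partial>M) \<partial>lborel)"
    using P.Fubini[OF disutility_slab_measurable[OF gbm_jointly_measurable, of \<rho> \<gamma> z \<theta> \<delta>]] by simp
  also have "\<dots> = (\<integral>\<^sup>+s. ennreal (?A * exp (- k * s)) * indicator {0..} s \<partial>lborel)"
    unfolding E ..
  also have "\<dots> = ennreal (0 - (- (?A / k) * exp (- k * 0)))"
  proof (rule nn_integral_FTC_atLeast)
    show "((\<lambda>s. - (?A / k) * exp (- k * s)) has_real_derivative ?A * exp (- k * s)) (at s)" for s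
      using k \<gamma> by (auto intro!: derivative_eq_intros)
    show "0 \<le> ?A * exp (- k * s)" for s using \<gamma> by simp
    have "((\<lambda>s. exp (- k * s)) \<longlongrightarrow> 0) at_top"
      using k by (intro filterlim_compose[OF exp_at_bot] filterlim_tendsto_neg_mult_at_bot[OF tendsto_const] filterlim_ident) auto
    then show "((\<lambda>s. - (?A / k) * exp (- k * s)) \<longlongrightarrow> 0) at_top"
      by (rule tendsto_mult_right_zero)
  qed simp
  also have "\<dots> = ennreal (?A / k)" by simp
  finally show ?thesis .
qed

text \<open>The tangent inequality at the candidate, integrated and combined with the budget
  constraint, gives \<gamma> * V \<le> U + y * x. The disutility of the candidate is a premise
  because its value is needed again for attainment.\<close>

lemma admissible_disutility_ge:
  assumes \<gamma>: "1 < \<gamma>" and x: "0 < x" and k: "0 < k"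
    and \<rho>: "\<gamma> * k = \<rho> - (1 - \<gamma>) * (r + lam\<^sup>2 / (2 * \<gamma>))"
    and adm: "(c, \<pi>) \<in> admissible M F W r \<sigma> lam x"
    and V: "(\<integral>\<^sup>+w. (\<integral>\<^sup>+s\<in>{0..}. disutility \<rho> \<gamma> s (gbm (k * x) (lam / \<gamma>) (r + lam\<^sup>2 / \<gamma> - k) s w) \<partial>lborel) \<partial>M)
      = ennreal ((k * x) powr (- \<gamma>) * x / (\<gamma> - 1))"
  shows "ennreal ((k * x) powr (- \<gamma>) * x / (\<gamma> - 1)) \<le> (\<integral>\<^sup>+w. (\<integral>\<^sup>+s\<in>{0..}. disutility \<rho> \<gamma> s (c s w) \<partial>lborel) \<partial>M)"
    (is "ennreal ?V \<le> ?U")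
proof -
  let ?\<theta> = "lam / \<gamma>" and ?\<delta> = "r + lam\<^sup>2 / \<gamma> - k"
  let ?z = "gbm (k * x) ?\<theta> ?\<delta>" and ?y = "(k * x) powr (- \<gamma>)"
  let ?g = "\<lambda>s w. exp (- r * s) * G (- lam) s w * c s w"
  obtain X where wp: "wealth_process M F W r \<sigma> lam x c \<pi> X" and X0: "AE w in M. \<forall>t\<ge>0. 0 \<le> X t w"
    and c: "c \<in> L1_loc_nonneg M F"
    using adm unfolding admissible_def by blast
  have cm: "jointly_measurable M c" using c by (simp add: L1_loc_nonneg_def L1_loc_def)
  have kx: "0 < k * x" using k x by simp
  have zpos: "0 < ?z s w" for s w using kx by (simp add: gbm_def)
  \<comment> \<open>Marginal utility at the candidate is a constant multiple of the state price;
    this lets the linear tangent term be controlled by the budget constraint.\<close>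
  have price: "exp (- \<rho> * s) * (?z s w) powr (- \<gamma>) = ?y * (exp (- r * s) * G (- lam) s w)" for s w
  proof -
    have g: "?z s w = k * x * exp ((?\<delta> - ?\<theta>\<^sup>2 / 2) * s + ?\<theta> * W s w)"
      unfolding gbm_def G_def by (simp add: mult.assoc algebra_simps flip: exp_add)
    have "(?z s w) powr (- \<gamma>) = ?y * exp ((?\<delta> - ?\<theta>\<^sup>2 / 2) * s + ?\<theta> * W s w) powr (- \<gamma>)"
      unfolding g using kx by (intro powr_mult)
    then have "(?z s w) powr (- \<gamma>) = ?y * exp (- \<gamma> * ((?\<delta> - ?\<theta>\<^sup>2 / 2) * s + ?\<theta> * W s w))"
      by (simp add: powr_def)
    moreover have "- \<rho> * s + - \<gamma> * ((?\<delta> - ?\<theta>\<^sup>2 / 2) * s + ?\<theta> * W s w) = - r * s + (- lam * W s w - (- lam)\<^sup>2 * s / 2)"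
    proof -
      have \<rho>': "\<rho> = \<gamma> * k + (1 - \<gamma>) * (r + lam\<^sup>2 / (2 * \<gamma>))" using \<rho> by simp
      \<comment> \<open>The time coefficients agree through the relation between k and \<rho>; those
        of W agree because \<gamma> * (lam / \<gamma>) = lam.\<close>
      have *: "- \<rho> - \<gamma> * (?\<delta> - ?\<theta>\<^sup>2 / 2) = - r - lam\<^sup>2 / 2"
        unfolding \<rho>' using \<gamma> by (simp add: power2_eq_square field_simps)
      have "- \<rho> * s + - \<gamma> * ((?\<delta> - ?\<theta>\<^sup>2 / 2) * s + ?\<theta> * W s w)
        = (- \<rho> - \<gamma> * (?\<delta> - ?\<theta>\<^sup>2 / 2)) * s - (\<gamma> * ?\<theta>) * W s w"
        by (simp add: left_diff_distrib right_diff_distrib distrib_left mult.assoc)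
      also have "\<dots> = (- r - lam\<^sup>2 / 2) * s - lam * W s w" unfolding * using \<gamma> by simp
      also have "\<dots> = - r * s + (- lam * W s w - (- lam)\<^sup>2 * s / 2)" by (simp add: left_diff_distrib)
      finally show ?thesis .
    qed
    ultimately show ?thesis
      unfolding G_def by (simp only: mult.left_commute[of _ ?y] exp_add[symmetric])
  qed
  have pw: "ennreal \<gamma> * (disutility \<rho> \<gamma> s (?z s w) * indicator {0..} s)
      \<le> disutility \<rho> \<gamma> s (c s w) * indicator {0..} s + ennreal ?y * (ennreal (?g s w) * indicator {0..} s)"
    if "w \<in> space M" for s w
  proof (cases "0 \<le> s")
    case True
    then have c0: "0 \<le> c s w" using c that by (simp add: L1_loc_nonneg_def)
    show ?thesis
    \<comment> \<open>At zero consumption the disutility is infinite, whereas the tangent inequality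
      only covers positive arguments.\<close>
    proof (cases "c s w = 0")
      case True
      then show ?thesis using \<open>0 \<le> s\<close> by (simp add: disutility_0)
    next
      case False
      then have cp: "0 < c s w" using c0 by simp
      have "exp (- \<rho> * s) * (\<gamma> * ((?z s w) powr (1 - \<gamma>) / (\<gamma> - 1)))
         \<le> exp (- \<rho> * s) * ((c s w) powr (1 - \<gamma>) / (\<gamma> - 1) + (?z s w) powr (- \<gamma>) * c s w)"
        using power_utility_tangent[OF cp zpos \<gamma>] by (intro mult_left_mono) auto
      also have "\<dots> = exp (- \<rho> * s) * ((c s w) powr (1 - \<gamma>) / (\<gamma> - 1)) + (exp (- \<rho> * s) * (?z s w) powr (- \<gamma>)) * c s w"
        by (simp only: distrib_left mult.assoc)
      also have "\<dots> = exp (- \<rho> * s) * ((c s w) powr (1 - \<gamma>) / (\<gamma> - 1)) + ?y * ?g s w"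
        unfolding price by (simp only: mult.assoc)
      finally have "ennreal (\<gamma> * (exp (- \<rho> * s) * ((?z s w) powr (1 - \<gamma>) / (\<gamma> - 1))))
         \<le> ennreal (exp (- \<rho> * s) * ((c s w) powr (1 - \<gamma>) / (\<gamma> - 1)) + ?y * ?g s w)"
        by (intro ennreal_leI) (simp only: mult.left_commute[of \<gamma>])
      also have "\<dots> = ennreal (exp (- \<rho> * s) * ((c s w) powr (1 - \<gamma>) / (\<gamma> - 1))) + ennreal ?y * ennreal (?g s w)"
        using \<gamma> c0 by (subst ennreal_plus) (auto simp: ennreal_mult')
      finally have "ennreal \<gamma> * disutility \<rho> \<gamma> s (?z s w) \<le> disutility \<rho> \<gamma> s (c s w) + ennreal ?y * ennreal (?g s w)"
        unfolding disutility_pos[OF zpos] disutility_pos[OF cp] using \<gamma> by (subst ennreal_mult'[symmetric]) auto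
      moreover have "indicator {0..} s = (1 :: ennreal)" using True by simp
      ultimately show ?thesis by (simp only: mult_1_right)
    qed
  qed simp
  have gm: "(\<lambda>(w, s). ennreal (?g s w) * indicator {0..} s) \<in> borel_measurable (M \<Otimes>\<^sub>M lborel)"
  proof -
    note [measurable] = jointly_measurable_slab[OF cm, of "{0..}"] G_slab_measurable[of "{0..}" "- lam"]
    have "(\<lambda>x. ennreal (exp (- r * snd x) * (case x of (w, u) \<Rightarrow> indicator {0..} u * G (- lam) u w) *
        (case x of (w, u) \<Rightarrow> indicator {0..} u * c u w))) \<in> borel_measurable (M \<Otimes>\<^sub>M lborel)"
      by measurable
    also have "(\<lambda>x. ennreal (exp (- r * snd x) * (case x of (w, u) \<Rightarrow> indicator {0..} u * G (- lam) u w) *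
        (case x of (w, u) \<Rightarrow> indicator {0..} u * c u w))) = (\<lambda>(w, s). ennreal (?g s w) * indicator {0..} s)"
      by (auto simp: fun_eq_iff indicator_def)
    finally show ?thesis .
  qed
  note dz = disutility_slab_measurable[OF gbm_jointly_measurable, of \<rho> \<gamma> "k * x" ?\<theta> ?\<delta>]
  note dc = disutility_slab_measurable[OF cm, of \<rho> \<gamma>]
  let ?N = "M \<Otimes>\<^sub>M lborel"
  have "ennreal \<gamma> * ennreal ?V = ennreal \<gamma> * (\<integral>\<^sup>+p. (case p of (w, s) \<Rightarrow> disutility \<rho> \<gamma> s (?z s w) * indicator {0..} s) \<partial>?N)"
    unfolding V[symmetric] using lborel.nn_integral_fst[OF dz] by simp
  also have "\<dots> = (\<integral>\<^sup>+p. ennreal \<gamma> * (case p of (w, s) \<Rightarrow> disutility \<rho> \<gamma> s (?z s w) * indicator {0..} s) \<partial>?N)"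
    by (rule nn_integral_cmult[OF dz, symmetric])
  also have "\<dots> \<le> (\<integral>\<^sup>+p. (case p of (w, s) \<Rightarrow> disutility \<rho> \<gamma> s (c s w) * indicator {0..} s)
      + ennreal ?y * (case p of (w, s) \<Rightarrow> ennreal (?g s w) * indicator {0..} s) \<partial>?N)"
    using pw by (intro nn_integral_mono) (auto simp: space_pair_measure)
  also have "\<dots> = (\<integral>\<^sup>+p. (case p of (w, s) \<Rightarrow> disutility \<rho> \<gamma> s (c s w) * indicator {0..} s) \<partial>?N)
      + ennreal ?y * (\<integral>\<^sup>+p. (case p of (w, s) \<Rightarrow> ennreal (?g s w) * indicator {0..} s) \<partial>?N)"
    using dc gm by (simp add: nn_integral_add nn_integral_cmult)
  also have "\<dots> = ?U + ennreal ?y * (\<integral>\<^sup>+w. (\<integral>\<^sup>+s\<in>{0..}. ennreal (?g s w) \<partial>lborel) \<partial>M)"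
    using lborel.nn_integral_fst[OF dc] lborel.nn_integral_fst[OF gm] by simp
  also have "\<dots> \<le> ?U + ennreal ?y * ennreal x"
    by (intro add_left_mono mult_left_mono budget_constraint[OF wp X0 c]) auto
  finally have main: "ennreal \<gamma> * ennreal ?V \<le> ?U + ennreal ?y * ennreal x" .
  show ?thesis
  proof (cases ?U)
    case (real u)
    have V0: "0 \<le> ?V" using \<gamma> x by simp
    from main have "ennreal (\<gamma> * ?V) \<le> ennreal (u + ?y * x)"
    proof -
      have "ennreal (\<gamma> * ?V) = ennreal \<gamma> * ennreal ?V" using \<gamma> by (intro ennreal_mult') simp
      moreover have "ennreal (u + ?y * x) = ennreal u + ennreal ?y * ennreal x"
        using real x by (subst ennreal_plus) (auto simp: ennreal_mult')
      ultimately show ?thesis using main unfolding real(2) by (simp only:)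
    qed
    then have "\<gamma> * ?V \<le> u + ?y * x"
      using real x by (subst (asm) ennreal_le_iff) auto
    \<comment> \<open>The budget term is exactly \<gamma> - 1 copies of \<open>?V\<close>;
      cancelling them, in the case of finite \<open>?U\<close>, leaves the claim.\<close>
    moreover have "?y * x = (\<gamma> - 1) * ?V" using \<gamma> by simp
    ultimately have "\<gamma> * ?V \<le> u + (\<gamma> - 1) * ?V" by (simp only:)
    moreover have "\<gamma> * v \<le> u + (\<gamma> - 1) * v \<Longrightarrow> v \<le> u" for v by (simp add: algebra_simps)
    ultimately have "?V \<le> u" by blast
    then show ?thesis unfolding real(2) by (rule ennreal_leI)
  qed simp
qed

text \<open>Here k is the optimal ratio of consumption to wealth.
  \<open>admissible_disutility_ge\<close> bounds every strategy by the candidate, and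
  \<open>gbm_admissible\<close> shows that the bound is attained.\<close>

lemma merton_value:
  assumes \<sigma>: "0 < \<sigma>" and \<gamma>: "1 < \<gamma>" and x: "0 < x" and k: "0 < k"
    and \<rho>: "\<gamma> * k = \<rho> - (1 - \<gamma>) * (r + lam\<^sup>2 / (2 * \<gamma>))"
  shows "value_function M F W r \<sigma> lam \<rho> \<gamma> x = ereal (k powr (- \<gamma>) * (x powr (1 - \<gamma>) / (1 - \<gamma>)))"
proof -
  let ?\<theta> = "lam / \<gamma>" and ?\<delta> = "r + lam\<^sup>2 / \<gamma> - k"
  let ?V = "(k * x) powr (- \<gamma>) * x / (\<gamma> - 1)"
  have kx: "0 < k * x" using k x by simp
  have "(k * x) powr (1 - \<gamma>) = (k * x) powr (- \<gamma>) * (k * x)"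
    using kx by (simp add: powr_diff powr_minus field_simps)
  then have eqV: "(k * x) powr (1 - \<gamma>) / (\<gamma> - 1) / k = ?V" using k by simp
  \<comment> \<open>With these \<theta> and \<delta>, the decay rate of the mean disutility equals
    the consumption ratio k itself.\<close>
  have e: "- \<rho> + (1 - \<gamma>) * (?\<delta> - ?\<theta>\<^sup>2 / 2) + ((1 - \<gamma>) * ?\<theta>)\<^sup>2 / 2 = - k"
  proof -
    have \<rho>': "\<rho> = \<gamma> * k + (1 - \<gamma>) * (r + lam\<^sup>2 / (2 * \<gamma>))" using \<rho> by simp
    show ?thesis unfolding \<rho>' using \<gamma> by (simp add: power2_eq_square field_simps)
  qed
  have V: "(\<integral>\<^sup>+w. (\<integral>\<^sup>+s\<in>{0..}. disutility \<rho> \<gamma> s (gbm (k * x) ?\<theta> ?\<delta> s w) \<partial>lborel) \<partial>M) = ennreal ?V"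
    using gbm_disutility[OF \<gamma> kx k e] unfolding eqV .
  have V0: "0 \<le> ?V" using \<gamma> x by simp
  have "- ?V = k powr (- \<gamma>) * (x powr (1 - \<gamma>) / (1 - \<gamma>))"
  proof -
    have "(k * x) powr (- \<gamma>) * x = k powr (- \<gamma>) * x powr (1 - \<gamma>)"
      using k x by (simp add: powr_mult powr_diff powr_minus field_simps)
    then show ?thesis by (metis minus_diff_eq minus_divide_right times_divide_eq_right)
  qed
  then have eq: "ereal (k powr (- \<gamma>) * (x powr (1 - \<gamma>) / (1 - \<gamma>))) = - enn2ereal (ennreal ?V)"
    using V0 by simp
  show ?thesis
    unfolding value_function_def eq
  proof (rule antisym)
    show "(SUP (c, \<pi>)\<in>admissible M F W r \<sigma> lam x. objective M \<rho> \<gamma> c) \<le> - enn2ereal (ennreal ?V)"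
    proof (rule SUP_least, clarify)
      fix c \<pi> assume "(c, \<pi>) \<in> admissible M F W r \<sigma> lam x"
      from admissible_disutility_ge[OF \<gamma> x k \<rho> this V]
      show "objective M \<rho> \<gamma> c \<le> - enn2ereal (ennreal ?V)"
        unfolding objective_disutility ereal_minus_le_minus by (simp add: less_eq_ennreal.rep_eq del: enn2ereal_ennreal)
    qed
    have adm: "(gbm (k * x) ?\<theta> ?\<delta>, gbm (?\<theta> / \<sigma> * x) ?\<theta> ?\<delta>) \<in> admissible M F W r \<sigma> lam x"
      using \<sigma> x k by (intro gbm_admissible) (auto simp: power2_eq_square)
    show "- enn2ereal (ennreal ?V) \<le> (SUP (c, \<pi>)\<in>admissible M F W r \<sigma> lam x. objective M \<rho> \<gamma> c)"
      using SUP_upper[OF adm, of "\<lambda>(c, \<pi>). objective M \<rho> \<gamma> c"] unfolding prod.case objective_disutility V .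
  qed
qed

end

section \<open>Reduction to a version with all paths continuous\<close>

lemma ito_integral_cong_AE:
  assumes "AE w in M. \<forall>t. W t w = W' t w"
  shows "ito_integral M F W H I = ito_integral M F W' H I"
proof -
  have "(\<integral>\<^sup>+w. ennreal ((step_integral W n \<tau> \<xi> T w - I T w)\<^sup>2) \<partial>M)
    = (\<integral>\<^sup>+w. ennreal ((step_integral W' n \<tau> \<xi> T w - I T w)\<^sup>2) \<partial>M)" for n \<tau> \<xi> T
    by (rule nn_integral_cong_AE, rule eventually_mono[OF assms]) (simp add: step_integral_def)
  then show ?thesis unfolding ito_integral_def by simp
qed

text \<open>The Brownian motion enters the value function only through the step integrals inside
  \<open>ito_integral\<close>, and those are compared in mean square.\<close>

lemma value_function_cong_AE:
  assumes "AE w in M. \<forall>t. W t w = W' t w"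
  shows "value_function M F W r \<sigma> lam \<rho> \<gamma> x = value_function M F W' r \<sigma> lam \<rho> \<gamma> x"
  unfolding value_function_def admissible_def wealth_process_def ito_integral_cong_AE[OF assms] ..

text \<open>The process is set to 0 on the null set where continuity or the initial value fails.
  Increments then agree almost surely with the original ones, so their laws and their independence
  of the past carry over.\<close>

lemma (in usual_filtered_prob_space) brownian_version:
  assumes bm: "brownian_motion M F W"
  obtains W' where "brownian M F W'" "AE w in M. \<forall>t. W t w = W' t w"
proof -
  have ad: "\<And>t. 0 \<le> t \<Longrightarrow> W t \<in> borel_measurable (F t)"
    and dist: "\<And>s t. 0 \<le> s \<Longrightarrow> s < t \<Longrightarrow> distributed M lborel (\<lambda>w. W t w - W s w) (normal_density 0 (sqrt (t - s)))"
    and ind: "\<And>s t. 0 \<le> s \<Longrightarrow> s < t \<Longrightarrow>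
      indep_set (sets (F s)) {(\<lambda>w. W t w - W s w) -` B \<inter> space M | B. B \<in> sets borel}"
    using bm unfolding brownian_motion_def adapted_def by auto
  have "AE w in M. continuous_on {0..} (\<lambda>t. W t w) \<and> W 0 w = 0"
    using bm unfolding brownian_motion_def continuous_paths_def by auto
  then obtain N where N: "N \<in> null_sets M" "{w \<in> space M. \<not> (continuous_on {0..} (\<lambda>t. W t w) \<and> W 0 w = 0)} \<subseteq> N"
    unfolding eventually_ae_filter by blast
  define W' where "W' t w = (if w \<in> N then 0 else W t w)" for t w
  have ae: "AE w in M. \<forall>t. W t w = W' t w"
    using AE_not_in[OF N(1)] by eventually_elim (simp add: W'_def)
  \<comment> \<open>Completeness of the filtration keeps the modified process adapted.\<close>
  have NF: "N \<in> sets (F t)" if "0 \<le> t" for t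
    using complete_F[OF N(1) order.refl] mono_F[OF order.refl that] by blast
  have W'ad: "W' t \<in> borel_measurable (F t)" if "0 \<le> t" for t
    unfolding W'_def using NF[OF that] ad[OF that] by (intro measurable_If_set) (auto simp: sets.Int_space_eq1)
  have Wm: "W t \<in> borel_measurable M" "W' t \<in> borel_measurable M" if "0 \<le> t" for t
    using measurable_F_M[OF that] ad[OF that] W'ad[OF that] by auto
  have "brownian M F W'"
  proof unfold_locales
    show "0 \<le> t \<Longrightarrow> W' t \<in> borel_measurable (F t)" for t by (rule W'ad)
    show "continuous_on {0..} (\<lambda>t. W' t w)" "W' 0 w = 0" if "w \<in> space M" for w
      using that N(2) unfolding W'_def by (cases "w \<in> N"; auto)+
    fix s t :: real assume st: "0 \<le> s" "s < t"
    let ?D = "\<lambda>w. W t w - W s w" and ?D' = "\<lambda>w. W' t w - W' s w"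
    have t: "0 \<le> t" using st by simp
    have [measurable]: "?D \<in> borel_measurable M" "?D' \<in> borel_measurable M"
      using Wm[OF st(1)] Wm[OF t] by auto
    have aeD: "AE w in M. ?D w = ?D' w" using ae by eventually_elim simp
    have "distr M lborel ?D = distr M lborel ?D'"
      using aeD by (intro distr_cong_AE) auto
    then show "distributed M lborel ?D' (normal_density 0 (sqrt (t - s)))"
      using dist[OF st] unfolding distributed_def by simp
    show "indep_set (sets (F s)) {?D' -` B \<inter> space M | B. B \<in> sets borel}"
      unfolding indep_sets2_eq
    proof (intro conjI ballI)
      show "sets (F s) \<subseteq> events" using subalgebra_F[OF st(1)] by (simp add: subalgebra_def)
      show "{?D' -` B \<inter> space M | B. B \<in> sets borel} \<subseteq> events"
        using measurable_sets[of ?D' M borel] by auto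
      fix a b assume a: "a \<in> sets (F s)" and "b \<in> {?D' -` B \<inter> space M | B. B \<in> sets borel}"
      then obtain B where b: "b = ?D' -` B \<inter> space M" and B: "B \<in> sets borel" by blast
      let ?b = "?D -` B \<inter> space M"
      have aM: "a \<in> events" using a subalgebra_F[OF st(1)] by (auto simp: subalgebra_def)
      have bM: "b \<in> events" "?b \<in> events" unfolding b using B by (auto intro!: measurable_sets)
      have "prob (a \<inter> b) = prob (a \<inter> ?b)" "prob b = prob ?b"
        using aeD aM bM by (auto intro!: measure_eq_AE elim!: eventually_mono simp: b)
      moreover have "prob (a \<inter> ?b) = prob a * prob ?b"
        using ind[OF st] a B by (intro indep_setD) blast+
      ultimately show "prob (a \<inter> b) = prob a * prob b" by simp
    qed
  qed
  then show thesis using ae by (rule that)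
qed

theorem proposition3p4:
  fixes M :: "'a measure" and F :: "real \<Rightarrow> 'a measure" and W :: "real \<Rightarrow> 'a \<Rightarrow> real"
    and r \<mu> \<rho> \<sigma> lam \<gamma> a :: real
  assumes "usual_filtered_prob_space M F"
    and "brownian_motion M F W"
    and "\<sigma> > 0"
    and "lam = (\<mu> - r) / \<sigma>"
    and "\<gamma> > 1"
    and "\<rho> > (1 - \<gamma>) * (r + lam\<^sup>2 / (2 * \<gamma>))"
    and "a = ((\<rho> - (1 - \<gamma>) * (r + lam\<^sup>2 / (2 * \<gamma>))) / \<gamma>) powr (- \<gamma>)"
  shows "a > 0 \<and>
    (\<forall>x>0. value_function M F W r \<sigma> lam \<rho> \<gamma> x = ereal (a * (x powr (1 - \<gamma>) / (1 - \<gamma>)))) \<and>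
    (\<forall>b>0. (\<forall>x>0. value_function M F W r \<sigma> lam \<rho> \<gamma> x = ereal (b * (x powr (1 - \<gamma>) / (1 - \<gamma>))))
       \<longrightarrow> b = a)"
proof -
  interpret usual_filtered_prob_space M F by fact
  obtain W' where bm: "brownian M F W'" and ae: "AE w in M. \<forall>t. W t w = W' t w"
    using brownian_version[OF assms(2)] .
  define k where "k = (\<rho> - (1 - \<gamma>) * (r + lam\<^sup>2 / (2 * \<gamma>))) / \<gamma>"
  have k: "0 < k" using assms(5,6) by (simp add: k_def)
  have \<rho>: "\<gamma> * k = \<rho> - (1 - \<gamma>) * (r + lam\<^sup>2 / (2 * \<gamma>))" using assms(5) by (simp add: k_def)
  have a: "a = k powr (- \<gamma>)" using assms(7) by (simp add: k_def)
  have val: "value_function M F W r \<sigma> lam \<rho> \<gamma> x = ereal (a * (x powr (1 - \<gamma>) / (1 - \<gamma>)))" if "x > 0" for x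
    unfolding value_function_cong_AE[OF ae] a
    by (rule brownian.merton_value[OF bm assms(3,5) that k \<rho>])
  have "b = a" if "\<forall>x>0. value_function M F W r \<sigma> lam \<rho> \<gamma> x = ereal (b * (x powr (1 - \<gamma>) / (1 - \<gamma>)))" for b
  proof -
    \<comment> \<open>For uniqueness the single point x = 1 suffices, since the factor 1 / (1 -
      \<gamma>) is nonzero.\<close>
    have "ereal (b * (1 powr (1 - \<gamma>) / (1 - \<gamma>))) = ereal (a * (1 powr (1 - \<gamma>) / (1 - \<gamma>)))"
      using that[rule_format, of 1] val[of 1] by (simp only: zero_less_one)
    then show ?thesis using assms(5) by simp
  qed
  moreover have "a > 0" using k by (simp add: a)
  ultimately show ?thesis using val by blast
qed

end
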